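(* Let $\rho=\frac{\lambda z_0}{\ell A}$ and suppose that $\frac{\ell A}{\lambda z_0}=\frac1\rho\in\mathbb{N}$. Let the target vector $X$ be randomly drawn from the target ensemble with sparsity $s\ge 2$ and, independently, let the antenna array be randomly drawn from the sensor ensemble with $n$ sensors. Let $\epsilon\in(0,1)$ and suppose that $$m\le \frac{\delta}{2}\,e^{K^2/2}\quad\text{for some } \delta>0,\ K>0 .$$ If $$s<\frac{n}{64\,\ln\frac{2m}{\delta}\,\ln\frac{m}{\epsilon}},$$ then $X$ is recovered exactly by Basis Pursuit with the source-inversion sensing matrix $\mathbf{A}$, with probability (over the product of the sensor and target ensembles) greater than or equal to $$\left[1-2\delta-\frac{\rho\, n(n-1)^{3/2}}{m^{1/2}}\right]\times\left[1-2\epsilon-s^{-p}\right],\qquad p=\frac{\ln m-\ln\epsilon}{288\sqrt{e}\,\ln s}.$$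
   Context: Fix real numbers $z_0,\ell,A,\lambda>0$ and set $\omega=2\pi/\lambda$. Let $m$ be a perfect square. Target grid: $\mathcal{M}=\{\mathbf r_j=(x_j,y_j,z_0): j=1,\dots,m\}$ is a $\sqrt m\times\sqrt m$ square lattice of mesh size $\ell$ in the plane $\{z=z_0\}$. Sensor ensemble: the sensors are $\mathbf a_q=(\xi_q,\eta_q,0)$, $q=1,\dots,n$, where $(\xi_q,\eta_q)$ are i.i.d. uniformly distributed in $[0,A]\times[0,A]$. Source-inversion sensing matrix: the entries are the paraxial Green function $\frac{e^{i\omega z_0}}{4\pi z_0}e^{i\omega|x-\xi|^2/(2z_0)}e^{i\omega|y-\eta|^2/(2z_0)}$ evaluated at sensor/grid-point pairs, normalized so that columns have unit $\ell^2$-norm; i.e. (up to a constant unimodular factor) $\mathbf A\in\mathbb C^{n\times m}$ has entries $$A_{qj}=\frac{1}{\sqrt n}\exp\!\Big(\tfrac{i\omega}{2z_0}\big[(x_j-\xi_q)^2+(y_j-\eta_q)^2\big]\Big).$$ Target ensemble (sparsity $s$): random vectors $X\in\mathbb C^m$ with at most $s$ nonzero entries, whose support indices are independently and randomly (uniformly) selected from $\{1,\dots,m\}$ and whose nonzero entries have phases that are independent and uniformly distributed in $[0,2\pi]$ (the magnitudes are arbitrary). The target ensemble is independent of the sensor ensemble. Basis Pursuit (BP): given $Y=\mathbf A X$, solve $\min\|Z\|_1$ subject to $\mathbf A Z=Y$. "Recovered exactly by BP" means that $X$ is the unique minimizer.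
   Formalization: Each bracket in the probability bound is replaced by its positive part; if both brackets are negative the printed product is positive and can exceed 1, so the printed claim fails there, and in all other cases the printed bound follows. *)

theory Defs
  imports "HOL-Probability.Probability"
begin

text \<open>
  Lateral coordinates of the targets: an axis-parallel square lattice with \<open>L\<close> points per side and
  mesh size \<open>l\<close>. Its position in the target plane and the numbering of its points are arbitrary.
\<close>

definition square_lattice :: "nat \<Rightarrow> real \<Rightarrow> ('m \<Rightarrow> real \<times> real) \<Rightarrow> bool" where
  "square_lattice L l r \<longleftrightarrow>
     (\<exists>x0 y0. bij_betw r UNIV {(x0 + real a * l, y0 + real b * l) |a b. a < L \<and> b < L})"

definition sensor_ensemble :: "real \<Rightarrow> ('n \<Rightarrow> real \<times> real) measure" where
  "sensor_ensemble A = PiM UNIV (\<lambda>_. uniform_measure lborel ({0..A} \<times> {0..A}))"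

text \<open>
  The paraxial Green function between the sensor \<open>(\<xi>, \<eta>, 0)\<close> and the grid point \<open>(x, y, z0)\<close>, with its
  constant prefactor replaced by \<open>1 / sqrt n\<close>, so that the columns have unit Euclidean norm.
\<close>

definition sensing_matrix ::
  "real \<Rightarrow> real \<Rightarrow> ('m \<Rightarrow> real \<times> real) \<Rightarrow> ('n \<Rightarrow> real \<times> real) \<Rightarrow> complex^'m^'n" where
  "sensing_matrix \<omega> z0 r a =
     (\<chi> q j. of_real (1 / sqrt (real CARD('n))) *
        exp (\<i> * of_real (\<omega> / (2 * z0) *
          ((fst (r j) - fst (a q))\<^sup>2 + (snd (r j) - snd (a q))\<^sup>2))))"

definition index_phase_law :: "nat \<Rightarrow> ((nat \<Rightarrow> 'm::finite) \<times> ('m \<Rightarrow> real)) measure" where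
  "index_phase_law s =
     PiM {..<s} (\<lambda>_. uniform_count_measure UNIV) \<Otimes>\<^sub>M
     PiM UNIV (\<lambda>_. uniform_measure lborel {0..2 * pi})"

text \<open>
  The support consists of \<open>s\<close> independently drawn indices \<open>J 0, \<dots>, J (s - 1)\<close>, which may coincide, so
  there are at most \<open>s\<close> nonzero entries. That the pair \<open>(J, \<Theta>)\<close> has law \<open>index_phase_law s\<close> says that
  all indices and all phases are uniformly distributed and jointly independent. The magnitudes
  \<open>norm (X t $ j)\<close> are unconstrained random variables; they may depend on \<open>J\<close> and \<open>\<Theta>\<close>.
\<close>

definition target_ensemble :: "nat \<Rightarrow> 't measure \<Rightarrow> ('t \<Rightarrow> complex^'m::finite) \<Rightarrow> bool" where
  "target_ensemble s T X \<longleftrightarrow>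
     prob_space T \<and> X \<in> borel_measurable T \<and>
     (\<exists>J \<Theta>. (\<lambda>t. (J t, \<Theta> t)) \<in> measurable T (index_phase_law s) \<and>
        distr T (index_phase_law s) (\<lambda>t. (J t, \<Theta> t)) = index_phase_law s \<and>
        (\<forall>t\<in>space T. {j. X t $ j \<noteq> 0} = J t ` {..<s}) \<and>
        (\<forall>t\<in>space T. \<forall>j. X t $ j \<noteq> 0 \<longrightarrow> X t $ j = of_real (norm (X t $ j)) * cis (\<Theta> t j)))"

definition l1_norm :: "complex^'m \<Rightarrow> real" where
  "l1_norm Z = (\<Sum>j\<in>UNIV. norm (Z $ j))"

definition BP_solutions :: "complex^'m^'n \<Rightarrow> complex^'n \<Rightarrow> (complex^'m) set" where
  "BP_solutions M Y = {Z. is_arg_min l1_norm (\<lambda>Z. M *v Z = Y) Z}"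

definition BP_recovers :: "complex^'m^'n \<Rightarrow> complex^'m \<Rightarrow> bool" where
  "BP_recovers M X \<longleftrightarrow> BP_solutions M (M *v X) = {X}"

end

theory Submission
  imports Defs
begin

text \<open>
  Up to a unimodular factor for each sensor and each grid point, the sensing matrix is a matrix of
  random Fourier samples: since \<open>1 / \<rho>\<close> is an integer, for distinct grid points \<open>i\<close>, \<open>j\<close> the
  correlation \<open>cnj (A\<^sub>q\<^sub>i) A\<^sub>q\<^sub>j\<close> is a nontrivial character of a square and hence, after scaling, uniform
  on the circle. So inner products of columns are sums of independent uniform phases, and their
  moments give a Gaussian tail for the coherence.

  The columns in a fixed support \<open>S\<close> are well conditioned with overwhelming probability: the rows
  are independent isotropic vectors \<open>\<phi>\<close> of bounded length, and the expected trace of a high power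
  of the resolvent of \<open>\<Sum> \<phi> \<phi>\<^sup>*\<close> is controlled one sample at a time with the Sherman--Morrison
  formula. Only the smallest singular value matters, and a Markov bound for the trace yields it.

  Given such sensors, the least-squares dual vector is, off the support, again a sum of independent
  uniform phases (those of the target), with small coefficients; it is therefore smaller than one in
  modulus there, which certifies exact recovery.
\<close>

section \<open>Powers of positive semidefinite matrices under rank-one updates\<close>

text \<open>A worst-case coherence argument stops at sparsity of order sqrt n. A bound nearly linear
  in n needs well-conditioned columns, but only on one support at a time: support and sensors are
  independent, so the exceptional set of sensors may depend on the support and no union over
  supports is paid.

  The potential tr (mu + sum phi phi^H)^(-p) dominates the p-th power of every eigenvalue of the
  resolvent; p of order ln (2m/\<delta>) makes the initial factor card S harmless. Spectral theory
  is bypassed: every inequality between powers of R is an inequality between the numbers <x, R^k x>,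
  and rests on these being nonnegative.

  With L1 = ln (2m/\<delta>) and L2 = ln (m/\<epsilon>), the 64 arises as 4 * 4 * 4: the squared
  coherence is at most 4 L1 / n, inverting the lower frame bound 1/2 costs its inverse square 4, and
  the dual values need variance at most 1 / (4 L2) for the tail 2 exp (-2 L2) at threshold 1. The
  same 64 leaves ample room in the conditioning estimate.\<close>

definition cdot :: "'i set \<Rightarrow> ('i \<Rightarrow> complex) \<Rightarrow> ('i \<Rightarrow> complex) \<Rightarrow> complex" where
  "cdot S x y = (\<Sum>i\<in>S. cnj (x i) * y i)"

text \<open>Vectors and matrices are plain functions on the whole index type, so that
  \<open>S\<close> can vary without changing types. Values outside \<open>S\<close> carry no
  meaning; all sums read indices in \<open>S\<close> only, whence the side condition
  \<open>i \<in> S\<close> in several pointwise identities.\<close>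

definition mapp :: "'i set \<Rightarrow> ('i \<Rightarrow> 'i \<Rightarrow> complex) \<Rightarrow> ('i \<Rightarrow> complex) \<Rightarrow> 'i \<Rightarrow> complex" where
  "mapp S R x = (\<lambda>i. \<Sum>j\<in>S. R i j * x j)"

definition psd :: "'i set \<Rightarrow> ('i \<Rightarrow> 'i \<Rightarrow> complex) \<Rightarrow> bool" where
  "psd S R \<longleftrightarrow> (\<forall>i\<in>S. \<forall>j\<in>S. R j i = cnj (R i j)) \<and> (\<forall>x. 0 \<le> Re (cdot S x (mapp S R x)))"

text \<open>The \<open>k\<close>-th moment of the spectral measure of \<open>R\<close> at
  \<open>x\<close>. These real numbers stand in for a diagonalization of \<open>R\<close>.\<close>

definition moment :: "'i set \<Rightarrow> ('i \<Rightarrow> 'i \<Rightarrow> complex) \<Rightarrow> nat \<Rightarrow> ('i \<Rightarrow> complex) \<Rightarrow> real" where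
  "moment S R k x = Re (cdot S x ((mapp S R ^^ k) x))"

definition unitvec :: "'i \<Rightarrow> 'i \<Rightarrow> complex" where
  "unitvec i = (\<lambda>j. if j = i then 1 else 0)"

definition trace_pow :: "'i set \<Rightarrow> ('i \<Rightarrow> 'i \<Rightarrow> complex) \<Rightarrow> nat \<Rightarrow> real" where
  "trace_pow S R k = (\<Sum>i\<in>S. moment S R k (unitvec i))"

definition sherman_coeff :: "'i set \<Rightarrow> ('i \<Rightarrow> 'i \<Rightarrow> complex) \<Rightarrow> ('i \<Rightarrow> complex) \<Rightarrow> real" where
  "sherman_coeff S R f = 1 / (1 + moment S R 1 f)"

text \<open>If \<open>R\<close> inverts B, this is the inverse of B + f f^H by the Sherman--Morrison
  formula. The lemma \<open>resolvent_sherman\<close> verifies this in the form in which it is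
  used.\<close>

definition sherman_morrison :: "'i set \<Rightarrow> ('i \<Rightarrow> 'i \<Rightarrow> complex) \<Rightarrow> ('i \<Rightarrow> complex) \<Rightarrow> 'i \<Rightarrow> 'i \<Rightarrow> complex" where
  "sherman_morrison S R f = (\<lambda>i j. R i j - of_real (sherman_coeff S R f) * (mapp S R f i * cnj (mapp S R f j)))"

section \<open>Sesquilinear algebra and powers of a self-adjoint matrix\<close>

lemma cdot_add_right: "cdot S x (\<lambda>i. y i + z i) = cdot S x y + cdot S x z"
  by (simp add: cdot_def sum.distrib algebra_simps)

lemma cdot_diff_right: "cdot S x (\<lambda>i. y i - z i) = cdot S x y - cdot S x z"
  by (simp add: cdot_def sum_subtractf algebra_simps)

lemma cdot_scale_right: "cdot S x (\<lambda>i. c * y i) = c * cdot S x y"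
  by (simp add: cdot_def sum_distrib_left algebra_simps)

lemma cdot_commute: "cdot S y x = cnj (cdot S x y)"
  by (simp add: cdot_def cnj_sum mult.commute)

lemma cdot_cong: "(\<And>i. i \<in> S \<Longrightarrow> x i = x' i) \<Longrightarrow> (\<And>i. i \<in> S \<Longrightarrow> y i = y' i) \<Longrightarrow> cdot S x y = cdot S x' y'"
  by (simp add: cdot_def)

lemma cdot_self: "cdot S x x = of_real (\<Sum>i\<in>S. (norm (x i))\<^sup>2)"
  by (simp add: cdot_def complex_norm_square mult.commute del: of_real_power)

lemma Re_cdot_self: "Re (cdot S x x) = (\<Sum>i\<in>S. (norm (x i))\<^sup>2)"
  by (simp add: cdot_self)

lemma cdot_unitvec: "finite S \<Longrightarrow> i \<in> S \<Longrightarrow> cdot S (unitvec i) x = x i"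
  by (simp add: cdot_def unitvec_def if_distrib [of cnj] if_distrib [of "\<lambda>z. z * _"] sum.delta cong: if_cong)

lemma cdot_unitvec_right: "finite S \<Longrightarrow> i \<in> S \<Longrightarrow> cdot S x (unitvec i) = cnj (x i)"
  by (subst cdot_commute) (simp add: cdot_unitvec)

lemma mapp_add: "mapp S R (\<lambda>i. x i + y i) = (\<lambda>i. mapp S R x i + mapp S R y i)"
  by (simp add: mapp_def sum.distrib algebra_simps)

lemma mapp_diff: "mapp S R (\<lambda>i. x i - y i) = (\<lambda>i. mapp S R x i - mapp S R y i)"
  by (simp add: mapp_def sum_subtractf algebra_simps)

lemma mapp_scale: "mapp S R (\<lambda>i. c * x i) = (\<lambda>i. c * mapp S R x i)"
  by (simp add: mapp_def sum_distrib_left algebra_simps)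

lemma cdot_mapp_swap:
  assumes "psd S R"
  shows "cdot S x (mapp S R y) = cdot S (mapp S R x) y"
proof -
  have "cdot S x (mapp S R y) = (\<Sum>i\<in>S. \<Sum>j\<in>S. cnj (x i) * (R i j * y j))"
    by (simp add: cdot_def mapp_def sum_distrib_left)
  also have "\<dots> = (\<Sum>j\<in>S. \<Sum>i\<in>S. cnj (x i) * (R i j * y j))"
    by (rule sum.swap)
  also have "\<dots> = (\<Sum>j\<in>S. \<Sum>i\<in>S. cnj (R j i * x i) * y j)"
  proof (intro sum.cong refl)
    fix i j assume "i \<in> S" "j \<in> S"
    then have "cnj (R j i) = R i j" using assms by (metis psd_def complex_cnj_cnj)
    then show "cnj (x i) * (R i j * y j) = cnj (R j i * x i) * y j" by simp
  qed
  also have "\<dots> = cdot S (mapp S R x) y"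
    by (simp add: cdot_def mapp_def sum_distrib_right cnj_sum)
  finally show ?thesis .
qed

lemma cdot_pow_swap:
  assumes "psd S R"
  shows "cdot S x ((mapp S R ^^ k) y) = cdot S ((mapp S R ^^ k) x) y"
  by (induction k arbitrary: x y)
     (simp_all add: cdot_mapp_swap [OF assms] funpow_swap1)

lemma cdot_pow_add:
  assumes "psd S R"
  shows "cdot S ((mapp S R ^^ i) x) ((mapp S R ^^ j) y) = cdot S x ((mapp S R ^^ (i + j)) y)"
  by (simp add: cdot_pow_swap [OF assms, symmetric] funpow_add)

lemma cdot_pow_self_real:
  assumes "psd S R"
  shows "cdot S x ((mapp S R ^^ k) x) = of_real (moment S R k x)"
proof -
  have "cnj (cdot S x ((mapp S R ^^ k) x)) = cdot S x ((mapp S R ^^ k) x)"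
    by (subst cdot_commute [symmetric]) (simp add: cdot_pow_swap [OF assms])
  then show ?thesis
    by (simp add: moment_def complex_eq_iff)
qed

text \<open>Self-adjointness moves \<open>i\<close> of the powers to the other argument, so passing
  from \<open>x\<close> to R^i x shifts the index by \<open>2 * i\<close>. Nonnegativity of all
  moments thereby reduces to the indices 0 and 1.\<close>

lemma moment_pow:
  assumes "psd S R"
  shows "moment S R k ((mapp S R ^^ i) x) = moment S R (k + 2 * i) x"
proof -
  have "(mapp S R ^^ k) ((mapp S R ^^ i) x) = (mapp S R ^^ (k + i)) x"
    by (simp add: funpow_add)
  then show ?thesis
    by (simp add: moment_def cdot_pow_add [OF assms] mult_2 add_ac)
qed

section \<open>Inequalities between the moments of a positive semidefinite matrix\<close>

lemma moment_nonneg: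
  assumes "psd S R"
  shows "0 \<le> moment S R k x"
proof -
  have *: "0 \<le> moment S R b x" if "b < 2" for b x
    using that assms by (auto simp: less_2_cases_iff moment_def psd_def Re_cdot_self sum_nonneg)
  have "moment S R k x = moment S R (k mod 2) ((mapp S R ^^ (k div 2)) x)"
    by (simp add: moment_pow [OF assms])
  then show ?thesis using *[of "k mod 2"] by simp
qed

lemma moment_0: "moment S R 0 x = (\<Sum>i\<in>S. (norm (x i))\<^sup>2)"
  by (simp add: moment_def Re_cdot_self)

text \<open>This is the \<open>k\<close>-th moment of y = (R - g) x, expanded. The real number
  \<open>g\<close> may have either sign.\<close>

lemma moment_quadratic_nonneg:
  assumes "psd S R"
  shows "0 \<le> moment S R (k + 2) x - 2 * g * moment S R (k + 1) x + g\<^sup>2 * moment S R k x"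
proof -
  define T where "T = mapp S R"
  define y where "y = (\<lambda>i. T x i - of_real g * x i)"
  have lin: "(T ^^ k) (\<lambda>i. a i - of_real g * b i) = (\<lambda>i. (T ^^ k) a i - of_real g * (T ^^ k) b i)" for k a b
    by (induction k) (simp_all add: T_def mapp_diff mapp_scale)
  have cy: "cdot S y z = cdot S (T x) z - of_real g * cdot S x z" for z
    by (simp add: cdot_def y_def sum_subtractf sum_distrib_left algebra_simps)
  have "0 \<le> moment S R k y" by (rule moment_nonneg [OF assms])
  also have "moment S R k y = Re (cdot S y ((T ^^ k) (T x)) - of_real g * cdot S y ((T ^^ k) x))"
    by (simp add: moment_def T_def [symmetric] y_def lin cdot_diff_right cdot_scale_right)
  also have "\<dots> = Re (cdot S (T x) ((T ^^ k) (T x)) - of_real g * cdot S x ((T ^^ k) (T x)))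
      - g * Re (cdot S (T x) ((T ^^ k) x) - of_real g * cdot S x ((T ^^ k) x))"
    by (simp add: cy)
  finally show ?thesis
    using cdot_pow_add [OF assms, of 1 x "Suc k" x] cdot_pow_add [OF assms, of 1 x k x]
    unfolding T_def [symmetric] by (simp add: moment_def T_def [symmetric] funpow_swap1 power2_eq_square right_diff_distrib)
qed

text \<open>Spectral form of P_p(t) = p t^(p+1) - (p+1) g t^p + g^(p+1) >= 0 for t, g >= 0, a
  weighted AM-GM inequality. The identity P_(p+1) = g P_p + (p+1) t^p (t - g)^2 drives the induction
  and reduces it to \<open>moment_quadratic_nonneg\<close>.\<close>

lemma moment_tangent:
  assumes "psd S R" "0 \<le> g"
  shows "0 \<le> real p * moment S R (p + 1) x - (real p + 1) * g * moment S R p x + g ^ (p + 1) * moment S R 0 x"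
proof (induction p)
  case 0
  then show ?case by simp
next
  case (Suc p)
  have eq: "(real p + 1) * a - (real p + 1 + 1) * g * b + g ^ (p + 1 + 1) * d =
      g * (real p * b - (real p + 1) * g * c + g ^ (p + 1) * d) + (real p + 1) * (a - 2 * g * b + g\<^sup>2 * c)"
    for a b c d
    by (simp only: power2_eq_square power_add power_one_right ring_distribs) algebra
  have "0 \<le> g * (real p * moment S R (p + 1) x - (real p + 1) * g * moment S R p x + g ^ (p + 1) * moment S R 0 x)
          + (real p + 1) * (moment S R (p + 2) x - 2 * g * moment S R (p + 1) x + g\<^sup>2 * moment S R p x)"
    by (rule add_nonneg_nonneg [OF mult_nonneg_nonneg [OF assms(2) Suc]
          mult_nonneg_nonneg [OF _ moment_quadratic_nonneg [OF assms(1)]]]) simp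
  also note eq [symmetric]
  finally have *: "0 \<le> (real p + 1) * moment S R (p + 2) x - (real p + 1 + 1) * g * moment S R (p + 1) x
      + g ^ (p + 1 + 1) * moment S R 0 x" .
  have e: "real (Suc p) = real p + 1" "p + 2 = Suc p + 1" "p + 1 + 1 = Suc p + 1" "p + 1 = Suc p" by simp_all
  show ?case using * unfolding e .
qed

text \<open>Jensen's inequality for the spectral measure, which has mass one. Each induction step is
  the tangent inequality at the point \<open>g\<close>, which only has to lie below the
  mean.\<close>

lemma moment_ge_power:
  assumes "psd S R" "0 \<le> g" "moment S R 0 x = 1" "g \<le> moment S R 1 x"
  shows "g ^ Suc k \<le> moment S R (Suc k) x"
proof (induction k)
  case 0 then show ?case using assms by simp
next
  case (Suc k)
  have "(real (Suc k) + 1) * g * g ^ Suc k \<le> (real (Suc k) + 1) * g * moment S R (Suc k) x"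
    using Suc assms by (intro mult_left_mono) auto
  moreover have "0 \<le> real (Suc k) * moment S R (Suc (Suc k)) x
      - (real (Suc k) + 1) * g * moment S R (Suc k) x + g ^ Suc (Suc k)"
    using moment_tangent [OF assms(1,2), of "Suc k" x] assms(3) by simp
  moreover have "(real (Suc k) + 1) * g * g ^ Suc k = real (Suc k) * g ^ Suc (Suc k) + g ^ Suc (Suc k)"
    by (simp add: ring_distribs)
  ultimately have "real (Suc k) * g ^ Suc (Suc k) \<le> real (Suc k) * moment S R (Suc (Suc k)) x"
    by linarith
  then show ?case by (rule mult_left_le_imp_le) simp
qed

lemma discriminant_bound:
  fixes a b c :: real
  assumes "\<And>g. 0 \<le> a - 2 * g * b + g\<^sup>2 * c" "0 \<le> c"
  shows "b\<^sup>2 \<le> a * c"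
proof (cases "c = 0")
  case True
  show ?thesis
  proof (cases "b = 0")
    case False
    \<comment> \<open>For \<open>c = 0\<close> the quadratic is affine in \<open>g\<close>, and at
      this point it equals -1.\<close>
    then show ?thesis using assms(1)[of "(a + 1) / (2 * b)"] True by (simp add: field_simps)
  qed (use True in simp)
next
  case False
  with assms have "c > 0" by simp
  then show ?thesis using assms(1)[of "b / c"] by (simp add: field_simps power2_eq_square)
qed

lemma moment_log_convex:
  assumes "psd S R"
  shows "(moment S R (k + 1) x)\<^sup>2 \<le> moment S R (k + 2) x * moment S R k x"
proof (rule discriminant_bound)
  show "0 \<le> moment S R (k + 2) x - 2 * g * moment S R (k + 1) x + g\<^sup>2 * moment S R k x" for g
    by (rule moment_quadratic_nonneg [OF assms])
qed (rule moment_nonneg [OF assms])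

text \<open>Log-convexity makes the ratios f (k+1) / f k nondecreasing, so f a / f 0, a product of
  \<open>a\<close> consecutive ratios, is at most the shifted product f (a+b) / f b. If some value
  vanishes the ratios are meaningless, but zeros then propagate in both directions and all values
  from index 1 on are zero.\<close>

lemma log_convex_product:
  fixes f :: "nat \<Rightarrow> real"
  assumes nonneg: "\<And>k. 0 \<le> f k" and convex: "\<And>k. (f (Suc k))\<^sup>2 \<le> f (Suc (Suc k)) * f k"
  shows "f a * f b \<le> f 0 * f (a + b)"
proof (cases "\<forall>k. f k \<noteq> 0")
  case True
  then have pos: "0 < f k" for k using nonneg[of k] by (simp add: order_less_le)
  define q where "q k = f (Suc k) / f k" for k
  have "q k \<le> q (Suc k)" for k
    using convex[of k] pos[of k] pos[of "Suc k"] by (simp add: q_def field_simps power2_eq_square)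
  then have q: "q i \<le> q j" if "i \<le> j" for i j using that by (rule lift_Suc_mono_le)
  have f_Suc: "f (Suc k) = q k * f k" for k using pos[of k] by (simp add: q_def)
  show ?thesis
  proof (induction a)
    case (Suc a)
    have "f (Suc a) * f b = q a * (f a * f b)" by (simp add: f_Suc)
    also have "\<dots> \<le> q (a + b) * (f 0 * f (a + b))"
      using q[of a "a + b"] nonneg by (intro mult_mono [OF _ Suc]) (simp_all add: q_def)
    also have "\<dots> = f 0 * f (Suc a + b)" by (simp add: f_Suc)
    finally show ?case .
  qed simp
next
  case False
  then obtain k where k: "f k = 0" by blast
  have up: "f (Suc j) = 0" if "f j = 0" for j using convex[of j] that by simp
  have down: "f (Suc j) = 0" if "f (Suc (Suc j)) = 0" for j using convex[of j] that by simp
  have "f 1 = 0"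
  proof (cases k)
    case 0 then show ?thesis using up[of 0] k by simp
  next
    case (Suc k')
    have "f (Suc j) = 0 \<Longrightarrow> f 1 = 0" for j
      by (induction j) (auto dest: down)
    then show ?thesis using k Suc by simp
  qed
  then have "f (Suc j) = 0" for j by (induction j) (auto dest: up)
  then show ?thesis using nonneg by (cases a; cases b) auto
qed

text \<open>Log-convexity is applied to the sequence that starts at index 1. The extra factor is
  then the first moment, the quantity later bounded by \<open>\<tau>\<close>, instead of the squared
  length of \<open>x\<close>.\<close>

lemma moment_product:
  assumes "psd S R"
  shows "moment S R (Suc a) x * moment S R (Suc b) x \<le> moment S R 1 x * moment S R (Suc (a + b)) x"
  using log_convex_product [of "\<lambda>k. moment S R (Suc k) x" a b] moment_log_convex [OF assms, of "Suc _" x]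
  by (simp add: moment_nonneg [OF assms])

lemma psd_cauchy_schwarz:
  assumes "psd S R"
  shows "(norm (cdot S x (mapp S R y)))\<^sup>2 \<le> moment S R 1 x * moment S R 1 y"
proof -
  define w where "w = cdot S x (mapp S R y)"
  \<comment> \<open>The unimodular \<open>u\<close> rotates \<open>w\<close> onto the nonnegative
    axis, so the real multiples \<open>g * u\<close> suffice for the discriminant argument.\<close>
  define u where "u = (if w = 0 then 1 else cnj w / of_real (norm w))"
  have u: "norm u = 1" "u * w = of_real (norm w)"
    using complex_norm_square[of w] by (auto simp: u_def norm_divide mult.commute power2_eq_square field_simps)
  have "0 \<le> moment S R 1 x - 2 * g * norm w + g\<^sup>2 * moment S R 1 y" for g
  proof -
    define c where "c = of_real g * u"
    have c: "cnj c * c = of_real (g\<^sup>2)"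
      using complex_norm_square[of u] u by (simp add: c_def power2_eq_square mult_ac)
    have "0 \<le> moment S R 1 (\<lambda>i. x i - c * y i)" by (rule moment_nonneg [OF assms])
    also have "\<dots> = Re (cdot S (\<lambda>i. x i - c * y i) (mapp S R x) - c * cdot S (\<lambda>i. x i - c * y i) (mapp S R y))"
      by (simp add: moment_def mapp_diff mapp_scale cdot_diff_right cdot_scale_right)
    also have "\<dots> = Re (cdot S x (mapp S R x) - cnj c * cdot S y (mapp S R x)
        - c * w + cnj c * c * cdot S y (mapp S R y))"
      by (simp add: w_def cdot_def sum_subtractf sum_distrib_left algebra_simps)
    also have "cdot S y (mapp S R x) = cnj w"
      using cdot_mapp_swap [OF assms, of x y] by (simp add: w_def cdot_commute [of S y])
    also have "Re (cdot S x (mapp S R x) - cnj c * cnj w - c * w + cnj c * c * cdot S y (mapp S R y))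
        = moment S R 1 x - 2 * Re (c * w) + g\<^sup>2 * moment S R 1 y"
      unfolding c by (simp add: moment_def flip: complex_cnj_mult)
    also have "Re (c * w) = g * norm w" using u by (simp add: c_def mult.assoc)
    finally show ?thesis by (simp add: mult_ac)
  qed
  then show ?thesis
    unfolding w_def [symmetric] by (rule discriminant_bound) (rule moment_nonneg [OF assms])
qed

section \<open>Rank-one updates of an inverse\<close>

lemma mapp_sherman:
  "mapp S (sherman_morrison S R f) x = (\<lambda>i. mapp S R x i -
     of_real (sherman_coeff S R f) * cdot S (mapp S R f) x * mapp S R f i)"
proof
  fix i
  have "mapp S (sherman_morrison S R f) x i = (\<Sum>j\<in>S. R i j * x j -
      of_real (sherman_coeff S R f) * (cnj (mapp S R f j) * x j) * mapp S R f i)"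
    unfolding mapp_def [of S "sherman_morrison S R f"]
    by (intro sum.cong refl) (simp add: sherman_morrison_def algebra_simps)
  then show "mapp S (sherman_morrison S R f) x i = mapp S R x i -
      of_real (sherman_coeff S R f) * cdot S (mapp S R f) x * mapp S R f i"
    by (simp add: sum_subtractf cdot_def sum_distrib_left sum_distrib_right mapp_def [of S R x])
qed

lemma moment_1: "moment S R 1 x = Re (cdot S x (mapp S R x))"
  by (simp add: moment_def)

lemma moment_sherman:
  assumes "psd S R"
  shows "moment S (sherman_morrison S R f) 1 x =
    moment S R 1 x - (norm (cdot S x (mapp S R f)))\<^sup>2 / (1 + moment S R 1 f)"
proof -
  define w where "w = cdot S x (mapp S R f)"
  have "cdot S (mapp S R f) x = cnj w"
    by (simp add: w_def cdot_commute [of S "mapp S R f"])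
  then have "cdot S x (mapp S (sherman_morrison S R f) x) =
      cdot S x (mapp S R x) - of_real (sherman_coeff S R f) * (cnj w * w)"
    by (simp only: mapp_sherman cdot_diff_right cdot_scale_right w_def mult.assoc)
  also have "cnj w * w = of_real ((norm w)\<^sup>2)"
    using complex_norm_square[of w] by (simp add: mult.commute)
  finally show ?thesis by (simp add: moment_1 [unfolded One_nat_def] w_def sherman_coeff_def)
qed

lemma moment_sherman_le:
  assumes "psd S R"
  shows "moment S (sherman_morrison S R f) 1 x \<le> moment S R 1 x"
  unfolding moment_sherman [OF assms] using moment_nonneg [OF assms, of 1 f] by simp

text \<open>Cauchy-Schwarz for the form of \<open>R\<close> bounds the subtracted square by
  \<open>moment S R 1 x * moment S R 1 f\<close>; division by \<open>1 + moment S R 1 f\<close>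
  leaves at most \<open>moment S R 1 x\<close>.\<close>

lemma psd_sherman:
  assumes "psd S R"
  shows "psd S (sherman_morrison S R f)"
  unfolding psd_def
proof (intro conjI ballI allI)
  fix i j assume "i \<in> S" "j \<in> S"
  then have "R j i = cnj (R i j)" using assms unfolding psd_def by blast
  then show "sherman_morrison S R f j i = cnj (sherman_morrison S R f i j)"
    by (simp add: sherman_morrison_def mult_ac)
next
  fix x
  have a: "0 \<le> moment S R 1 f" and b: "0 \<le> moment S R 1 x" by (rule moment_nonneg [OF assms])+
  have "(norm (cdot S x (mapp S R f)))\<^sup>2 \<le> moment S R 1 x * moment S R 1 f"
    by (rule psd_cauchy_schwarz [OF assms])
  also have "\<dots> \<le> moment S R 1 x * (1 + moment S R 1 f)"
    using b by (simp add: mult_left_mono)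
  finally have "0 \<le> moment S (sherman_morrison S R f) 1 x"
    unfolding moment_sherman [OF assms] using a by (simp add: pos_divide_le_eq)
  then show "0 \<le> Re (cdot S x (mapp S (sherman_morrison S R f) x))" unfolding moment_1 .
qed

text \<open>Telescoping: T^p - T'^p is the sum of T'^(p-1-k) (T - T') T^k, and T - T' = beta u u^H
  has rank one, with u = R f.\<close>

lemma funpow_mapp_diff_rank_one:
  "(mapp S R ^^ p) x i - (mapp S (sherman_morrison S R f) ^^ p) x i =
     of_real (sherman_coeff S R f) *
     (\<Sum>k<p. cdot S (mapp S R f) ((mapp S R ^^ k) x) * (mapp S (sherman_morrison S R f) ^^ (p - 1 - k)) (mapp S R f) i)"
proof (induction p arbitrary: i)
  case (Suc p)
  define T where "T = mapp S R"
  define T' where "T' = mapp S (sherman_morrison S R f)"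
  define u where "u = T f"
  define b where "b = complex_of_real (sherman_coeff S R f)"
  have IH: "(\<lambda>i. (T ^^ p) x i - (T' ^^ p) x i) = (\<lambda>i. b * (\<Sum>k<p. cdot S u ((T ^^ k) x) * (T' ^^ (p - 1 - k)) u i))"
    using Suc by (simp add: T_def T'_def u_def b_def fun_eq_iff)
  have T'_sum: "T' (\<lambda>i. \<Sum>k<n. c k * v k i) = (\<lambda>i. \<Sum>k<n. c k * T' (v k) i)" for c v and n :: nat
    by (induction n) (simp_all add: T'_def mapp_add mapp_scale, simp add: mapp_def)
  have T'_scale: "T' (\<lambda>i. c * v i) = (\<lambda>i. c * T' v i)" for c v
    by (simp add: T'_def mapp_scale)
  have "(T ^^ Suc p) x i - (T' ^^ Suc p) x i = (T ((T ^^ p) x) i - T' ((T ^^ p) x) i) + T' (\<lambda>i. (T ^^ p) x i - (T' ^^ p) x i) i"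
    by (simp add: T'_def mapp_diff)
  also have "T ((T ^^ p) x) i - T' ((T ^^ p) x) i = b * (cdot S u ((T ^^ p) x) * u i)"
    by (simp add: T'_def T_def mapp_sherman b_def u_def mult.assoc)
  also have "T' (\<lambda>i. (T ^^ p) x i - (T' ^^ p) x i) i = b * (\<Sum>k<p. cdot S u ((T ^^ k) x) * (T' ^^ (p - k)) u i)"
  proof -
    have "T' ((T' ^^ (p - 1 - k)) u) = (T' ^^ (p - k)) u" if "k < p" for k
    proof -
      have "p - k = Suc (p - 1 - k)" using that by simp
      then show ?thesis by simp
    qed
    then show ?thesis
      unfolding IH T'_scale T'_sum by (intro arg_cong2 [where f = "(*)"] sum.cong refl) simp
  qed
  finally show ?case
    by (simp add: T_def T'_def u_def b_def algebra_simps)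
qed simp

lemma sherman_coeff_bounds:
  assumes "psd S R"
  shows "0 \<le> sherman_coeff S R f" "sherman_coeff S R f * (1 + moment S R 1 f) = 1"
  using moment_nonneg [OF assms, of 1 f] by (simp_all add: sherman_coeff_def)

text \<open>Mixed products of old and updated powers are compared with a pure moment of the old
  matrix. Replacing one \<open>T'\<close> by \<open>T\<close> costs \<open>\<beta>\<close> times a
  product of a mixed term and a moment; by \<open>upper\<close> and \<open>moment_product\<close>
  this is at most \<open>\<beta> * a\<close> times the target moment, and there are \<open>j\<close>
  replacements.\<close>

lemma cdot_pow_sherman_ge:
  fixes R :: "'i \<Rightarrow> 'i \<Rightarrow> complex" and f :: "'i \<Rightarrow> complex"
  assumes psd: "psd S R"
  defines "T \<equiv> mapp S R" and "T' \<equiv> mapp S (sherman_morrison S R f)"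
    and "\<beta> \<equiv> sherman_coeff S R f" and "a \<equiv> moment S R 1 f"
  shows "moment S R (i + j + 2) f * (1 - real j * (\<beta> * a)) \<le>
    Re (cdot S ((T ^^ i) (T f)) ((T' ^^ j) (T f)))"
proof -
  define u where "u = T f"
  define h where "h j i = Re (cdot S ((T ^^ i) u) ((T' ^^ j) u))" for i j
  have psd': "psd S (sherman_morrison S R f)" by (rule psd_sherman [OF psd])
  have \<beta>: "0 \<le> \<beta>" using sherman_coeff_bounds [OF psd] by (simp add: \<beta>_def)
  have Tu: "(T ^^ i) u = (T ^^ Suc i) f" for i by (simp add: u_def funpow_swap1)
  have r: "cdot S ((T ^^ i) u) u = of_real (moment S R (i + 2) f)" for i
    using cdot_pow_add [OF psd, of "Suc i" f 1 f] cdot_pow_self_real [OF psd, of f "i + 2"]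
    unfolding T_def [symmetric] Tu by (simp add: u_def)
  have r': "cdot S u ((T' ^^ j) u) = of_real (h j 0)" for j
    using cdot_pow_self_real [OF psd', of u j] by (simp add: h_def T'_def)
  have h0: "0 \<le> h j 0" for j
    using moment_nonneg [OF psd', of j u] by (simp add: h_def moment_def T'_def)
  have step: "h (Suc j) i = h j (Suc i) - \<beta> * (h j 0 * moment S R (i + 2) f)" for i j
  proof -
    have "(T' ^^ Suc j) u = (\<lambda>k. T ((T' ^^ j) u) k - of_real \<beta> * cdot S u ((T' ^^ j) u) * u k)"
      by (simp add: T'_def T_def \<beta>_def u_def mapp_sherman)
    then have "cdot S ((T ^^ i) u) ((T' ^^ Suc j) u) = cdot S ((T ^^ i) u) (T ((T' ^^ j) u))
        - of_real \<beta> * of_real (h j 0) * of_real (moment S R (i + 2) f)"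
      by (simp only: cdot_diff_right cdot_scale_right r r')
    also have "cdot S ((T ^^ i) u) (T ((T' ^^ j) u)) = cdot S ((T ^^ Suc i) u) ((T' ^^ j) u)"
      using cdot_mapp_swap [OF psd] by (simp add: T_def)
    finally show ?thesis by (simp add: h_def)
  qed
  have upper: "h j i \<le> moment S R (i + j + 2) f" for i j
  proof (induction j arbitrary: i)
    case 0
    show ?case using r[of i] by (simp add: h_def)
  next
    case (Suc j)
    have "h (Suc j) i \<le> h j (Suc i)"
      using \<beta> h0[of j] moment_nonneg [OF psd, of "i + 2" f] by (simp add: step)
    also have "\<dots> \<le> moment S R (i + Suc j + 2) f" using Suc[of "Suc i"] by simp
    finally show ?case .
  qed
  have "moment S R (i + j + 2) f * (1 - real j * (\<beta> * a)) \<le> h j i"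
  proof (induction j arbitrary: i)
    case 0
    show ?case using r[of i] by (simp add: h_def)
  next
    case (Suc j)
    have "h j 0 * moment S R (i + 2) f \<le> moment S R (j + 2) f * moment S R (i + 2) f"
      using upper[of j 0] by (intro mult_right_mono moment_nonneg psd) simp
    also have "\<dots> \<le> a * moment S R (i + Suc j + 2) f"
      using moment_product [OF psd, of "Suc j" f "Suc i"] by (simp add: a_def add_ac)
    finally have "\<beta> * (h j 0 * moment S R (i + 2) f) \<le> \<beta> * (a * moment S R (i + Suc j + 2) f)"
      using \<beta> by (rule mult_left_mono)
    moreover have "moment S R (i + Suc j + 2) f * (1 - real j * (\<beta> * a)) \<le> h j (Suc i)"
      using Suc[of "Suc i"] by simp
    moreover have "moment S R (i + Suc j + 2) f * (1 - real (Suc j) * (\<beta> * a)) =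
        moment S R (i + Suc j + 2) f * (1 - real j * (\<beta> * a)) - \<beta> * (a * moment S R (i + Suc j + 2) f)"
      by (simp add: algebra_simps)
    ultimately show ?case by (simp only: step)
  qed
  then show ?thesis by (simp add: h_def u_def)
qed

section \<open>Traces of powers, and what they say about quadratic forms\<close>

lemma trace_pow_alt:
  assumes "finite S"
  shows "trace_pow S R k = (\<Sum>i\<in>S. Re ((mapp S R ^^ k) (unitvec i) i))"
  using assms by (simp add: trace_pow_def moment_def cdot_unitvec)

lemma sum_one_minus: "(\<Sum>k<p. 1 - real (p - 1 - k) * x) = real p - real p * (real p - 1) / 2 * (x::real)"
proof -
  have "(\<Sum>k<p. 1 - real (p - 1 - k) * x) = (\<Sum>k<p. 1 - real k * x)"
    using sum.nat_diff_reindex [of "\<lambda>k. 1 - real k * x" p] by simp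
  also have "\<dots> = real p - real p * (real p - 1) / 2 * x"
    by (induction p) (simp_all add: field_simps)
  finally show ?thesis .
qed

text \<open>The trace of the telescoped difference is \<open>\<beta>\<close> times the sum over
  \<open>k\<close> of the mixed products <T^k u, T'^(p-1-k) u>. Each loses at most (p-1-k) beta a
  relative to the pure moment; the average of p-1-k is (p-1)/2, which explains the halved term.
  Finally \<open>a\<close> is replaced by its bound \<open>\<tau>\<close>.\<close>

lemma trace_pow_sherman_le:
  fixes R :: "'i \<Rightarrow> 'i \<Rightarrow> complex"
  assumes fin: "finite S" and psd: "psd S R" and a: "moment S R 1 f \<le> \<tau>"
    and small: "(real p - 1) * \<tau> \<le> 2" and p: "0 < p"
  shows "trace_pow S (sherman_morrison S R f) p \<le> trace_pow S R p
    - real p * ((1 - (real p - 1) * \<tau> / 2) / (1 + \<tau>)) * moment S R (p + 1) f"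
proof -
  define T where "T = mapp S R"
  define T' where "T' = mapp S (sherman_morrison S R f)"
  define u where "u = T f"
  define \<beta> where "\<beta> = sherman_coeff S R f"
  define a where "a = moment S R 1 f"
  have \<beta>: "0 \<le> \<beta>" "\<beta> * (1 + a) = 1"
    using sherman_coeff_bounds [OF psd] by (simp_all add: \<beta>_def a_def)
  have a0: "0 \<le> a" "a \<le> \<tau>" using moment_nonneg [OF psd] a by (simp_all add: a_def)
  have m0: "0 \<le> moment S R (p + 1) f" by (rule moment_nonneg [OF psd])
  have "trace_pow S R p - trace_pow S (sherman_morrison S R f) p =
      (\<Sum>i\<in>S. Re ((T ^^ p) (unitvec i) i - (T' ^^ p) (unitvec i) i))"
    using fin by (simp add: trace_pow_alt T_def T'_def sum_subtractf)
  also have "\<dots> = Re (\<Sum>i\<in>S. of_real \<beta> * (\<Sum>k<p. cdot S u ((T ^^ k) (unitvec i)) * (T' ^^ (p - 1 - k)) u i))"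
    unfolding T_def T'_def u_def \<beta>_def by (simp only: funpow_mapp_diff_rank_one Re_sum)
  also have "\<dots> = Re (of_real \<beta> * (\<Sum>k<p. \<Sum>i\<in>S. cdot S u ((T ^^ k) (unitvec i)) * (T' ^^ (p - 1 - k)) u i))"
    by (subst sum.swap) (simp add: sum_distrib_left)
  also have "\<dots> = \<beta> * (\<Sum>k<p. Re (\<Sum>i\<in>S. cdot S u ((T ^^ k) (unitvec i)) * (T' ^^ (p - 1 - k)) u i))"
    by simp
  also have "\<dots> = \<beta> * (\<Sum>k<p. Re (cdot S ((T ^^ k) u) ((T' ^^ (p - 1 - k)) u)))"
  proof -
    have "cdot S u ((T ^^ k) (unitvec i)) = cnj ((T ^^ k) u i)" if "i \<in> S" for k i
      using cdot_pow_swap [OF psd, of u k "unitvec i"] cdot_unitvec_right [OF fin that] by (simp add: T_def)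
    then show ?thesis by (simp add: cdot_def)
  qed
  also have "\<dots> \<ge> \<beta> * (\<Sum>k<p. moment S R (p + 1) f * (1 - real (p - 1 - k) * (\<beta> * a)))"
  proof (intro mult_left_mono sum_mono \<beta>)
    fix k assume "k \<in> {..<p}"
    \<comment> \<open>The two extra powers come from \<open>u = T f\<close> on either side of the
      inner product.\<close>
    then have "k + (p - 1 - k) + 2 = p + 1" by simp
    then show "moment S R (p + 1) f * (1 - real (p - 1 - k) * (\<beta> * a)) \<le>
        Re (cdot S ((T ^^ k) u) ((T' ^^ (p - 1 - k)) u))"
      using cdot_pow_sherman_ge [OF psd, of k "p - 1 - k" f]
      by (simp only: T_def T'_def u_def \<beta>_def a_def)
  qed
  also have "\<beta> * (\<Sum>k<p. moment S R (p + 1) f * (1 - real (p - 1 - k) * (\<beta> * a)))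
      = (\<beta> * (1 - (real p - 1) * (\<beta> * a) / 2)) * (real p * moment S R (p + 1) f)"
    unfolding sum_distrib_left [symmetric] sum_one_minus by (simp add: algebra_simps)
  also have "\<dots> \<ge> ((1 / (1 + \<tau>)) * (1 - (real p - 1) * \<tau> / 2)) * (real p * moment S R (p + 1) f)"
  proof (intro mult_right_mono mult_mono)
    have "\<beta> = 1 / (1 + a)" using \<beta> a0 by (simp add: field_simps)
    then show "1 / (1 + \<tau>) \<le> \<beta>" using a0 by (simp add: frac_le)
    have "\<beta> * a = 1 - \<beta>" using \<beta>(2) by (simp add: algebra_simps)
    also have "\<dots> \<le> \<tau>"
    proof -
      have "1 - \<beta> = \<beta> * a" using \<beta>(2) by (simp add: algebra_simps)
      also have "\<dots> \<le> 1 * a" using a0 \<open>\<beta> = 1 / (1 + a)\<close> by (intro mult_right_mono) auto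
      finally show ?thesis using a0 by simp
    qed
    finally have "(real p - 1) * (\<beta> * a) \<le> (real p - 1) * \<tau>"
      using p by (intro mult_left_mono) auto
    then show "1 - (real p - 1) * \<tau> / 2 \<le> 1 - (real p - 1) * (\<beta> * a) / 2" by simp
  qed (use m0 small \<beta> in auto)
  also have "((1 / (1 + \<tau>)) * (1 - (real p - 1) * \<tau> / 2)) * (real p * moment S R (p + 1) f) =
      real p * ((1 - (real p - 1) * \<tau> / 2) / (1 + \<tau>)) * moment S R (p + 1) f"
    by simp
  finally show ?thesis by linarith
qed

text \<open>The tangent inequality summed over the unit vectors. A power-mean inequality would also
  bound the higher trace from below, but this version is linear in \<open>trace_pow S R p\<close>
  and therefore passes directly to expectations.\<close>

lemma trace_pow_tangent:
  assumes "finite S" "psd S R" "0 \<le> g"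
  shows "(real p + 1) * g * trace_pow S R p \<le> real p * trace_pow S R (p + 1) + real (card S) * g ^ (p + 1)"
proof -
  have "moment S R 0 (unitvec i) = 1" if "i \<in> S" for i
    using assms(1) that by (simp add: moment_def cdot_unitvec) (simp add: unitvec_def)
  then have "0 \<le> (\<Sum>i\<in>S. real p * moment S R (p + 1) (unitvec i)
      - (real p + 1) * g * moment S R p (unitvec i) + g ^ (p + 1))"
    using moment_tangent [OF assms(2,3), of p] by (intro sum_nonneg) (metis mult.right_neutral)
  then show ?thesis
    by (simp add: trace_pow_def sum.distrib sum_subtractf sum_distrib_left)
qed

lemma cdot_cauchy_schwarz:
  "(norm (cdot S x y))\<^sup>2 \<le> (\<Sum>i\<in>S. (norm (x i))\<^sup>2) * (\<Sum>i\<in>S. (norm (y i))\<^sup>2)"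
proof -
  have "norm (cdot S x y) \<le> (\<Sum>i\<in>S. norm (x i) * norm (y i))"
    unfolding cdot_def by (rule sum_norm_le) (simp add: norm_mult)
  then have "(norm (cdot S x y))\<^sup>2 \<le> (\<Sum>i\<in>S. norm (x i) * norm (y i))\<^sup>2"
    by (rule power_mono) simp
  also have "\<dots> \<le> (\<Sum>i\<in>S. (norm (x i))\<^sup>2) * (\<Sum>i\<in>S. (norm (y i))\<^sup>2)"
    by (rule Cauchy_Schwarz_ineq_sum)
  finally show ?thesis .
qed

text \<open>The Hilbert-Schmidt norm of R^h dominates its operator norm. The even exponent makes the
  moment a squared length, so it suffices to apply Cauchy-Schwarz to each coordinate (R^h x)_i =
  <R^h e_i, x>.\<close>

lemma moment_le_trace_pow:
  assumes fin: "finite S" and psd: "psd S R" and x: "(\<Sum>i\<in>S. (norm (x i))\<^sup>2) = 1"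
  shows "moment S R (2 * h) x \<le> trace_pow S R (2 * h)"
proof -
  define T where "T = mapp S R"
  have m: "moment S R (2 * h) y = (\<Sum>i\<in>S. (norm ((T ^^ h) y i))\<^sup>2)" for y
    using moment_pow [OF psd, of 0 h y] by (simp add: moment_0 T_def)
  have "(norm ((T ^^ h) x i))\<^sup>2 \<le> moment S R (2 * h) (unitvec i)" if "i \<in> S" for i
  proof -
    have "(T ^^ h) x i = cdot S ((T ^^ h) (unitvec i)) x"
      using cdot_pow_swap [OF psd, of "unitvec i" h x] cdot_unitvec [OF fin that] by (simp add: T_def)
    then show ?thesis
      using cdot_cauchy_schwarz [of S "(T ^^ h) (unitvec i)" x] by (simp add: m x)
  qed
  then show ?thesis
    unfolding m trace_pow_def by (rule sum_mono) (simp add: m)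
qed

text \<open>Here \<open>y\<close> stands for B x, where \<open>R\<close> inverts B, and the argument
  in the conclusion is (B + f f^H) x. Only the action of B on a vector is tracked; B never appears
  as a matrix.\<close>

lemma resolvent_sherman:
  assumes fin: "finite S" and psd: "psd S R" and inv: "\<And>i. i \<in> S \<Longrightarrow> mapp S R y i = x i" and i: "i \<in> S"
  shows "mapp S (sherman_morrison S R f) (\<lambda>i. y i + cdot S f x * f i) i = x i"
proof -
  define \<beta> where "\<beta> = complex_of_real (sherman_coeff S R f)"
  define a where "a = complex_of_real (moment S R 1 f)"
  have \<beta>: "\<beta> * (1 + a) = 1"
    using arg_cong [OF sherman_coeff_bounds(2) [OF psd, of f], of complex_of_real]
    unfolding \<beta>_def a_def of_real_mult of_real_add of_real_1 .
  have "cdot S (mapp S R f) y = cdot S f x"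
    unfolding cdot_mapp_swap [OF psd, symmetric] by (rule cdot_cong) (auto simp: inv)
  moreover have "cdot S (mapp S R f) f = a"
    using cdot_pow_self_real [OF psd, of f 1] by (simp add: a_def cdot_mapp_swap [OF psd])
  ultimately have E: "cdot S (mapp S R f) (\<lambda>i. y i + cdot S f x * f i) = cdot S f x * (1 + a)"
    by (simp only: cdot_add_right cdot_scale_right) (simp add: algebra_simps)
  have "mapp S (sherman_morrison S R f) (\<lambda>i. y i + cdot S f x * f i) i =
      mapp S R y i + cdot S f x * mapp S R f i - (\<beta> * (1 + a)) * (cdot S f x * mapp S R f i)"
    unfolding mapp_sherman E unfolding mapp_add mapp_scale \<beta>_def by (simp add: algebra_simps)
  then show ?thesis by (simp add: \<beta> inv i)
qed

text \<open>Cauchy-Schwarz in the form of \<open>R\<close> for \<open>x\<close> and y = B x: the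
  mixed term <x, R y> is 1, while <y, R y> = <y, x>. A direction in which B is small is one in which
  its inverse is large.\<close>

lemma moment_resolvent_ge:
  assumes psd: "psd S R" and inv: "\<And>i. i \<in> S \<Longrightarrow> mapp S R y i = x i"
    and x: "(\<Sum>i\<in>S. (norm (x i))\<^sup>2) = 1" and le: "Re (cdot S y x) \<le> \<gamma>" "0 < \<gamma>"
  shows "1 / \<gamma> \<le> moment S R 1 x"
proof -
  have "cdot S x (mapp S R y) = 1" 
    using x cdot_self[of S x] cdot_cong[of S x x "mapp S R y" x] inv by simp
  then have "1 \<le> moment S R 1 x * moment S R 1 y"
    using psd_cauchy_schwarz [OF psd, of x y] by simp
  also have "moment S R 1 y = Re (cdot S y x)"
    unfolding moment_1 using cdot_cong[of S y y "mapp S R y" x] inv by simp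
  also have "moment S R 1 x * Re (cdot S y x) \<le> moment S R 1 x * \<gamma>"
    by (intro mult_left_mono le moment_nonneg psd)
  finally show ?thesis using le by (simp add: field_simps)
qed

lemma funpow_mapp_expand:
  assumes "finite S" "i \<in> S"
  shows "(mapp S R ^^ k) f i = (\<Sum>j\<in>S. f j * (mapp S R ^^ k) (unitvec j) i)"
  using assms(2)
proof (induction k arbitrary: i)
  case 0
  then show ?case using assms(1) by (simp add: unitvec_def if_distrib sum.delta cong: if_cong)
next
  case (Suc k)
  have "(mapp S R ^^ Suc k) f i = (\<Sum>l\<in>S. R i l * (\<Sum>j\<in>S. f j * (mapp S R ^^ k) (unitvec j) l))"
    using Suc by (simp add: mapp_def [of S R "(mapp S R ^^ k) f"])
  also have "\<dots> = (\<Sum>j\<in>S. f j * (\<Sum>l\<in>S. R i l * (mapp S R ^^ k) (unitvec j) l))"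
    unfolding sum_distrib_left by (subst sum.swap) (simp add: mult_ac)
  finally show ?case by (simp add: mapp_def [of S R "(mapp S R ^^ k) (unitvec _)"])
qed

section \<open>Conditioning of independent isotropic vectors\<close>

lemma measurable_mapp_pow:
  fixes F :: "'b \<Rightarrow> 'i \<Rightarrow> 'i \<Rightarrow> complex"
  assumes "\<And>i j. (\<lambda>\<omega>. F \<omega> i j) \<in> borel_measurable M"
  shows "(\<lambda>\<omega>. (mapp S (F \<omega>) ^^ k) x i) \<in> borel_measurable M"
  using assms by (induction k arbitrary: i) (simp_all add: mapp_def)

lemma measurable_trace_pow:
  fixes F :: "'b \<Rightarrow> 'i \<Rightarrow> 'i \<Rightarrow> complex"
  assumes "\<And>i j. (\<lambda>\<omega>. F \<omega> i j) \<in> borel_measurable M"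
  shows "(\<lambda>\<omega>. trace_pow S (F \<omega>) k) \<in> borel_measurable M"
  unfolding trace_pow_def moment_def cdot_def
  by (intro borel_measurable_sum borel_measurable_times borel_measurable_const borel_measurable_Re
      measurable_compose [OF _ borel_measurable_Re] measurable_mapp_pow assms)

lemma borel_measurable_cnj [measurable]: "f \<in> borel_measurable M \<Longrightarrow> (\<lambda>x. cnj (f x)) \<in> borel_measurable M"
  by (rule borel_measurable_continuous_on [OF continuous_on_cnj [OF continuous_on_id]])

lemma measurable_sherman:
  fixes F :: "'b \<Rightarrow> 'i \<Rightarrow> 'i \<Rightarrow> complex"
  assumes [measurable]: "\<And>i j. (\<lambda>\<omega>. F \<omega> i j) \<in> borel_measurable M"
    and f: "\<And>i. i \<in> S \<Longrightarrow> (\<lambda>\<omega>. f \<omega> i) \<in> borel_measurable M"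
  shows "(\<lambda>\<omega>. sherman_morrison S (F \<omega>) (f \<omega>) i j) \<in> borel_measurable M"
proof -
  have m [measurable]: "(\<lambda>\<omega>. mapp S (F \<omega>) (f \<omega>) i) \<in> borel_measurable M" for i
    unfolding mapp_def by (intro borel_measurable_sum borel_measurable_times assms)
  have [measurable]: "(\<lambda>\<omega>. moment S (F \<omega>) 1 (f \<omega>)) \<in> borel_measurable M"
    unfolding moment_1 cdot_def
    by (intro measurable_compose [OF _ borel_measurable_Re] borel_measurable_sum borel_measurable_times m
        borel_measurable_cnj f)
  show ?thesis
    unfolding sherman_morrison_def sherman_coeff_def by measurable
qed

section \<open>The starting point of the recursion: multiples of the identity\<close>

definition scalar_mat :: "real \<Rightarrow> 'i \<Rightarrow> 'i \<Rightarrow> complex" where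
  "scalar_mat c = (\<lambda>i j. if i = j then of_real c else 0)"

lemma mapp_ident: "finite S \<Longrightarrow> i \<in> S \<Longrightarrow> mapp S (scalar_mat c) x i = of_real c * x i"
  by (simp add: mapp_def scalar_mat_def if_distrib [of "\<lambda>z. z * _"] sum.delta' cong: if_cong)

lemma moment_ident:
  assumes "finite S"
  shows "moment S (scalar_mat c) k x = c ^ k * (\<Sum>i\<in>S. (norm (x i))\<^sup>2)"
proof -
  have "(mapp S (scalar_mat c) ^^ k) x i = of_real (c ^ k) * x i" if "i \<in> S" for i
    using that by (induction k arbitrary: i) (simp_all add: mapp_ident assms)
  then have "cdot S x ((mapp S (scalar_mat c) ^^ k) x) = cdot S x (\<lambda>i. of_real (c ^ k) * x i)"
    by (intro cdot_cong) auto
  also have "\<dots> = of_real (c ^ k * (\<Sum>i\<in>S. (norm (x i))\<^sup>2))"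
    by (simp only: cdot_scale_right cdot_self of_real_mult)
  finally show ?thesis by (simp only: moment_def Re_complex_of_real)
qed

lemma psd_ident:
  assumes "finite S" "0 \<le> c"
  shows "psd S (scalar_mat c)"
  unfolding psd_def moment_1 [symmetric] moment_ident [OF assms(1)]
  using assms(2) by (auto simp: scalar_mat_def intro!: sum_nonneg mult_nonneg_nonneg)

lemma trace_pow_ident:
  assumes "finite S"
  shows "trace_pow S (scalar_mat c) k = real (card S) * c ^ k"
proof -
  have "(\<Sum>j\<in>S. (norm (unitvec i j))\<^sup>2) = 1" if "i \<in> S" for i
    using Re_cdot_self [of S "unitvec i"] cdot_unitvec [OF assms that, of "unitvec i"] by (simp add: unitvec_def)
  then show ?thesis by (simp add: trace_pow_def moment_ident assms)
qed

text \<open>Closes the recursion for the expected trace: the linear loss \<open>real p * x\<close>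
  is absorbed into the \<open>p\<close>-th power of a scalar. Since 1 / (1 + x) = 1 - x / (1 + x),
  Bernoulli's inequality applies at - x / (1 + x).\<close>

lemma power_inverse_bernoulli:
  assumes "0 \<le> (x :: real)"
  shows "1 - real p * x \<le> (1 / (1 + x)) ^ p"
proof -
  have "1 - real p * x \<le> 1 - real p * (x / (1 + x))"
    using assms by (intro diff_left_mono mult_left_mono) (simp_all add: pos_divide_le_eq algebra_simps)
  also have "\<dots> \<le> (1 + - (x / (1 + x))) ^ p"
    using Bernoulli_inequality [of "- (x / (1 + x))" p] assms by (simp add: pos_divide_le_eq)
  also have "1 + - (x / (1 + x)) = 1 / (1 + x)" using assms by (simp add: field_simps)
  finally show ?thesis .
qed

section \<open>Bounded random vectors with identity covariance\<close>

locale isotropic = prob_space N for N :: "'b measure" +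
  fixes S :: "'i set" and \<phi> :: "'b \<Rightarrow> 'i \<Rightarrow> complex" and D :: real
  assumes finite_S: "finite S"
    and measurable_\<phi>: "i \<in> S \<Longrightarrow> (\<lambda>b. \<phi> b i) \<in> borel_measurable N"
    and norm_\<phi>: "(\<Sum>i\<in>S. (norm (\<phi> b i))\<^sup>2) \<le> D"
    and isotropic: "i \<in> S \<Longrightarrow> j \<in> S \<Longrightarrow> (\<integral>b. cnj (\<phi> b i) * \<phi> b j \<partial>N) = (if i = j then 1 else 0)"
begin

lemma integrable_coord:
  assumes "i \<in> S" "j \<in> S"
  shows "integrable N (\<lambda>b. cnj (\<phi> b i) * \<phi> b j)"
proof (rule integrable_const_bound [where B = D])
  have sq: "(norm (\<phi> b k))\<^sup>2 \<le> D" if "k \<in> S" for b k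
    using norm_\<phi> [of b] finite_S that
    by (meson member_le_sum order_trans zero_le_power2)
  then have "norm (\<phi> b i) * norm (\<phi> b j) \<le> D" for b
    using sum_squares_bound [of "norm (\<phi> b i)" "norm (\<phi> b j)"] sq [OF assms(1), of b] sq [OF assms(2), of b]
    by linarith
  then show "AE b in N. norm (cnj (\<phi> b i) * \<phi> b j) \<le> D" by (simp add: norm_mult)
  show "(\<lambda>b. cnj (\<phi> b i) * \<phi> b j) \<in> borel_measurable N"
    using measurable_\<phi> [OF assms(1)] measurable_\<phi> [OF assms(2)]
    by (intro borel_measurable_times borel_measurable_cnj)
qed

lemma moment_expand:
  "moment S R k (\<phi> b) = Re (\<Sum>i\<in>S. \<Sum>j\<in>S. (mapp S R ^^ k) (unitvec j) i * (cnj (\<phi> b i) * \<phi> b j))"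
  unfolding moment_def cdot_def
  by (rule arg_cong [where f = Re], intro sum.cong refl, subst funpow_mapp_expand [OF finite_S])
     (simp_all add: sum_distrib_left mult_ac)

text \<open>Identity covariance turns the expected quadratic form of R^k into its trace. In this way
  the random decrease in \<open>trace_pow_sherman_le\<close> becomes a multiple of
  \<open>trace_pow S R (p + 1)\<close>.\<close>

lemma
  shows integrable_moment: "integrable N (\<lambda>b. moment S R k (\<phi> b))"
    and integral_moment: "(\<integral>b. moment S R k (\<phi> b) \<partial>N) = trace_pow S R k"
proof -
  have int: "integrable N (\<lambda>b. \<Sum>i\<in>S. \<Sum>j\<in>S. (mapp S R ^^ k) (unitvec j) i * (cnj (\<phi> b i) * \<phi> b j))"
    by (intro Bochner_Integration.integrable_sum integrable_mult_right integrable_coord)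
  then show "integrable N (\<lambda>b. moment S R k (\<phi> b))"
    unfolding moment_expand by (rule integrable_Re)
  have "(\<integral>b. moment S R k (\<phi> b) \<partial>N) =
      Re (\<integral>b. (\<Sum>i\<in>S. \<Sum>j\<in>S. (mapp S R ^^ k) (unitvec j) i * (cnj (\<phi> b i) * \<phi> b j)) \<partial>N)"
    unfolding moment_expand by (rule integral_Re [OF int])
  also have "(\<integral>b. (\<Sum>i\<in>S. \<Sum>j\<in>S. (mapp S R ^^ k) (unitvec j) i * (cnj (\<phi> b i) * \<phi> b j)) \<partial>N)
      = (\<Sum>i\<in>S. \<Sum>j\<in>S. (mapp S R ^^ k) (unitvec j) i * (if i = j then 1 else 0))"
    by (subst Bochner_Integration.integral_sum Bochner_Integration.integrable_sum,
        intro Bochner_Integration.integrable_sum integrable_mult_right integrable_coord, assumption+,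
        intro sum.cong refl,
        subst Bochner_Integration.integral_sum, intro integrable_mult_right integrable_coord, assumption+)
       (simp add: isotropic integrable_coord cong: sum.cong)
  also have "Re \<dots> = trace_pow S R k"
    using finite_S by (simp add: trace_pow_alt if_distrib [of "\<lambda>z. _ * z"] sum.delta cong: if_cong)
  finally show "(\<integral>b. moment S R k (\<phi> b) \<partial>N) = trace_pow S R k" .
qed

lemma D_nonneg: "0 \<le> D"
  using norm_\<phi> [of undefined] by (rule order_trans [rotated]) (simp add: sum_nonneg)

text \<open>
  The expected decrease of \<open>trace_pow\<close> under one more sample is at least
  \<open>p * \<kappa> * trace_pow S R (p + 1)\<close>, which makes \<open>(trace_pow / card S) powr (- 1 / p)\<close> grow by
  \<open>\<kappa>\<close> per sample.
\<close>

lemma resolvent_family: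
  fixes \<kappa> \<mu> \<tau> :: real and p :: nat and I :: "'q set"
  defines "\<tau> \<equiv> D / \<mu>"
  defines "\<kappa> \<equiv> (1 - (real p - 1) * \<tau> / 2) / (1 + \<tau>)"
  assumes "0 < \<mu>" "0 < p" "real p * \<tau> \<le> 2" "real p + 1 \<le> \<mu>" "finite I"
  shows "\<exists>F. (\<forall>i j. (\<lambda>\<omega>. F \<omega> i j) \<in> borel_measurable (PiM I (\<lambda>_. N))) \<and>
    (\<forall>\<omega>. psd S (F \<omega>)) \<and>
    (\<forall>\<omega> x. moment S (F \<omega>) 1 x \<le> (\<Sum>i\<in>S. (norm (x i))\<^sup>2) / \<mu>) \<and>
    (\<forall>\<omega> x. \<forall>i\<in>S. mapp S (F \<omega>) (\<lambda>i. of_real \<mu> * x i + (\<Sum>q\<in>I. cdot S (\<phi> (\<omega> q)) x * \<phi> (\<omega> q) i)) i = x i) \<and>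
    (\<forall>\<omega>. \<forall>k\<in>{p, p + 1}. trace_pow S (F \<omega>) k \<le> real (card S) * (1 / \<mu>) ^ k) \<and>
    (\<integral>\<omega>. trace_pow S (F \<omega>) p \<partial>PiM I (\<lambda>_. N)) \<le> real (card S) * (1 / (\<mu> + real (card I) * \<kappa>)) ^ p"
  using \<open>finite I\<close>
proof induction
  case empty
  interpret P: prob_space "PiM {} (\<lambda>_::'q. N)" by (rule prob_space_PiM) (rule prob_space_axioms)
  have "mapp S (scalar_mat (1 / \<mu>)) (\<lambda>i. of_real \<mu> * x i + (\<Sum>q\<in>{}. cdot S (\<phi> (\<omega> q)) x * \<phi> (\<omega> q) i)) i = x i"
    if "i \<in> S" for x i and \<omega> :: "'q \<Rightarrow> 'b"
    using \<open>0 < \<mu>\<close> by (simp add: mapp_ident finite_S that flip: of_real_mult)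
  then show ?case
    using \<open>0 < \<mu>\<close>
    by (intro exI [of _ "\<lambda>_. scalar_mat (1 / \<mu>)"] conjI allI ballI psd_ident)
       (simp_all only: moment_ident trace_pow_ident finite_S P.prob_space lebesgue_integral_const, simp_all add: P.prob_space)
next
  case (insert q I)
  then obtain F where meas: "\<And>i j. (\<lambda>\<omega>. F \<omega> i j) \<in> borel_measurable (PiM I (\<lambda>_. N))"
    and psd: "\<And>\<omega>. psd S (F \<omega>)"
    and bound: "\<And>\<omega> x. moment S (F \<omega>) 1 x \<le> (\<Sum>i\<in>S. (norm (x i))\<^sup>2) / \<mu>"
    and inv: "\<And>\<omega> x i. i \<in> S \<Longrightarrow>
      mapp S (F \<omega>) (\<lambda>i. of_real \<mu> * x i + (\<Sum>q\<in>I. cdot S (\<phi> (\<omega> q)) x * \<phi> (\<omega> q) i)) i = x i"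
    and trace: "\<And>\<omega> k. k \<in> {p, p + 1} \<Longrightarrow> trace_pow S (F \<omega>) k \<le> real (card S) * (1 / \<mu>) ^ k"
    and IH: "(\<integral>\<omega>. trace_pow S (F \<omega>) p \<partial>PiM I (\<lambda>_. N)) \<le> real (card S) * (1 / (\<mu> + real (card I) * \<kappa>)) ^ p"
    by (elim exE conjE) blast
  interpret product_sigma_finite "\<lambda>_::'q. N" by standard
  interpret PI: prob_space "PiM I (\<lambda>_::'q. N)" by (rule prob_space_PiM) (rule prob_space_axioms)
  interpret PQ: prob_space "PiM (insert q I) (\<lambda>_::'q. N)" by (rule prob_space_PiM) (rule prob_space_axioms)
  \<comment> \<open>\<open>F\<close> is measurable on the product over \<open>I\<close>, whose
    points are \<open>undefined\<close> outside \<open>I\<close>; \<open>restrict\<close> brings a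
    point of the larger product there.\<close>
  define R where "R \<omega> = F (restrict \<omega> I)" for \<omega>
  define F' where "F' \<omega> = sherman_morrison S (R \<omega>) (\<phi> (\<omega> q))" for \<omega>
  have \<tau>: "0 \<le> \<tau>" using D_nonneg \<open>0 < \<mu>\<close> by (simp add: \<tau>_def)
  have small: "(real k - 1) * \<tau> \<le> 2" if "k \<in> {p, p + 1}" for k
    using that \<open>real p * \<tau> \<le> 2\<close> \<tau> by (auto simp: algebra_simps)
  have \<kappa>: "0 \<le> \<kappa>" "\<kappa> \<le> 1"
  proof -
    have "0 \<le> (real p - 1) * \<tau>" using \<tau> \<open>0 < p\<close> by (intro mult_nonneg_nonneg) auto
    then show "0 \<le> \<kappa>" "\<kappa> \<le> 1"
      using small[of p] \<tau> unfolding \<kappa>_def by (simp_all add: divide_le_eq_1)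
  qed
  have meas_R: "(\<lambda>\<omega>. R \<omega> i j) \<in> borel_measurable (PiM (insert q I) (\<lambda>_. N))" for i j
    unfolding R_def by (rule measurable_compose [OF measurable_restrict_subset meas]) auto
  have meas': "(\<lambda>\<omega>. F' \<omega> i j) \<in> borel_measurable (PiM (insert q I) (\<lambda>_. N))" for i j
    unfolding F'_def
    by (rule measurable_sherman, rule meas_R,
        rule measurable_compose [where f = "\<lambda>\<omega>. \<omega> q", OF measurable_component_singleton], simp, rule measurable_\<phi>)
  have psd_R: "psd S (R \<omega>)" for \<omega> by (simp add: R_def psd)
  have psd': "psd S (F' \<omega>)" for \<omega> by (simp add: F'_def psd_sherman psd_R)
  have moment_le: "moment S (F \<omega>) 1 (\<phi> b) \<le> \<tau>" for \<omega> b
    using bound[of \<omega> "\<phi> b"] norm_\<phi>[of b] \<open>0 < \<mu>\<close> unfolding \<tau>_def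
    by (meson divide_right_mono less_imp_le order_trans)
  have drop: "trace_pow S (sherman_morrison S (F \<omega>) (\<phi> b)) k \<le> trace_pow S (F \<omega>) k
      - real k * ((1 - (real k - 1) * \<tau> / 2) / (1 + \<tau>)) * moment S (F \<omega>) (k + 1) (\<phi> b)"
    if "k \<in> {p, p + 1}" for k \<omega> b
    using that \<open>0 < p\<close> by (intro trace_pow_sherman_le finite_S psd moment_le small) auto
  have trace': "trace_pow S (F' \<omega>) k \<le> real (card S) * (1 / \<mu>) ^ k" if "k \<in> {p, p + 1}" for k \<omega>
  proof -
    have "0 \<le> real k * ((1 - (real k - 1) * \<tau> / 2) / (1 + \<tau>)) * moment S (R \<omega>) (k + 1) (\<phi> (\<omega> q))"
      using small[OF that] \<tau> by (intro mult_nonneg_nonneg moment_nonneg psd_R divide_nonneg_nonneg) auto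
    then show ?thesis
      using drop[OF that, of "restrict \<omega> I" "\<omega> q"] trace[OF that, of "restrict \<omega> I"]
      unfolding F'_def R_def by linarith
  qed
  have trace_nonneg: "0 \<le> trace_pow S A k" if "psd S A" for A k
    unfolding trace_pow_def by (intro sum_nonneg moment_nonneg that)
  have int_F: "integrable (PiM I (\<lambda>_. N)) (\<lambda>\<omega>. trace_pow S (F \<omega>) k)" if "k \<in> {p, p + 1}" for k
    using trace[OF that] trace_nonneg[OF psd]
    by (intro PI.integrable_const_bound [where B = "real (card S) * (1 / \<mu>) ^ k"] measurable_trace_pow meas) auto
  have int_F': "integrable (PiM (insert q I) (\<lambda>_. N)) (\<lambda>\<omega>. trace_pow S (F' \<omega>) p)"
    using trace'[of p] trace_nonneg[OF psd']
    by (intro PQ.integrable_const_bound [where B = "real (card S) * (1 / \<mu>) ^ p"] measurable_trace_pow meas') auto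
  \<comment> \<open>The reciprocal of the current denominator: the induction hypothesis reads as
    expected trace at most d g^p, and as a tangent point \<open>g\<close> is exact when all
    eigenvalues equal \<open>g\<close>.\<close>
  define g where "g = 1 / (\<mu> + real (card I) * \<kappa>)"
  define d where "d = real (card S)"
  have pos: "0 < \<mu> + real (card I) * \<kappa>" using \<open>0 < \<mu>\<close> \<kappa> by (intro add_pos_nonneg) auto
  have g: "0 < g" using pos by (simp add: g_def)
  have "g \<le> 1 / \<mu>" using \<open>0 < \<mu>\<close> \<kappa> pos unfolding g_def by (intro divide_left_mono) auto
  \<comment> \<open>The weight \<open>1 - \<kappa> * (real p + 1) * g\<close> has to be nonnegative
    before the induction hypothesis can be inserted; this is where
    \<open>real p + 1 \<le> \<mu>\<close> enters.\<close>
  have g_le: "\<kappa> * (real p + 1) * g \<le> 1"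
  proof -
    have "\<kappa> * (real p + 1) * g \<le> 1 * \<mu> * (1 / \<mu>)"
      using \<kappa> g \<open>g \<le> 1 / \<mu>\<close> \<open>real p + 1 \<le> \<mu>\<close> \<open>0 < \<mu>\<close> by (intro mult_mono mult_nonneg_nonneg) auto
    then show ?thesis using \<open>0 < \<mu>\<close> by simp
  qed
  have "(\<integral>\<omega>. trace_pow S (F' \<omega>) p \<partial>PiM (insert q I) (\<lambda>_. N)) =
      (\<integral>\<omega>. (\<integral>b. trace_pow S (F' (fun_upd \<omega> q b)) p \<partial>N) \<partial>PiM I (\<lambda>_. N))"
    by (rule product_integral_insert [OF insert(1,2) int_F'])
  also have "\<dots> \<le> (\<integral>\<omega>. (1 - \<kappa> * (real p + 1) * g) * trace_pow S (F \<omega>) p + \<kappa> * (d * g ^ (p + 1)) \<partial>PiM I (\<lambda>_. N))"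
  proof (rule integral_mono')
    show "integrable (PiM I (\<lambda>_. N)) (\<lambda>\<omega>. (1 - \<kappa> * (real p + 1) * g) * trace_pow S (F \<omega>) p + \<kappa> * (d * g ^ (p + 1)))"
      using int_F[of p] by simp
    fix \<omega> assume \<omega>: "\<omega> \<in> space (PiM I (\<lambda>_. N))"
    then have restrict: "restrict (fun_upd \<omega> q b) I = \<omega>" for b
      using insert(2) by (auto simp: space_PiM PiE_def extensional_def restrict_def fun_eq_iff)
    have F': "F' (fun_upd \<omega> q b) = sherman_morrison S (F \<omega>) (\<phi> b)" for b
      by (simp add: F'_def R_def restrict)
    have "(\<integral>b. trace_pow S (F' (fun_upd \<omega> q b)) p \<partial>N) \<le>
        (\<integral>b. trace_pow S (F \<omega>) p - real p * \<kappa> * moment S (F \<omega>) (p + 1) (\<phi> b) \<partial>N)"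
    proof (rule integral_mono')
      show "integrable N (\<lambda>b. trace_pow S (F \<omega>) p - real p * \<kappa> * moment S (F \<omega>) (p + 1) (\<phi> b))"
        by (intro Bochner_Integration.integrable_diff integrable_const integrable_mult_right integrable_moment)
      show "trace_pow S (F' (fun_upd \<omega> q b)) p \<le> trace_pow S (F \<omega>) p - real p * \<kappa> * moment S (F \<omega>) (p + 1) (\<phi> b)" for b
        unfolding F' \<kappa>_def by (rule drop) simp
      then show "0 \<le> trace_pow S (F \<omega>) p - real p * \<kappa> * moment S (F \<omega>) (p + 1) (\<phi> b)" for b
        using trace_nonneg[OF psd'] by (meson order_trans)
    qed
    also have "\<dots> = trace_pow S (F \<omega>) p - \<kappa> * (real p * trace_pow S (F \<omega>) (p + 1))"
      by (simp add: integrable_moment integral_moment prob_space del: One_nat_def add_Suc_right)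
    also have "\<dots> \<le> trace_pow S (F \<omega>) p - \<kappa> * ((real p + 1) * g * trace_pow S (F \<omega>) p - d * g ^ (p + 1))"
      using trace_pow_tangent [OF finite_S psd, of g p \<omega>] g \<kappa> unfolding d_def
      by (intro diff_left_mono mult_left_mono) auto
    finally show "(\<integral>b. trace_pow S (F' (fun_upd \<omega> q b)) p \<partial>N) \<le>
        (1 - \<kappa> * (real p + 1) * g) * trace_pow S (F \<omega>) p + \<kappa> * (d * g ^ (p + 1))"
      by (simp add: algebra_simps)
    show "0 \<le> (1 - \<kappa> * (real p + 1) * g) * trace_pow S (F \<omega>) p + \<kappa> * (d * g ^ (p + 1))"
      using g_le g \<kappa> trace_nonneg[OF psd] unfolding d_def
      by (intro add_nonneg_nonneg mult_nonneg_nonneg) auto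
  qed
  also have "\<dots> = (1 - \<kappa> * (real p + 1) * g) * (\<integral>\<omega>. trace_pow S (F \<omega>) p \<partial>PiM I (\<lambda>_. N)) + \<kappa> * (d * g ^ (p + 1))"
    using int_F[of p] by (simp add: PI.prob_space)
  also have "\<dots> \<le> (1 - \<kappa> * (real p + 1) * g) * (d * g ^ p) + \<kappa> * (d * g ^ (p + 1))"
    using IH g_le unfolding d_def g_def by (intro add_right_mono mult_left_mono) auto
  also have "\<dots> = d * g ^ p * (1 - real p * (\<kappa> * g))"
    by (simp add: algebra_simps)
  also have "\<dots> \<le> d * g ^ p * (1 / (1 + \<kappa> * g)) ^ p"
    using g \<kappa> by (intro mult_left_mono power_inverse_bernoulli mult_nonneg_nonneg) (auto simp: d_def)
  also have "\<dots> = d * (g * (1 / (1 + \<kappa> * g))) ^ p"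
    by (simp only: power_mult_distrib mult.assoc)
  \<comment> \<open>On the reciprocal scale the recursion is additive: one sample raises the
    denominator by exactly \<open>\<kappa>\<close>.\<close>
  also have "g * (1 / (1 + \<kappa> * g)) = 1 / (1 / g + \<kappa>)"
    using g \<kappa> by (simp add: field_simps)
  also have "1 / g + \<kappa> = \<mu> + real (card (insert q I)) * \<kappa>"
    using insert(1,2) by (simp add: g_def algebra_simps)
  finally have final: "(\<integral>\<omega>. trace_pow S (F' \<omega>) p \<partial>PiM (insert q I) (\<lambda>_. N)) \<le>
      real (card S) * (1 / (\<mu> + real (card (insert q I)) * \<kappa>)) ^ p" by (simp only: d_def)
  have bound': "moment S (F' \<omega>) 1 x \<le> (\<Sum>i\<in>S. (norm (x i))\<^sup>2) / \<mu>" for \<omega> x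
    using moment_sherman_le [OF psd_R] bound unfolding F'_def R_def by (rule order_trans)
  have inv': "mapp S (F' \<omega>) (\<lambda>i. of_real \<mu> * x i + (\<Sum>q\<in>insert q I. cdot S (\<phi> (\<omega> q)) x * \<phi> (\<omega> q) i)) i = x i"
    if "i \<in> S" for \<omega> x i
  proof -
    have "(\<Sum>r\<in>I. cdot S (\<phi> (restrict \<omega> I r)) x * \<phi> (restrict \<omega> I r) j) = (\<Sum>r\<in>I. cdot S (\<phi> (\<omega> r)) x * \<phi> (\<omega> r) j)" for j
      by (intro sum.cong) auto
    then have "mapp S (R \<omega>) (\<lambda>i. of_real \<mu> * x i + (\<Sum>q\<in>I. cdot S (\<phi> (\<omega> q)) x * \<phi> (\<omega> q) i)) j = x j" if "j \<in> S" for j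
      using inv[OF that, of "restrict \<omega> I" x] by (simp add: R_def)
    from resolvent_sherman [OF finite_S psd_R this that, of "\<phi> (\<omega> q)"]
    show ?thesis using insert(1,2) by (simp add: F'_def add_ac)
  qed
  show ?case
    using meas' psd' bound' inv' trace' final by (intro exI [of _ F'] conjI allI ballI) 
qed

text \<open>If the bound fails in some direction, its unit vector z satisfies <z, B z> \<le>
  \<open>\<gamma> + \<mu>\<close> for B = mu + sum phi phi^H. Hence <z, R z> \<ge> 1 /
  (\<open>\<gamma> + \<mu>\<close>) for the resolvent R, and by Jensen tr R^(2h) is at least the
  \<open>2 * h\<close>-th power of that number. Markov's inequality makes this unlikely.\<close>

lemma lower_frame_bound:
  fixes \<mu> \<gamma> :: real and h :: nat and I :: "'q set"
  defines "\<tau> \<equiv> D / \<mu>"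
  defines "\<kappa> \<equiv> (1 - (real (2 * h) - 1) * \<tau> / 2) / (1 + \<tau>)"
  assumes "0 < \<mu>" "0 < h" "real (2 * h) * \<tau> \<le> 2" "real (2 * h) + 1 \<le> \<mu>" "0 \<le> \<gamma>" "finite I"
  shows "\<exists>G\<in>sets (PiM I (\<lambda>_. N)).
    1 - real (card S) * ((\<gamma> + \<mu>) / (\<mu> + real (card I) * \<kappa>)) ^ (2 * h) \<le> measure (PiM I (\<lambda>_. N)) G \<and>
    (\<forall>\<omega>\<in>G. \<forall>x. \<gamma> * (\<Sum>i\<in>S. (norm (x i))\<^sup>2) \<le> (\<Sum>q\<in>I. (norm (cdot S (\<phi> (\<omega> q)) x))\<^sup>2))"
proof -
  obtain F where meas: "\<And>i j. (\<lambda>\<omega>. F \<omega> i j) \<in> borel_measurable (PiM I (\<lambda>_. N))"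
    and psd: "\<And>\<omega>. psd S (F \<omega>)"
    and inv: "\<And>\<omega> x i. i \<in> S \<Longrightarrow>
      mapp S (F \<omega>) (\<lambda>i. of_real \<mu> * x i + (\<Sum>q\<in>I. cdot S (\<phi> (\<omega> q)) x * \<phi> (\<omega> q) i)) i = x i"
    and trace: "\<And>\<omega>. trace_pow S (F \<omega>) (2 * h) \<le> real (card S) * (1 / \<mu>) ^ (2 * h)"
    and int: "(\<integral>\<omega>. trace_pow S (F \<omega>) (2 * h) \<partial>PiM I (\<lambda>_. N)) \<le> real (card S) * (1 / (\<mu> + real (card I) * \<kappa>)) ^ (2 * h)"
  proof -
    have "0 < 2 * h" using assms by simp
    from resolvent_family [OF \<open>0 < \<mu>\<close> this assms(5)[unfolded \<tau>_def] \<open>real (2 * h) + 1 \<le> \<mu>\<close> \<open>finite I\<close>]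
    obtain F where "\<forall>i j. (\<lambda>\<omega>. F \<omega> i j) \<in> borel_measurable (PiM I (\<lambda>_. N))"
      "\<forall>\<omega>. psd S (F \<omega>)"
      "\<forall>\<omega> x. \<forall>i\<in>S. mapp S (F \<omega>) (\<lambda>i. of_real \<mu> * x i + (\<Sum>q\<in>I. cdot S (\<phi> (\<omega> q)) x * \<phi> (\<omega> q) i)) i = x i"
      "\<forall>\<omega>. \<forall>k\<in>{2 * h, 2 * h + 1}. trace_pow S (F \<omega>) k \<le> real (card S) * (1 / \<mu>) ^ k"
      "(\<integral>\<omega>. trace_pow S (F \<omega>) (2 * h) \<partial>PiM I (\<lambda>_. N)) \<le> real (card S) * (1 / (\<mu> + real (card I) * \<kappa>)) ^ (2 * h)"
      unfolding \<kappa>_def \<tau>_def by (elim exE conjE)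
    then show ?thesis by (intro that [of F]) simp_all
  qed
  interpret P: prob_space "PiM I (\<lambda>_::'q. N)" by (rule prob_space_PiM) (rule prob_space_axioms)
  define c where "c = (1 / (\<gamma> + \<mu>)) ^ (2 * h)"
  have c: "0 < c" using assms by (simp add: c_def)
  \<comment> \<open>The event is defined by the trace, whose measurability is known, and not by a
    condition on all vectors.\<close>
  define G where "G = {\<omega> \<in> space (PiM I (\<lambda>_. N)). trace_pow S (F \<omega>) (2 * h) < c}"
  have m [measurable]: "(\<lambda>\<omega>. trace_pow S (F \<omega>) (2 * h)) \<in> borel_measurable (PiM I (\<lambda>_. N))"
    by (rule measurable_trace_pow [OF meas])
  have nonneg: "0 \<le> trace_pow S (F \<omega>) (2 * h)" for \<omega>
    unfolding trace_pow_def by (intro sum_nonneg moment_nonneg psd)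
  have "integrable (PiM I (\<lambda>_. N)) (\<lambda>\<omega>. trace_pow S (F \<omega>) (2 * h))"
    using trace nonneg by (intro P.integrable_const_bound [where B = "real (card S) * (1 / \<mu>) ^ (2 * h)"] m) auto
  then have "measure (PiM I (\<lambda>_. N)) {\<omega> \<in> space (PiM I (\<lambda>_. N)). c \<le> trace_pow S (F \<omega>) (2 * h)} \<le>
      (\<integral>\<omega>. trace_pow S (F \<omega>) (2 * h) \<partial>PiM I (\<lambda>_. N)) / c"
    using c nonneg by (intro integral_Markov_inequality_measure [where A = "{}"]) auto
  also have "\<dots> \<le> real (card S) * (1 / (\<mu> + real (card I) * \<kappa>)) ^ (2 * h) / c"
    using int c by (intro divide_right_mono) auto
  also have "\<dots> = real (card S) * ((\<gamma> + \<mu>) / (\<mu> + real (card I) * \<kappa>)) ^ (2 * h)"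
    by (simp add: c_def power_divide)
  also have "{\<omega> \<in> space (PiM I (\<lambda>_. N)). c \<le> trace_pow S (F \<omega>) (2 * h)} = space (PiM I (\<lambda>_. N)) - G"
    by (auto simp: G_def)
  also have "measure (PiM I (\<lambda>_. N)) (space (PiM I (\<lambda>_. N)) - G) = 1 - measure (PiM I (\<lambda>_. N)) G"
    by (rule P.prob_compl) (simp add: G_def)
  finally have "1 - real (card S) * ((\<gamma> + \<mu>) / (\<mu> + real (card I) * \<kappa>)) ^ (2 * h) \<le> measure (PiM I (\<lambda>_. N)) G"
    by linarith
  moreover have "\<gamma> * (\<Sum>i\<in>S. (norm (x i))\<^sup>2) \<le> (\<Sum>q\<in>I. (norm (cdot S (\<phi> (\<omega> q)) x))\<^sup>2)" if "\<omega> \<in> G" for \<omega> x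
  proof (rule ccontr)
    assume neg: "\<not> ?thesis"
    define v where "v = (\<Sum>i\<in>S. (norm (x i))\<^sup>2)"
    have "0 \<le> v" by (simp add: v_def sum_nonneg)
    moreover have "v \<noteq> 0" using neg by (auto simp: v_def sum_nonneg)
    ultimately have v: "0 < v" by simp
    define z where "z i = x i / of_real (sqrt v)" for i
    have z: "(\<Sum>i\<in>S. (norm (z i))\<^sup>2) = 1"
      using v by (simp add: z_def norm_divide power_divide v_def flip: sum_divide_distrib)
    define y where "y = (\<lambda>i. of_real \<mu> * z i + (\<Sum>q\<in>I. cdot S (\<phi> (\<omega> q)) z * \<phi> (\<omega> q) i))"
    have cdot_z: "cdot S f z = cdot S f x / of_real (sqrt v)" for f
      by (simp add: cdot_def z_def sum_divide_distrib)
    have "cdot S z y = of_real \<mu> * cdot S z z + (\<Sum>q\<in>I. cdot S (\<phi> (\<omega> q)) z * cdot S z (\<phi> (\<omega> q)))"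
    proof -
      have "cdot S z (\<lambda>i. \<Sum>q\<in>I. cdot S (\<phi> (\<omega> q)) z * \<phi> (\<omega> q) i) =
          (\<Sum>q\<in>I. cdot S (\<phi> (\<omega> q)) z * cdot S z (\<phi> (\<omega> q)))"
        unfolding cdot_def [of S z] sum_distrib_left by (subst sum.swap) (simp add: mult_ac)
      then show ?thesis unfolding y_def by (simp only: cdot_add_right cdot_scale_right)
    qed
    also have "\<dots> = of_real (\<mu> + (\<Sum>q\<in>I. (norm (cdot S (\<phi> (\<omega> q)) z))\<^sup>2))"
    proof -
      have "cdot S f z * cdot S z f = of_real ((norm (cdot S f z))\<^sup>2)" for f
        unfolding cdot_commute [of S z f] complex_norm_square ..
      then show ?thesis by (simp only: cdot_self z of_real_add of_real_sum of_real_1 mult_1_right)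
    qed
    finally have "Re (cdot S y z) = \<mu> + (\<Sum>q\<in>I. (norm (cdot S (\<phi> (\<omega> q)) z))\<^sup>2)"
      by (simp add: cdot_commute [of S y z] del: of_real_add)
    also have "(\<Sum>q\<in>I. (norm (cdot S (\<phi> (\<omega> q)) z))\<^sup>2) = (\<Sum>q\<in>I. (norm (cdot S (\<phi> (\<omega> q)) x))\<^sup>2) / v"
      using v by (simp add: cdot_z norm_divide power_divide sum_divide_distrib)
    also have "\<dots> \<le> \<gamma>" using neg v by (simp add: v_def pos_divide_le_eq)
    finally have "Re (cdot S y z) \<le> \<gamma> + \<mu>" by simp
    then have "1 / (\<gamma> + \<mu>) \<le> moment S (F \<omega>) 1 z"
      using assms by (intro moment_resolvent_ge [OF psd _ z, where y = y]) (auto simp: y_def inv)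
    then have "c \<le> moment S (F \<omega>) (2 * h) z"
      using moment_ge_power [OF psd [of \<omega>], of "1 / (\<gamma> + \<mu>)" z "2 * h - 1"] assms z
      by (simp add: c_def moment_0)
    also have "\<dots> \<le> trace_pow S (F \<omega>) (2 * h)"
      by (rule moment_le_trace_pow [OF finite_S psd z])
    finally show False using that by (simp add: G_def)
  qed
  moreover have "G \<in> sets (PiM I (\<lambda>_. N))" by (simp add: G_def)
  ultimately show ?thesis by blast
qed

end

section \<open>Sums of independent uniform phases\<close>

text \<open>All nonzero Fourier coefficients vanish, the negative ones by conjugation, so
  \<open>e\<close> is uniform on the unit circle. The moment computation asks for exactly these
  integrals.\<close>

locale steinhaus = prob_space N for N :: "'b measure" +
  fixes e :: "'b \<Rightarrow> complex"
  assumes measurable_e [measurable]: "e \<in> borel_measurable N"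
    and norm_e: "norm (e b) = 1"
    and integral_e_power: "0 < k \<Longrightarrow> (\<integral>b. e b ^ k \<partial>N) = 0"
begin

lemma integral_e_orthogonal: "(\<integral>b. e b ^ k * cnj (e b ^ l) \<partial>N) = (if k = l then 1 else 0)"
proof -
  have unit: "e b ^ j * cnj (e b ^ j) = 1" for b j
    using complex_norm_square [of "e b ^ j"] by (simp add: norm_power norm_e)
  have gt: "(\<integral>b. e b ^ k * cnj (e b ^ l) \<partial>N) = 0" if "l < k" for k l
  proof -
    have "e b ^ k * cnj (e b ^ l) = e b ^ (k - l)" for b
    proof -
      have "e b ^ k = e b ^ (k - l) * e b ^ l" using that by (simp flip: power_add)
      then show ?thesis using unit[of b l] by (simp add: mult.assoc)
    qed
    then show ?thesis using integral_e_power[of "k - l"] that by simp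
  qed
  show ?thesis
  proof (cases k l rule: linorder_cases)
    case less
    have "(\<integral>b. e b ^ k * cnj (e b ^ l) \<partial>N) = (\<integral>b. cnj (e b ^ l * cnj (e b ^ k)) \<partial>N)"
      by (simp add: mult.commute)
    also have "\<dots> = cnj (\<integral>b. e b ^ l * cnj (e b ^ k) \<partial>N)" by (rule integral_bounded_linear' [OF bounded_linear_cnj bounded_linear_cnj]) simp
    finally show ?thesis using gt[OF less] less by simp
  qed (use gt unit prob_space in auto)
qed

text \<open>Parseval's identity: the powers of \<open>e\<close> are orthonormal.\<close>

lemma integral_norm_polynomial:
  "(\<integral>b. (norm (\<Sum>k\<le>r. a k * e b ^ k))\<^sup>2 \<partial>N) = (\<Sum>k\<le>r. (norm (a k))\<^sup>2)"
proof -
  have int: "integrable N (\<lambda>b. a k * cnj (a l) * (e b ^ k * cnj (e b ^ l)))" for k l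
    by (intro integrable_mult_right integrable_const_bound [where B = 1])
       (auto simp: norm_mult norm_power norm_e simp del: complex_cnj_power intro!: borel_measurable_times borel_measurable_power measurable_e
          borel_measurable_continuous_on [OF continuous_on_cnj [OF continuous_on_id]])
  have "complex_of_real (\<integral>b. (norm (\<Sum>k\<le>r. a k * e b ^ k))\<^sup>2 \<partial>N) =
      (\<integral>b. complex_of_real ((norm (\<Sum>k\<le>r. a k * e b ^ k))\<^sup>2) \<partial>N)"
    by (rule integral_complex_of_real [symmetric])
  also have "\<dots> = (\<integral>b. (\<Sum>k\<le>r. \<Sum>l\<le>r. a k * cnj (a l) * (e b ^ k * cnj (e b ^ l))) \<partial>N)"
    by (simp only: complex_norm_square cnj_sum sum_product complex_cnj_mult mult_ac)
  also have "\<dots> = (\<Sum>k\<le>r. \<Sum>l\<le>r. a k * cnj (a l) * (if k = l then 1 else 0))"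
    by (simp only: Bochner_Integration.integral_sum Bochner_Integration.integrable_sum int
        integral_mult_right_zero integral_e_orthogonal)
  also have "\<dots> = complex_of_real (\<Sum>k\<le>r. (norm (a k))\<^sup>2)"
    by (simp add: complex_norm_square if_distrib [of "\<lambda>z. _ * z"] sum.delta cong: if_cong del: of_real_power)
  finally show ?thesis by (simp only: of_real_eq_iff)
qed

lemma norm_sum_le:
  "norm (\<Sum>i\<in>I. c i * e (\<omega> i)) \<le> (\<Sum>i\<in>I. norm (c i))"
  by (rule order_trans [OF norm_sum]) (simp add: norm_mult norm_e)

lemma measurable_norm_sum [measurable]:
  "(\<lambda>\<omega>. norm (\<Sum>i\<in>I. c i * e (\<omega> i))) \<in> borel_measurable (PiM I (\<lambda>_. N))"
  by measurable

lemma integrable_norm_sum: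
  "integrable (PiM I (\<lambda>_. N)) (\<lambda>\<omega>. norm (\<Sum>i\<in>I. c i * e (\<omega> i)) ^ k)"
proof -
  interpret P: prob_space "PiM I (\<lambda>_. N)" by (rule prob_space_PiM) (rule prob_space_axioms)
  show ?thesis
    by (rule P.integrable_const_bound [where B = "(\<Sum>i\<in>I. norm (c i)) ^ k"])
       (auto intro!: power_mono norm_sum_le)
qed

text \<open>The bound is the 2r-th absolute moment of a complex Gaussian with the same variance.
  When one index is peeled off, Parseval in the new phase removes the cross terms and leaves squared
  binomial coefficients. One of the two is absorbed by (r choose k) (r-k)! = r!/k! \<le> r!, and the
  binomial theorem reassembles the rest.\<close>

lemma moment_bound:
  assumes "finite I"
  shows "(\<integral>\<omega>. norm (\<Sum>i\<in>I. c i * e (\<omega> i)) ^ (2 * r) \<partial>PiM I (\<lambda>_. N)) \<le> fact r * (\<Sum>i\<in>I. (norm (c i))\<^sup>2) ^ r"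
  using assms
proof (induction I arbitrary: r)
  case empty
  interpret P: prob_space "PiM {} (\<lambda>_. N)" by (rule prob_space_PiM) (rule prob_space_axioms)
  show ?case by (cases r) (simp_all add: P.prob_space)
next
  case (insert q I)
  interpret product_sigma_finite "\<lambda>_. N" by standard
  interpret PI: prob_space "PiM I (\<lambda>_. N)" by (rule prob_space_PiM) (rule prob_space_axioms)
  define Z where "Z \<omega> = (\<Sum>i\<in>I. c i * e (\<omega> i))" for \<omega>
  define V where "V = (\<Sum>i\<in>I. (norm (c i))\<^sup>2)"
  have "(\<integral>\<omega>. norm (\<Sum>i\<in>insert q I. c i * e (\<omega> i)) ^ (2 * r) \<partial>PiM (insert q I) (\<lambda>_. N)) =
      (\<integral>\<omega>. (\<integral>b. norm (\<Sum>i\<in>insert q I. c i * e (fun_upd \<omega> q b i)) ^ (2 * r) \<partial>N) \<partial>PiM I (\<lambda>_. N))"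
    by (rule product_integral_insert [OF insert(1,2) integrable_norm_sum])
  also have "\<dots> = (\<integral>\<omega>. (\<Sum>k\<le>r. (real (r choose k))\<^sup>2 * norm (c q) ^ (2 * k) * norm (Z \<omega>) ^ (2 * (r - k))) \<partial>PiM I (\<lambda>_. N))"
  proof (rule arg_cong [where f = "integral\<^sup>L (PiM I (\<lambda>_. N))"], rule ext)
    fix \<omega>
    have "(\<Sum>i\<in>I. c i * e (fun_upd \<omega> q b i)) = Z \<omega>" for b
      unfolding Z_def using insert(2) by (intro sum.cong) auto
    then have "norm (\<Sum>i\<in>insert q I. c i * e (fun_upd \<omega> q b i)) ^ (2 * r) =
        (norm ((c q * e b + Z \<omega>) ^ r))\<^sup>2" for b
      using insert(1,2) by (simp add: norm_power power_mult mult.commute)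
    also have "(norm ((c q * e b + Z \<omega>) ^ r))\<^sup>2 =
        (norm (\<Sum>k\<le>r. (of_nat (r choose k) * c q ^ k * Z \<omega> ^ (r - k)) * e b ^ k))\<^sup>2" for b
      by (simp add: binomial_ring power_mult_distrib mult_ac)
    finally show "(\<integral>b. norm (\<Sum>i\<in>insert q I. c i * e (fun_upd \<omega> q b i)) ^ (2 * r) \<partial>N) =
        (\<Sum>k\<le>r. (real (r choose k))\<^sup>2 * norm (c q) ^ (2 * k) * norm (Z \<omega>) ^ (2 * (r - k)))"
      by (simp only: integral_norm_polynomial)
         (simp add: norm_mult norm_power power_mult_distrib flip: power_mult, simp add: mult.commute)
  qed
  also have "\<dots> = (\<Sum>k\<le>r. (real (r choose k))\<^sup>2 * norm (c q) ^ (2 * k) *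
      (\<integral>\<omega>. norm (Z \<omega>) ^ (2 * (r - k)) \<partial>PiM I (\<lambda>_. N)))"
    unfolding Z_def by (simp add: Bochner_Integration.integral_sum integrable_norm_sum)
  also have "\<dots> \<le> (\<Sum>k\<le>r. fact r * (real (r choose k) * (norm (c q))\<^sup>2 ^ k * V ^ (r - k)))"
  proof (rule sum_mono)
    fix k assume "k \<in> {..r}"
    then have "fact k * fact (r - k) * real (r choose k) = fact r"
      by (metis atMost_iff binomial_fact_lemma of_nat_fact of_nat_mult)
    moreover have "1 * (fact (r - k) * real (r choose k)) \<le> fact k * (fact (r - k) * real (r choose k))"
      by (intro mult_right_mono) auto
    ultimately have le: "real (r choose k) * fact (r - k) \<le> fact r" by (simp add: mult_ac)
    have "(real (r choose k))\<^sup>2 * norm (c q) ^ (2 * k) * (\<integral>\<omega>. norm (Z \<omega>) ^ (2 * (r - k)) \<partial>PiM I (\<lambda>_. N))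
        \<le> (real (r choose k))\<^sup>2 * norm (c q) ^ (2 * k) * (fact (r - k) * V ^ (r - k))"
      unfolding Z_def V_def by (intro mult_left_mono insert.IH) auto
    also have "\<dots> = (real (r choose k) * fact (r - k)) * (real (r choose k) * (norm (c q))\<^sup>2 ^ k * V ^ (r - k))"
      by (simp add: power2_eq_square power_mult power_mult_distrib mult_ac)
    also have "\<dots> \<le> fact r * (real (r choose k) * (norm (c q))\<^sup>2 ^ k * V ^ (r - k))"
      by (intro mult_right_mono le mult_nonneg_nonneg) (auto simp: V_def sum_nonneg)
    finally show "(real (r choose k))\<^sup>2 * norm (c q) ^ (2 * k) * (\<integral>\<omega>. norm (Z \<omega>) ^ (2 * (r - k)) \<partial>PiM I (\<lambda>_. N))
        \<le> fact r * (real (r choose k) * (norm (c q))\<^sup>2 ^ k * V ^ (r - k))" .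
  qed
  also have "\<dots> = fact r * ((norm (c q))\<^sup>2 + V) ^ r"
    by (simp add: binomial_ring sum_distrib_left)
  finally show ?case using insert(1,2) by (simp add: V_def)
qed

text \<open>Markov's inequality for exp (|Z|^2 / (2V)): by \<open>moment_bound\<close> the r-th term
  of its series has expectation at most 2^(-r), in total at most 2. Truncating the series keeps all
  integrals over finite sums; the limit is taken afterwards, in a numerical inequality. A positive
  upper bound \<open>V\<close> in place of the sum admits vanishing coefficients.\<close>

lemma tail_bound:
  assumes fin: "finite I" and V: "(\<Sum>i\<in>I. (norm (c i))\<^sup>2) \<le> V" "0 < V" and t: "0 \<le> t"
  shows "measure (PiM I (\<lambda>_. N)) {\<omega> \<in> space (PiM I (\<lambda>_. N)). t \<le> norm (\<Sum>i\<in>I. c i * e (\<omega> i))}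
    \<le> 2 * exp (- t\<^sup>2 / (2 * V))"
proof -
  interpret P: prob_space "PiM I (\<lambda>_. N)" by (rule prob_space_PiM) (rule prob_space_axioms)
  define Z where "Z \<omega> = norm (\<Sum>i\<in>I. c i * e (\<omega> i))" for \<omega>
  define W where "W n \<omega> = (\<Sum>r<n. (1 / (fact r * (2 * V) ^ r)) * Z \<omega> ^ (2 * r))" for n \<omega>
  define A where "A = {\<omega> \<in> space (PiM I (\<lambda>_. N)). t \<le> Z \<omega>}"
  define y where "y = t\<^sup>2 / (2 * V)"
  have int_W: "integrable (PiM I (\<lambda>_. N)) (W n)" for n
    unfolding W_def Z_def by (intro Bochner_Integration.integrable_sum integrable_mult_right integrable_norm_sum)
  have A: "A \<in> sets (PiM I (\<lambda>_. N))" unfolding A_def Z_def by measurable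
  have "measure (PiM I (\<lambda>_. N)) A * (\<Sum>r<n. y ^ r /\<^sub>R fact r) \<le> 2" for n
  proof -
    have "measure (PiM I (\<lambda>_. N)) A * (\<Sum>r<n. y ^ r /\<^sub>R fact r) =
        (\<integral>\<omega>. indicator A \<omega> * (\<Sum>r<n. y ^ r /\<^sub>R fact r) \<partial>PiM I (\<lambda>_. N))"
      using A by simp
    also have "\<dots> \<le> (\<integral>\<omega>. W n \<omega> \<partial>PiM I (\<lambda>_. N))"
    proof (rule integral_mono')
      fix \<omega>
      show W0: "0 \<le> W n \<omega>" using V by (simp add: W_def Z_def sum_nonneg)
      have "(\<Sum>r<n. y ^ r /\<^sub>R fact r) \<le> W n \<omega>" if "t \<le> Z \<omega>"
        unfolding W_def
      proof (rule sum_mono)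
        fix r
        have "y ^ r /\<^sub>R fact r = (1 / (fact r * (2 * V) ^ r)) * t ^ (2 * r)"
          unfolding y_def power_divide power_mult [of t]
          by (simp only: divide_inverse inverse_mult_distrib mult_1_left mult_ac real_scaleR_def)
        also have "\<dots> \<le> (1 / (fact r * (2 * V) ^ r)) * Z \<omega> ^ (2 * r)"
          using t V that by (intro mult_left_mono power_mono) auto
        finally show "y ^ r /\<^sub>R fact r \<le> (1 / (fact r * (2 * V) ^ r)) * Z \<omega> ^ (2 * r)" .
      qed
      then show "indicator A \<omega> * (\<Sum>r<n. y ^ r /\<^sub>R fact r) \<le> W n \<omega>"
        using W0 by (auto simp: indicator_def A_def)
    qed (rule int_W)
    also have "\<dots> = (\<Sum>r<n. (1 / (fact r * (2 * V) ^ r)) * (\<integral>\<omega>. Z \<omega> ^ (2 * r) \<partial>PiM I (\<lambda>_. N)))"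
      unfolding W_def Z_def by (simp add: Bochner_Integration.integral_sum integrable_norm_sum)
    also have "\<dots> \<le> (\<Sum>r<n. (1 / (fact r * (2 * V) ^ r)) * (fact r * V ^ r))"
    proof (intro sum_mono mult_left_mono)
      fix r
      have "(\<integral>\<omega>. Z \<omega> ^ (2 * r) \<partial>PiM I (\<lambda>_. N)) \<le> fact r * (\<Sum>i\<in>I. (norm (c i))\<^sup>2) ^ r"
        unfolding Z_def by (rule moment_bound [OF fin])
      also have "\<dots> \<le> fact r * V ^ r"
        using V by (intro mult_left_mono power_mono) (auto intro: sum_nonneg)
      finally show "(\<integral>\<omega>. Z \<omega> ^ (2 * r) \<partial>PiM I (\<lambda>_. N)) \<le> fact r * V ^ r" .
    qed (use V in auto)
    also have "\<dots> = (\<Sum>r<n. (1 / 2) ^ r)"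
      using V by (intro sum.cong) (auto simp: power_mult_distrib power_divide)
    also have "\<dots> = 2 - 2 * (1 / 2) ^ n" by (induction n) simp_all
    also have "\<dots> \<le> 2" by simp
    finally show ?thesis .
  qed
  moreover have "(\<lambda>n. measure (PiM I (\<lambda>_. N)) A * (\<Sum>r<n. y ^ r /\<^sub>R fact r)) \<longlonglongrightarrow> measure (PiM I (\<lambda>_. N)) A * exp y"
    using exp_converges [of y] by (intro tendsto_mult_left) (simp add: sums_def)
  ultimately have "measure (PiM I (\<lambda>_. N)) A * exp y \<le> 2"
    by (intro LIMSEQ_le_const2) auto
  then have "measure (PiM I (\<lambda>_. N)) A \<le> 2 / exp y" by (simp add: pos_le_divide_eq)
  also have "2 / exp y = 2 * exp (- t\<^sup>2 / (2 * V))"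
    unfolding y_def minus_divide_left [symmetric] exp_minus divide_inverse [of 2] ..
  finally show ?thesis unfolding A_def Z_def .
qed

end

section \<open>Dual certificates for Basis Pursuit\<close>

lemma BP_recovers_iff:
  "BP_recovers M X \<longleftrightarrow> (\<forall>h. M *v h = 0 \<and> h \<noteq> 0 \<longrightarrow> l1_norm X < l1_norm (X + h))"
  (is "_ \<longleftrightarrow> ?R")
proof
  assume L: "BP_recovers M X"
  then have sol: "Z \<in> BP_solutions M (M *v X) \<longleftrightarrow> Z = X" for Z
    by (simp add: BP_recovers_def)
  show ?R
  proof (intro allI impI)
    fix h assume h: "M *v h = 0 \<and> h \<noteq> 0"
    show "l1_norm X < l1_norm (X + h)"
    proof (rule ccontr)
      assume "\<not> ?thesis"
      moreover have "\<And>y. M *v y = M *v X \<Longrightarrow> l1_norm X \<le> l1_norm y"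
        using sol[of X] by (auto simp: BP_solutions_def is_arg_min_def not_less)
      ultimately have "X + h \<in> BP_solutions M (M *v X)"
        using h by (auto simp: BP_solutions_def is_arg_min_def not_less matrix_vector_right_distrib intro: order_trans)
      then show False using sol h by simp
    qed
  qed
next
  assume R: ?R
  have "l1_norm X < l1_norm Z" if "M *v Z = M *v X" "Z \<noteq> X" for Z
    using R[rule_format, of "Z - X"] that by (simp add: matrix_vector_mult_diff_distrib)
  then show "BP_recovers M X"
    unfolding BP_recovers_def BP_solutions_def is_arg_min_def by (force simp: not_less)
qed

text \<open>Pairing with the sign pattern \<open>\<sigma>\<close> reproduces the l1 norm of
  \<open>X\<close> and, for X + h, stays below the l1 mass on \<open>S\<close>. The discrepancy is
  the pairing of \<open>\<sigma>\<close> with \<open>h\<close>, which the mass of \<open>h\<close>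
  off \<open>S\<close> outweighs.\<close>

lemma BP_recovers_null_space:
  fixes M :: "complex^'m^'n"
  assumes supp: "\<And>j. X $ j \<noteq> 0 \<Longrightarrow> j \<in> S"
    and sgn: "\<And>j. j \<in> S \<Longrightarrow> X $ j = of_real (norm (X $ j)) * \<sigma> j" "\<And>j. norm (\<sigma> j) = 1"
    and null: "\<And>h. M *v h = 0 \<Longrightarrow> h \<noteq> 0 \<Longrightarrow>
      norm (\<Sum>j\<in>S. cnj (\<sigma> j) * h $ j) < (\<Sum>j\<in>-S. norm (h $ j))"
  shows "BP_recovers M X"
  unfolding BP_recovers_iff
proof (intro allI impI, elim conjE)
  fix h assume h: "M *v h = 0" "h \<noteq> 0"
  have split: "l1_norm Z = (\<Sum>j\<in>S. norm (Z $ j)) + (\<Sum>j\<in>-S. norm (Z $ j))" for Z :: "complex^'m"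
    unfolding l1_norm_def by (subst sum.union_disjoint [symmetric]) (auto simp: Compl_eq_Diff_UNIV)
  have "cnj (\<sigma> j) * X $ j = of_real (norm (X $ j))" if "j \<in> S" for j
  proof -
    have "cnj (\<sigma> j) * \<sigma> j = 1" using complex_norm_square[of "\<sigma> j"] sgn(2)[of j] by (simp add: mult.commute)
    then show ?thesis using sgn(1)[OF that] by (metis mult.left_commute mult.right_neutral)
  qed
  then have "of_real (\<Sum>j\<in>S. norm (X $ j)) = (\<Sum>j\<in>S. cnj (\<sigma> j) * X $ j)" by simp
  also have "\<dots> = (\<Sum>j\<in>S. cnj (\<sigma> j) * (X + h) $ j) - (\<Sum>j\<in>S. cnj (\<sigma> j) * h $ j)"
    by (simp add: sum_subtractf [symmetric] algebra_simps)
  finally have "norm (complex_of_real (\<Sum>j\<in>S. norm (X $ j))) \<le>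
      norm (\<Sum>j\<in>S. cnj (\<sigma> j) * (X + h) $ j) + norm (\<Sum>j\<in>S. cnj (\<sigma> j) * h $ j)"
    by (metis norm_triangle_ineq4)
  also have "norm (\<Sum>j\<in>S. cnj (\<sigma> j) * (X + h) $ j) \<le> (\<Sum>j\<in>S. norm ((X + h) $ j))"
    by (rule sum_norm_le) (simp add: norm_mult sgn(2))
  also have "norm (complex_of_real (\<Sum>j\<in>S. norm (X $ j))) = l1_norm X"
  proof -
    have "(\<Sum>j\<in>-S. norm (X $ j)) = 0" using supp by (intro sum.neutral) (metis ComplD norm_zero)
    then show ?thesis by (simp only: split norm_of_real) (simp add: sum_nonneg)
  qed
  finally have "l1_norm X < (\<Sum>j\<in>S. norm ((X + h) $ j)) + (\<Sum>j\<in>-S. norm (h $ j))"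
    using null[OF h] by simp
  also have "(\<Sum>j\<in>-S. norm (h $ j)) = (\<Sum>j\<in>-S. norm ((X + h) $ j))"
  proof (intro sum.cong refl)
    fix j assume "j \<in> -S"
    then have "X $ j = 0" using supp by blast
    then show "norm (h $ j) = norm ((X + h) $ j)" by simp
  qed
  finally show "l1_norm X < l1_norm (X + h)" by (simp only: split)
qed

lemma cnj_cdot: "cnj (cdot S x y) = cdot S y x"
  by (rule cdot_commute [symmetric])

lemma frame_zero:
  assumes fin: "finite S" and frame: "\<And>x. \<gamma> * (\<Sum>i\<in>S. (norm (x i))\<^sup>2) \<le> (\<Sum>q\<in>I. (norm (cdot S (\<phi> q) x))\<^sup>2)"
    and \<gamma>: "0 < \<gamma>" and zero: "\<And>k. k \<in> S \<Longrightarrow> (\<Sum>q\<in>I. \<phi> q k * cdot S (\<phi> q) x) = 0" and i: "i \<in> S"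
  shows "x i = 0"
proof -
  have "of_real (\<Sum>q\<in>I. (norm (cdot S (\<phi> q) x))\<^sup>2) = (\<Sum>q\<in>I. cnj (cdot S (\<phi> q) x) * cdot S (\<phi> q) x)"
    by (simp add: complex_norm_square mult.commute del: of_real_power)
  also have "\<dots> = (\<Sum>k\<in>S. cnj (x k) * (\<Sum>q\<in>I. \<phi> q k * cdot S (\<phi> q) x))"
    unfolding sum_distrib_left
    by (subst sum.swap) (simp add: cnj_cdot cdot_def [of S x] sum_distrib_left mult_ac)
  also have "\<dots> = 0" by (simp add: zero)
  finally have "\<gamma> * (\<Sum>i\<in>S. (norm (x i))\<^sup>2) \<le> 0" using frame[of x] by (simp only: of_real_eq_0_iff)
  then have "(\<Sum>i\<in>S. (norm (x i))\<^sup>2) = 0"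
    using \<gamma> by (intro antisym sum_nonneg) (auto simp: mult_le_0_iff)
  then show ?thesis using i fin by (simp add: sum_nonneg_eq_0_iff)
qed

text \<open>The Gram operator on \<open>S\<close> is extended by the identity off \<open>S\<close>;
  as an endomorphism of a finite-dimensional space it is onto once it is injective. The size bound
  comes from gamma |c|^2 \<le> <c, G c> = <c, b> \<le> |c| |b|.\<close>

lemma frame_solve:
  fixes \<phi> :: "'q \<Rightarrow> 'm::finite \<Rightarrow> complex"
  assumes frame: "\<And>x. \<gamma> * (\<Sum>i\<in>S. (norm (x i))\<^sup>2) \<le> (\<Sum>q\<in>I. (norm (cdot S (\<phi> q) x))\<^sup>2)"
    and \<gamma>: "0 < \<gamma>"
  shows "\<exists>c. (\<forall>k\<in>S. (\<Sum>q\<in>I. \<phi> q k * cdot S (\<phi> q) c) = b k) \<and>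
    \<gamma>\<^sup>2 * (\<Sum>k\<in>S. (norm (c k))\<^sup>2) \<le> (\<Sum>k\<in>S. (norm (b k))\<^sup>2)"
proof -
  define f where "f x = (\<chi> k. if k \<in> S then \<Sum>q\<in>I. \<phi> q k * cdot S (\<phi> q) (($) x) else x $ k)" for x :: "complex^'m"
  have "linear f"
  proof (rule linearI)
    show "f (x + y) = f x + f y" for x y
      by (simp add: f_def vec_eq_iff cdot_def sum.distrib algebra_simps)
    show "f (c *\<^sub>R x) = c *\<^sub>R f x" for c x
      by (simp add: f_def vec_eq_iff cdot_def flip: scaleR_sum_right)
  qed
  moreover have "inj f"
    unfolding linear_injective_0 [OF \<open>linear f\<close>]
  proof (intro allI impI)
    fix x assume "f x = 0"
    then have *: "(if k \<in> S then \<Sum>q\<in>I. \<phi> q k * cdot S (\<phi> q) (($) x) else x $ k) = 0" for k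
      by (simp add: f_def vec_eq_iff)
    then have "x $ k = 0" if "k \<in> S" for k
      using frame_zero [OF _ frame \<gamma> _ that, where x = "($) x"] * by (metis finite)
    then show "x = 0" using * by (metis vec_eq_iff zero_index)
  qed
  ultimately have "surj f" by (rule linear_injective_imp_surjective) (rule refl)
  then obtain y where y: "f y = (\<chi> k. b k)" by (metis surjD)
  define c where "c = ($) y"
  have c: "(\<Sum>q\<in>I. \<phi> q k * cdot S (\<phi> q) c) = b k" if "k \<in> S" for k
    using arg_cong [OF y, of "\<lambda>v. v $ k"] that by (simp add: f_def c_def)
  define C where "C = (\<Sum>k\<in>S. (norm (c k))\<^sup>2)"
  define B where "B = (\<Sum>k\<in>S. (norm (b k))\<^sup>2)"
  have C0: "0 \<le> C" by (simp add: C_def sum_nonneg)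
  have "of_real (\<Sum>q\<in>I. (norm (cdot S (\<phi> q) c))\<^sup>2) = (\<Sum>q\<in>I. cnj (cdot S (\<phi> q) c) * cdot S (\<phi> q) c)"
    by (simp add: complex_norm_square mult.commute del: of_real_power)
  also have "\<dots> = (\<Sum>k\<in>S. cnj (c k) * (\<Sum>q\<in>I. \<phi> q k * cdot S (\<phi> q) c))"
    unfolding sum_distrib_left
    by (subst sum.swap) (simp add: cnj_cdot cdot_def [of S c] sum_distrib_left mult_ac)
  also have "\<dots> = cdot S c b" by (simp add: c cdot_def [of S c])
  finally have "norm (cdot S c b) = \<bar>\<Sum>q\<in>I. (norm (cdot S (\<phi> q) c))\<^sup>2\<bar>"
    using norm_of_real [where 'a = complex] by metis
  then have "\<gamma> * C \<le> norm (cdot S c b)"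
    using frame[of c] unfolding C_def by linarith
  then have "(\<gamma> * C)\<^sup>2 \<le> (norm (cdot S c b))\<^sup>2"
    using \<gamma> C0 by (intro power_mono) auto
  also have "\<dots> \<le> C * B" unfolding C_def B_def by (rule cdot_cauchy_schwarz)
  finally have "C * (\<gamma>\<^sup>2 * C) \<le> C * B" by (simp add: power2_eq_square mult_ac)
  then have "\<gamma>\<^sup>2 * C \<le> B"
    using C0 by (cases "C = 0") (auto simp: B_def sum_nonneg)
  then show ?thesis using c by (auto simp: C_def B_def intro!: exI [of _ c])
qed

text \<open>\<open>c j\<close> holds the least-squares coefficients of column \<open>j\<close> in
  the columns of \<open>S\<close>, and its hypothesis is the normal equation. On the kernel of
  \<open>M\<close> the entries in \<open>S\<close> are then determined by those off
  \<open>S\<close>, which turns the null-space condition into \<open>dual\<close>. Rows are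
  conjugated because \<open>cdot\<close> conjugates its first argument.\<close>

lemma BP_recovers_dual:
  fixes M :: "complex^'m^'n" and S :: "'m set"
  assumes supp: "\<And>j. X $ j \<noteq> 0 \<Longrightarrow> j \<in> S"
    and sgn: "\<And>j. j \<in> S \<Longrightarrow> X $ j = of_real (norm (X $ j)) * \<sigma> j" "\<And>j. norm (\<sigma> j) = 1"
    and frame: "\<And>x. \<gamma> * (\<Sum>i\<in>S. (norm (x i))\<^sup>2) \<le> (\<Sum>q\<in>UNIV. (norm (cdot S (\<lambda>k. cnj (M $ q $ k)) x))\<^sup>2)"
    and \<gamma>: "0 < \<gamma>"
    and c: "\<And>j k. j \<notin> S \<Longrightarrow> k \<in> S \<Longrightarrow>
      (\<Sum>q\<in>UNIV. cnj (M $ q $ k) * cdot S (\<lambda>k. cnj (M $ q $ k)) (c j)) = (\<Sum>q\<in>UNIV. cnj (M $ q $ k) * M $ q $ j)"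
    and dual: "\<And>j. j \<notin> S \<Longrightarrow> norm (\<Sum>k\<in>S. c j k * cnj (\<sigma> k)) < 1"
  shows "BP_recovers M X"
proof (rule BP_recovers_null_space [OF supp sgn])
  fix h assume h: "M *v h = 0" "h \<noteq> 0"
  have row: "cdot S (\<lambda>k. cnj (M $ q $ k)) (($) h) + (\<Sum>j\<in>-S. M $ q $ j * h $ j) = 0" for q
  proof -
    have "(M *v h) $ q = (\<Sum>j\<in>S. M $ q $ j * h $ j) + (\<Sum>j\<in>-S. M $ q $ j * h $ j)"
      unfolding matrix_vector_mult_def
      by (simp, subst sum.union_disjoint [symmetric]) (auto simp: Compl_eq_Diff_UNIV)
    then show ?thesis using h by (simp add: cdot_def)
  qed
  \<comment> \<open>Since \<open>h\<close> lies in the kernel, \<open>x\<close> solves the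
    homogeneous normal equations, and the frame bound forces it to vanish on
    \<open>S\<close>.\<close>
  define x where "x k = h $ k + (\<Sum>j\<in>-S. h $ j * c j k)" for k
  have "cdot S f x = cdot S f (($) h) + (\<Sum>j\<in>-S. h $ j * cdot S f (c j))" for f
  proof -
    have "cdot S f (\<lambda>k. \<Sum>j\<in>-S. h $ j * c j k) = (\<Sum>j\<in>-S. h $ j * cdot S f (c j))"
      unfolding cdot_def sum_distrib_left by (subst sum.swap) (simp add: mult_ac)
    then show ?thesis by (simp add: x_def [abs_def] cdot_add_right)
  qed
  then have "(\<Sum>q\<in>UNIV. cnj (M $ q $ k) * cdot S (\<lambda>k. cnj (M $ q $ k)) x) = 0" if "k \<in> S" for k
  proof -
    have "(\<Sum>q\<in>UNIV. cnj (M $ q $ k) * cdot S (\<lambda>k. cnj (M $ q $ k)) x) =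
      (\<Sum>q\<in>UNIV. cnj (M $ q $ k) * cdot S (\<lambda>k. cnj (M $ q $ k)) (($) h)) +
      (\<Sum>j\<in>-S. h $ j * (\<Sum>q\<in>UNIV. cnj (M $ q $ k) * cdot S (\<lambda>k. cnj (M $ q $ k)) (c j)))"
      unfolding \<open>\<And>f. cdot S f x = _ f\<close> ring_distribs sum.distrib sum_distrib_left
      by (subst (2) sum.swap) (simp add: mult_ac)
    also have "(\<Sum>j\<in>-S. h $ j * (\<Sum>q\<in>UNIV. cnj (M $ q $ k) * cdot S (\<lambda>k. cnj (M $ q $ k)) (c j)))
        = (\<Sum>j\<in>-S. h $ j * (\<Sum>q\<in>UNIV. cnj (M $ q $ k) * M $ q $ j))"
      using that by (intro sum.cong refl) (simp add: c)
    also have "\<dots> = (\<Sum>q\<in>UNIV. cnj (M $ q $ k) * (\<Sum>j\<in>-S. M $ q $ j * h $ j))"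
      unfolding sum_distrib_left by (subst sum.swap) (simp add: mult_ac)
    also have "(\<Sum>q\<in>UNIV. cnj (M $ q $ k) * cdot S (\<lambda>k. cnj (M $ q $ k)) (($) h)) + \<dots> =
        (\<Sum>q\<in>UNIV. cnj (M $ q $ k) * (cdot S (\<lambda>k. cnj (M $ q $ k)) (($) h) + (\<Sum>j\<in>-S. M $ q $ j * h $ j)))"
      by (simp only: ring_distribs sum.distrib)
    finally show ?thesis by (simp add: row)
  qed
  from frame_zero [OF _ frame \<gamma> this] have x: "x k = 0" if "k \<in> S" for k
    using that by simp
  have hk: "h $ k = - (\<Sum>j\<in>-S. h $ j * c j k)" if "k \<in> S" for k
    using x [OF that] by (simp only: x_def eq_neg_iff_add_eq_0)
  \<comment> \<open>By \<open>hk\<close>, a kernel vector that vanishes off \<open>S\<close> is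
    zero. The entry at \<open>l\<close> makes the final inequality strict.\<close>
  obtain l where l: "l \<in> -S" "h $ l \<noteq> 0"
  proof -
    have "\<exists>l\<in>-S. h $ l \<noteq> 0"
    proof (rule ccontr)
      assume "\<not> ?thesis"
      then have "h $ k = 0" for k using hk[of k] by (cases "k \<in> S") auto
      then show False using h by (simp add: vec_eq_iff)
    qed
    then show ?thesis using that by blast
  qed
  have "(\<Sum>j\<in>S. cnj (\<sigma> j) * h $ j) = (\<Sum>k\<in>S. cnj (\<sigma> k) * - (\<Sum>j\<in>-S. h $ j * c j k))"
    by (simp add: hk)
  also have "\<dots> = - (\<Sum>j\<in>-S. h $ j * (\<Sum>k\<in>S. c j k * cnj (\<sigma> k)))"
    unfolding mult_minus_right sum_negf sum_distrib_left
    by (subst sum.swap) (simp add: mult_ac)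
  finally have "norm (\<Sum>j\<in>S. cnj (\<sigma> j) * h $ j) \<le> (\<Sum>j\<in>-S. norm (h $ j) * norm (\<Sum>k\<in>S. c j k * cnj (\<sigma> k)))"
    by (simp add: sum_norm_le norm_mult)
  also have "\<dots> < (\<Sum>j\<in>-S. norm (h $ j))"
  proof (rule sum_strict_mono_ex1)
    show "\<forall>j\<in>-S. norm (h $ j) * norm (\<Sum>k\<in>S. c j k * cnj (\<sigma> k)) \<le> norm (h $ j)"
      using dual by (auto intro!: mult_left_le dest: less_imp_le)
    show "\<exists>j\<in>-S. norm (h $ j) * norm (\<Sum>k\<in>S. c j k * cnj (\<sigma> k)) < norm (h $ j)"
      using l dual[of l] by (auto intro!: bexI [of _ l])
  qed simp
  finally show "norm (\<Sum>j\<in>S. cnj (\<sigma> j) * h $ j) < (\<Sum>j\<in>-S. norm (h $ j))" .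
qed

section \<open>Measurability of the recovery event\<close>

lemma closed_BP_failure:
  assumes "compact C"
  shows "closed {p :: (complex^'m^'n) \<times> (complex^'m). \<exists>h. h \<in> C \<and>
    fst p *v h = 0 \<and> l1_norm (snd p + h) \<le> l1_norm (snd p)}"
proof -
  have "closed {x :: (complex^'m) \<times> (complex^'m^'n) \<times> (complex^'m).
      fst (snd x) *v fst x = 0 \<and> l1_norm (snd (snd x) + fst x) \<le> l1_norm (snd (snd x))}"
    unfolding matrix_vector_mult_def l1_norm_def
    by (intro closed_Collect_conj closed_Collect_eq closed_Collect_le continuous_intros)
  from closed_compact_projection [OF assms this] show ?thesis by simp
qed

text \<open>Failure means that some nonzero kernel vector does not increase the l1 norm. Nonzero
  vectors are exhausted by the compact shells \<open>C k\<close>, and projecting along a compact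
  factor preserves closedness, so failure is a countable union of closed sets.\<close>

lemma borel_BP_recovers:
  "{p :: (complex^'m^'n) \<times> (complex^'m). BP_recovers (fst p) (snd p)} \<in> sets borel"
proof -
  define C where "C k = cball (0 :: complex^'m) (real k) - ball 0 (1 / real (Suc k))" for k
  have "\<exists>k. h \<in> C k" if "h \<noteq> 0" for h
  proof -
    have "0 < norm h" using that by simp
    then obtain k1 where "1 / real (Suc k1) < norm h" by (rule nat_approx_posE)
    moreover obtain k2 where "norm h < real k2" using reals_Archimedean2 by blast
    moreover have "1 / real (Suc (max k1 k2)) \<le> 1 / real (Suc k1)" by (intro divide_left_mono) auto
    ultimately have "h \<in> C (max k1 k2)" by (auto simp: C_def)
    then show ?thesis by blast
  qed
  moreover have "0 \<notin> C k" for k by (simp add: C_def)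
  ultimately have "{p :: (complex^'m^'n) \<times> (complex^'m). BP_recovers (fst p) (snd p)} =
      - (\<Union>k. {p. \<exists>h. h \<in> C k \<and> fst p *v h = 0 \<and> l1_norm (snd p + h) \<le> l1_norm (snd p)})"
    unfolding BP_recovers_iff by (auto simp: not_less[symmetric])
  moreover have "compact (C k)" for k
    unfolding C_def by (intro compact_diff compact_cball open_ball)
  ultimately show ?thesis
    by (simp add: closed_BP_failure borel_closed sets.countable_UN borel_comp)
qed

lemma borel_measurable_vecI:
  fixes f :: "'x \<Rightarrow> 'e::euclidean_space^'n"
  assumes "\<And>i. (\<lambda>x. f x $ i) \<in> borel_measurable M"
  shows "f \<in> borel_measurable M"
  unfolding borel_measurable_euclidean_space [of f]
  by (auto simp: Basis_vec_def inner_axis intro!: borel_measurable_inner assms)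

section \<open>Sampling characters on the lattice\<close>

lemma integral_interval_character:
  fixes k :: int
  assumes "0 < A" "k \<noteq> 0"
  shows "(\<integral>x. indicator {0..A} x *\<^sub>R cis (2 * pi * of_int k * x / A) \<partial>lborel) = 0"
proof -
  define w where "w = 2 * pi * of_int k / A"
  have w: "w \<noteq> 0" using assms by (simp add: w_def)
  have "((\<lambda>x. cis (w * x) / (\<i> * of_real w)) has_vector_derivative cis (w * x)) (at x within {0..A})" for x
  proof -
    have "((\<lambda>x. exp (\<i> * of_real w * of_real x) / (\<i> * of_real w)) has_vector_derivative exp (\<i> * of_real w * of_real x)) (at x within {0..A})"
      using w by (auto intro!: derivative_eq_intros has_vector_derivative_real_field simp: field_simps)
    then show ?thesis by (simp add: cis_conv_exp mult_ac)
  qed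
  moreover have "continuous_on {0..A} (\<lambda>x. cis (w * x))"
    by (intro continuous_intros)
  ultimately have "(\<integral>x. indicator {0..A} x *\<^sub>R cis (w * x) \<partial>lborel) =
      cis (w * A) / (\<i> * of_real w) - cis (w * 0) / (\<i> * of_real w)"
    using assms by (intro integral_FTC_Icc) auto
  also have "w * A = 2 * pi * of_int k" using assms by (simp add: w_def)
  also have "cis (2 * pi * of_int k) = 1" by (intro cis_multiple_2pi) simp
  finally show ?thesis by (simp add: w_def)
qed

lemma emeasure_lborel_square:
  assumes "0 \<le> A"
  shows "emeasure lborel ({0..A} \<times> {0..A :: real}) = ennreal (A\<^sup>2)"
  using assms by (simp add: lborel_prod [symmetric] lborel.emeasure_pair_measure_Times
      power2_eq_square ennreal_mult)

lemma prob_space_uniform_square: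
  assumes "0 < A"
  shows "prob_space (uniform_measure lborel ({0..A} \<times> {0..A :: real}))"
  using assms by (intro prob_space_uniform_measure) (simp_all add: emeasure_lborel_square)

lemma integral_square_character:
  fixes k1 k2 :: int
  assumes A: "0 < A" and k: "k1 \<noteq> 0 \<or> k2 \<noteq> 0"
  shows "(\<integral>b. cis (\<theta> + 2 * pi * of_int k1 * fst b / A + 2 * pi * of_int k2 * snd b / A)
    \<partial>uniform_measure lborel ({0..A} \<times> {0..A})) = 0"
proof -
  define g where "g k x = indicator {0..A} x *\<^sub>R cis (2 * pi * of_int k * x / A)" for k x
  define f where "f = (\<lambda>b. cis (\<theta> + 2 * pi * of_int k1 * fst b / A + 2 * pi * of_int k2 * snd b / A))"
  have meas: "f \<in> borel_measurable lborel"
    unfolding f_def by (simp, intro borel_measurable_continuous_onI continuous_intros) (use A in auto)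
  have dens: "uniform_measure lborel ({0..A} \<times> {0..A}) =
      density lborel (\<lambda>b. ennreal (indicator ({0..A} \<times> {0..A}) b / A\<^sup>2))"
    unfolding uniform_measure_def emeasure_lborel_square [OF less_imp_le [OF A]]
    using A by (intro arg_cong [where f = "density lborel"] ext)
      (auto simp: divide_ennreal [symmetric] split: split_indicator)
  have "(\<integral>b. f b \<partial>uniform_measure lborel ({0..A} \<times> {0..A})) =
      (\<integral>b. (indicator ({0..A} \<times> {0..A}) b / A\<^sup>2) *\<^sub>R f b \<partial>lborel)"
    unfolding dens by (intro integral_density meas) (auto intro!: borel_measurable_divide borel_measurable_indicator borel_closed closed_Times)
  also have "\<dots> = (\<integral>b. (case b of (x, y) \<Rightarrow> of_real (1 / A\<^sup>2) * cis \<theta> * g k1 x * g k2 y) \<partial>(lborel \<Otimes>\<^sub>M lborel))"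
    unfolding lborel_prod
    by (intro Bochner_Integration.integral_cong refl)
       (auto simp: f_def g_def cis_mult indicator_def scaleR_conv_of_real simp flip: cis_mult)
  also have "\<dots> = 0"
  \<comment> \<open>The Bochner integral of a function that is not integrable is 0 by convention, so
    both cases give 0 and integrability need not be settled.\<close>
  proof (cases "integrable (lborel \<Otimes>\<^sub>M lborel) (\<lambda>b. case b of (x, y) \<Rightarrow> of_real (1 / A\<^sup>2) * cis \<theta> * g k1 x * g k2 y)")
    case True
    from lborel_pair.integral_fst [OF this]
    have "(\<integral>b. (case b of (x, y) \<Rightarrow> of_real (1 / A\<^sup>2) * cis \<theta> * g k1 x * g k2 y) \<partial>(lborel \<Otimes>\<^sub>M lborel)) =
        (\<integral>x. (\<integral>y. of_real (1 / A\<^sup>2) * cis \<theta> * g k1 x * g k2 y \<partial>lborel) \<partial>lborel)" by simp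
    also have "\<dots> = of_real (1 / A\<^sup>2) * cis \<theta> * (\<integral>x. g k1 x \<partial>lborel) * (\<integral>y. g k2 y \<partial>lborel)"
      by (simp only: integral_mult_right_zero integral_mult_left_zero)
    also have "\<dots> = 0"
      using k integral_interval_character [OF A] unfolding g_def by auto
    finally show ?thesis .
  qed (rule not_integrable_integral_eq)
  finally show ?thesis unfolding f_def .
qed

text \<open>The matrix entry before normalization, with \<open>c\<close> standing for
  \<open>\<omega> / (2 * z0)\<close>. In this argument order, \<open>green c r b\<close> is the row
  of a sensor at \<open>b\<close>.\<close>

definition green :: "real \<Rightarrow> ('m \<Rightarrow> real \<times> real) \<Rightarrow> real \<times> real \<Rightarrow> 'm \<Rightarrow> complex" where
  "green c r b j = cis (c * ((fst (r j) - fst b)\<^sup>2 + (snd (r j) - snd b)\<^sup>2))"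

lemma norm_green [simp]: "norm (green c r b j) = 1"
  by (simp add: green_def)

lemma measurable_green [measurable]: "(\<lambda>b. green c r b j) \<in> borel_measurable borel"
  unfolding green_def by (intro borel_measurable_continuous_onI continuous_intros)

lemma sensing_matrix_green:
  "sensing_matrix \<omega> z0 r (a :: 'n::finite \<Rightarrow> real \<times> real) $ q $ j =
    of_real (1 / sqrt (real CARD('n))) * green (\<omega> / (2 * z0)) r (a q) j"
  by (simp add: sensing_matrix_def green_def cis_conv_exp)

text \<open>The squared sensor coordinates cancel in the product, so its phase is affine in the
  sensor position; \<open>\<theta>\<close> collects the constant part. Lattice differences are
  integer multiples of \<open>l\<close>, and hypothesis \<open>c\<close> encodes 1/\<rho> = N, so
  both frequencies are integer multiples of 2 pi / A and not both are zero.\<close>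

lemma integral_green_power:
  assumes A: "0 < A" and c: "2 * c * l = 2 * pi * real N / A" and N: "0 < N" and k: "0 < k"
    and lat: "square_lattice L l r" and ij: "i \<noteq> j"
  shows "(\<integral>b. (cnj (green c r b i) * green c r b j) ^ k \<partial>uniform_measure lborel ({0..A} \<times> {0..A})) = 0"
proof -
  obtain x0 y0 where bij: "bij_betw r UNIV {(x0 + real a * l, y0 + real b * l) |a b. a < L \<and> b < L}"
    using lat unfolding square_lattice_def by blast
  have ex: "\<exists>a b. r j = (x0 + real a * l, y0 + real b * l)" for j
    using bij_betwE [OF bij] by blast
  obtain a1 b1 where ri: "r i = (x0 + real a1 * l, y0 + real b1 * l)" using ex by blast
  obtain a2 b2 where rj: "r j = (x0 + real a2 * l, y0 + real b2 * l)" using ex by blast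
  have "r i \<noteq> r j" using bij ij by (auto simp: bij_betw_def inj_on_def)
  then have ne: "int a1 \<noteq> int a2 \<or> int b1 \<noteq> int b2" using ri rj by auto
  define k1 where "k1 = int k * int N * (int a1 - int a2)"
  define k2 where "k2 = int k * int N * (int b1 - int b2)"
  define \<theta> where "\<theta> = real k * (c * ((fst (r j))\<^sup>2 - (fst (r i))\<^sup>2 + (snd (r j))\<^sup>2 - (snd (r i))\<^sup>2))"
  have "(cnj (green c r b i) * green c r b j) ^ k =
      cis (\<theta> + 2 * pi * of_int k1 * fst b / A + 2 * pi * of_int k2 * snd b / A)" for b
  proof -
    have "(cnj (green c r b i) * green c r b j) ^ k =
        cis (real k * (- (c * ((fst (r i) - fst b)\<^sup>2 + (snd (r i) - snd b)\<^sup>2))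
          + c * ((fst (r j) - fst b)\<^sup>2 + (snd (r j) - snd b)\<^sup>2)))"
      unfolding green_def cis_cnj cis_mult Complex.DeMoivre ..
    also have "real k * (- (c * ((fst (r i) - fst b)\<^sup>2 + (snd (r i) - snd b)\<^sup>2))
          + c * ((fst (r j) - fst b)\<^sup>2 + (snd (r j) - snd b)\<^sup>2)) =
        \<theta> + real k * ((real a1 - real a2) * fst b * (2 * c * l) + (real b1 - real b2) * snd b * (2 * c * l))"
      unfolding \<theta>_def ri rj by (simp add: power2_eq_square algebra_simps)
    also have "\<dots> = \<theta> + 2 * pi * of_int k1 * fst b / A + 2 * pi * of_int k2 * snd b / A"
      unfolding c k1_def k2_def using A by (simp add: field_simps)
    finally show ?thesis .
  qed
  then show ?thesis
    using integral_square_character [OF A, of k1 k2 \<theta>] ne N k by (simp add: k1_def k2_def)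
qed

text \<open>The row is conjugated so that its \<open>cdot\<close> with \<open>x\<close> is the
  response of the sensor to \<open>x\<close>. Entries have modulus one, so the squared length is
  \<open>card S\<close>.\<close>

lemma isotropic_green:
  assumes A: "0 < A" and c: "2 * c * l = 2 * pi * real N / A" and N: "0 < N"
    and lat: "square_lattice L l r" and S: "card S \<le> s"
  shows "isotropic (uniform_measure lborel ({0..A} \<times> {0..A})) (S :: 'm::finite set)
    (\<lambda>b k. cnj (green c r b k)) (real s)"
proof -
  interpret prob_space "uniform_measure lborel ({0..A} \<times> {0..A :: real})"
    by (rule prob_space_uniform_square [OF A])
  show ?thesis
  proof
    show "(\<integral>b. cnj (cnj (green c r b i)) * cnj (green c r b j) \<partial>uniform_measure lborel ({0..A} \<times> {0..A})) =
        (if i = j then 1 else 0)" for i j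
    proof (cases "i = j")
      case True
      have "green c r b j * cnj (green c r b j) = 1" for b
        using complex_norm_square [of "green c r b j"] by simp
      then show ?thesis using True prob_space by simp
    next
      case False
      then show ?thesis
        using integral_green_power [OF A c N _ lat, of 1 j i] by (simp add: mult.commute)
    qed
    show "(\<lambda>b. cnj (green c r b i)) \<in> borel_measurable (uniform_measure lborel ({0..A} \<times> {0..A}))" for i
      by (rule borel_measurable_cnj) (simp add: measurable_cong_sets [OF sets_uniform_measure refl])
  qed (use S in auto)
qed

lemma steinhaus_green:
  assumes A: "0 < A" and c: "2 * c * l = 2 * pi * real N / A" and N: "0 < N"
    and lat: "square_lattice L l r" and ij: "i \<noteq> j"
  shows "steinhaus (uniform_measure lborel ({0..A} \<times> {0..A})) (\<lambda>b. cnj (green c r b i) * green c r b j)"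
proof -
  interpret prob_space "uniform_measure lborel ({0..A} \<times> {0..A :: real})"
    by (rule prob_space_uniform_square [OF A])
  show ?thesis
  proof
    show "(\<lambda>b. cnj (green c r b i) * green c r b j) \<in> borel_measurable (uniform_measure lborel ({0..A} \<times> {0..A}))"
      unfolding measurable_cong_sets [OF sets_uniform_measure refl]
      by (intro borel_measurable_times borel_measurable_cnj) simp_all
  qed (simp_all add: norm_mult integral_green_power [OF A c N _ lat ij])
qed

text \<open>Stated for the conjugate because the dual values pair the coefficients with
  \<open>cnj (cis \<theta>)\<close>.\<close>

lemma steinhaus_phase: "steinhaus (uniform_measure lborel {0..2 * pi}) (\<lambda>\<theta>. cnj (cis \<theta>))"
proof -
  have em: "emeasure lborel {0..2 * pi} = ennreal (2 * pi)" by simp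
  interpret prob_space "uniform_measure lborel {0..2 * pi}"
    by (rule prob_space_uniform_measure) (simp_all add: em)
  show ?thesis
  proof
    show "(\<integral>\<theta>. cnj (cis \<theta>) ^ k \<partial>uniform_measure lborel {0..2 * pi}) = 0" if "0 < k" for k
    proof -
      have dens: "uniform_measure lborel {0..2 * pi} =
          density lborel (\<lambda>b. ennreal (indicator {0..2 * pi} b / (2 * pi)))"
        unfolding uniform_measure_def em
        by (intro arg_cong [where f = "density lborel"] ext)
           (auto simp: divide_ennreal [symmetric] split: split_indicator)
      have "(\<integral>\<theta>. cnj (cis \<theta>) ^ k \<partial>uniform_measure lborel {0..2 * pi}) =
          (\<integral>\<theta>. (indicator {0..2 * pi} \<theta> / (2 * pi)) *\<^sub>R cnj (cis \<theta>) ^ k \<partial>lborel)"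
        unfolding dens
        by (intro integral_density) (auto intro!: borel_measurable_continuous_onI continuous_intros)
      also have "\<dots> = (\<integral>\<theta>. (1 / (2 * pi)) *\<^sub>R (indicator {0..2 * pi} \<theta> *\<^sub>R
          cis (2 * pi * of_int (- int k) * \<theta> / (2 * pi))) \<partial>lborel)"
        by (intro Bochner_Integration.integral_cong refl) (simp add: cis_cnj Complex.DeMoivre)
      also have "\<dots> = 0"
        unfolding Bochner_Integration.integral_scaleR_right
        using integral_interval_character [of "2 * pi" "- int k"] that by simp
      finally show ?thesis .
    qed
    show "(\<lambda>\<theta>. cnj (cis \<theta>)) \<in> borel_measurable (uniform_measure lborel {0..2 * pi})"
      unfolding measurable_cong_sets [OF sets_uniform_measure refl]
      by (simp, intro borel_measurable_continuous_onI continuous_intros)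
  qed simp
qed

section \<open>Probability of good sensors and good phases\<close>

lemma frame_sensors:
  fixes r :: "'m::finite \<Rightarrow> real \<times> real" and S :: "'m set"
  assumes A: "0 < A" and c: "2 * c * l = 2 * pi * real N / A" and N: "0 < N"
    and lat: "square_lattice L l r" and S: "card S \<le> s" and s: "1 \<le> s"
    and L1: "2 \<le> L1" and n: "64 * real s * L1 < real CARD('n::finite)"
  shows "\<exists>G\<in>sets (sensor_ensemble A :: ('n \<Rightarrow> real \<times> real) measure).
    1 - real (card S) * exp (- L1) \<le> measure (sensor_ensemble A) G \<and>
    (\<forall>a\<in>G. \<forall>x. real CARD('n) / 2 * (\<Sum>i\<in>S. (norm (x i))\<^sup>2) \<le>
      (\<Sum>q\<in>UNIV. (norm (cdot S (\<lambda>k. cnj (green c r (a q) k)) x))\<^sup>2))"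
proof -
  interpret isotropic "uniform_measure lborel ({0..A} \<times> {0..A})" S "\<lambda>b k. cnj (green c r b k)" "real s"
    by (rule isotropic_green [OF A c N lat S])
  define n where "n = real CARD('n)"
  \<comment> \<open>With \<open>\<gamma> = \<mu> = n / 2\<close>, half of the expected Gram matrix
    is asked for. The exponent \<open>2 * h\<close>, at least 4 L1, brings a ratio of at most 3/4
    down to exp (-L1).\<close>
  define h where "h = nat \<lceil>2 * L1\<rceil>"
  define \<tau> where "\<tau> = real s / (n / 2)"
  define \<kappa> where "\<kappa> = (1 - (real (2 * h) - 1) * \<tau> / 2) / (1 + \<tau>)"
  have h: "2 * L1 \<le> real h" "real h \<le> 2 * L1 + 1" using L1 unfolding h_def by linarith+
  have "64 * 1 * L1 \<le> 64 * real s * L1" using s L1 by (intro mult_right_mono mult_left_mono) auto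
  then have n_ge: "64 * L1 < n" and n_pos: "0 < n" using n L1 unfolding n_def by linarith+
  have \<tau>0: "0 \<le> \<tau>" using n_pos by (simp add: \<tau>_def)
  have L1\<tau>: "L1 * \<tau> \<le> 1 / 32" using n n_pos by (simp add: \<tau>_def n_def field_simps)
  have "2 * \<tau> \<le> L1 * \<tau>" using L1 \<tau>0 by (intro mult_right_mono)
  then have \<tau>_le: "\<tau> \<le> 1 / 64" using L1\<tau> by linarith
  \<comment> \<open>\<open>2 * h\<close> is at most 4 L1 + 2, and 2 \<le> L1.\<close>
  have "real (2 * h) * \<tau> \<le> (5 * L1) * \<tau>" using h L1 \<tau>0 by (intro mult_right_mono) auto
  then have h\<tau>: "real (2 * h) * \<tau> \<le> 5 / 32" using L1\<tau> by linarith
  \<comment> \<open>The value 5/6 makes 1 / (1/2 + \<kappa>) at most 3/4, which is at most exp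
    (-1/4).\<close>
  have "5 / 6 \<le> \<kappa>"
  proof -
    have "(5 / 6) * (1 + \<tau>) \<le> (5 / 6) * (1 + 1 / 64)" using \<tau>_le by simp
    also have "\<dots> \<le> 1 - (5 / 32) / 2" by simp
    also have "\<dots> \<le> 1 - (real (2 * h) - 1) * \<tau> / 2" using h\<tau> \<tau>0 by (simp add: left_diff_distrib)
    finally show ?thesis using \<tau>0 by (simp add: \<kappa>_def pos_le_divide_eq)
  qed
  have "0 < h" using h L1 by (intro Nat.gr0I) auto
  from lower_frame_bound [of "n / 2" h "n / 2" "UNIV :: 'n set"] this n_pos h\<tau> h L1 n_ge
  obtain G where G: "G \<in> sets (sensor_ensemble A :: ('n \<Rightarrow> real \<times> real) measure)"
    and prob: "1 - real (card S) * ((n / 2 + n / 2) / (n / 2 + n * \<kappa>)) ^ (2 * h) \<le> measure (sensor_ensemble A) G"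
    and frame: "\<forall>a\<in>G. \<forall>x. n / 2 * (\<Sum>i\<in>S. (norm (x i))\<^sup>2) \<le>
      (\<Sum>q\<in>UNIV. (norm (cdot S (\<lambda>k. cnj (green c r (a q) k)) x))\<^sup>2)"
    unfolding \<kappa>_def \<tau>_def sensor_ensemble_def n_def by auto
  have "(n / 2 + n / 2) / (n / 2 + n * \<kappa>) = 1 / (1 / 2 + \<kappa>)"
  proof -
    have "(n / 2 + n / 2) / (n / 2 + n * \<kappa>) = (n * 1) / (n * (1 / 2 + \<kappa>))" by (simp add: algebra_simps)
    then show ?thesis using n_pos by (simp only: mult_divide_mult_cancel_left order_less_imp_not_eq2 not_False_eq_True)
  qed
  also have "\<dots> \<le> 3 / 4" using \<open>5 / 6 \<le> \<kappa>\<close> by (simp add: pos_divide_le_eq)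
  also have "\<dots> \<le> exp (- (1 / 4))" using exp_ge_add_one_self [of "- (1 / 4)"] by simp
  finally have "((n / 2 + n / 2) / (n / 2 + n * \<kappa>)) ^ (2 * h) \<le> exp (- (1 / 4)) ^ (2 * h)"
    using n_pos \<open>5 / 6 \<le> \<kappa>\<close> by (intro power_mono) auto
  also have "\<dots> = exp (- (real h / 2))" by (simp flip: exp_of_nat_mult)
  also have "\<dots> \<le> exp (- L1)" using h by simp
  finally have "real (card S) * ((n / 2 + n / 2) / (n / 2 + n * \<kappa>)) ^ (2 * h) \<le> real (card S) * exp (- L1)"
    by (intro mult_left_mono) auto
  then have "1 - real (card S) * exp (- L1) \<le> measure (sensor_ensemble A) G" using prob by linarith
  then show ?thesis using G frame unfolding n_def by blast
qed

text \<open>For one pair the correlations are n independent uniform phases, so the tail bound with V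
  = n and t^2 = 4 L1 n gives 2 exp (-2 L1). The square in the conclusion comes from the union over
  the m^2 ordered pairs.\<close>

lemma coherent_sensors:
  fixes r :: "'m::finite \<Rightarrow> real \<times> real"
  assumes A: "0 < A" and c: "2 * c * l = 2 * pi * real N / A" and N: "0 < N"
    and lat: "square_lattice L l r" and L1: "0 < L1"
  shows "\<exists>G\<in>sets (sensor_ensemble A :: ('n::finite \<Rightarrow> real \<times> real) measure).
    1 - 2 * (real CARD('m) * exp (- L1))\<^sup>2 \<le> measure (sensor_ensemble A) G \<and>
    (\<forall>a\<in>G. \<forall>i j. i \<noteq> j \<longrightarrow>
      (norm (\<Sum>q\<in>UNIV. cnj (green c r (a q) i) * green c r (a q) j))\<^sup>2 \<le> 4 * L1 * real CARD('n))"
proof -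
  define P where "P = (sensor_ensemble A :: ('n \<Rightarrow> real \<times> real) measure)"
  interpret P: prob_space P
    unfolding P_def sensor_ensemble_def by (intro prob_space_PiM prob_space_uniform_square A)
  define n where "n = real CARD('n)"
  have n: "0 < n" by (simp add: n_def)
  define Z where "Z i j a = norm (\<Sum>q\<in>UNIV. 1 * (cnj (green c r (a q) i) * green c r (a q) j))" for i j and a :: "'n \<Rightarrow> real \<times> real"
  define B where "B = (\<lambda>(i, j). if i = j then {} else {a \<in> space P. sqrt (4 * L1 * n) \<le> Z i j a})"
  have B: "B p \<in> sets P \<and> measure P (B p) \<le> 2 * (exp (- L1))\<^sup>2" for p
  proof (cases "fst p = snd p")
    case False
    interpret steinhaus "uniform_measure lborel ({0..A} \<times> {0..A})" "\<lambda>b. cnj (green c r b (fst p)) * green c r b (snd p)"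
      by (rule steinhaus_green [OF A c N lat False])
    have "B p = {a \<in> space P. sqrt (4 * L1 * n) \<le> Z (fst p) (snd p) a}" using False by (simp add: B_def split_beta)
    moreover have "Z (fst p) (snd p) \<in> borel_measurable P"
      unfolding Z_def P_def sensor_ensemble_def by (rule measurable_norm_sum)
    moreover have "measure P {a \<in> space P. sqrt (4 * L1 * n) \<le> Z (fst p) (snd p) a} \<le> 2 * exp (- (sqrt (4 * L1 * n))\<^sup>2 / (2 * n))"
      unfolding P_def sensor_ensemble_def Z_def using n L1
      by (intro tail_bound) (simp_all add: n_def)
    moreover have "- (sqrt (4 * L1 * n))\<^sup>2 / (2 * n) = - L1 + - L1" using n L1 by (simp add: field_simps)
    ultimately show ?thesis by (simp add: power2_eq_square exp_add [symmetric])
  qed (simp add: B_def split_beta)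
  define G where "G = space P - (\<Union>p\<in>UNIV. B p)"
  have "measure P (\<Union>p\<in>UNIV. B p) \<le> (\<Sum>p\<in>UNIV. measure P (B p))"
    using B by (intro P.finite_measure_subadditive_finite) auto
  also have "\<dots> \<le> (\<Sum>p\<in>(UNIV :: ('m \<times> 'm) set). 2 * (exp (- L1))\<^sup>2)"
    using B by (intro sum_mono) auto
  also have "\<dots> = 2 * (real CARD('m) * exp (- L1))\<^sup>2"
    by (simp add: power_mult_distrib power2_eq_square)
  finally have "1 - 2 * (real CARD('m) * exp (- L1))\<^sup>2 \<le> measure P G"
    unfolding G_def using B by (subst P.prob_compl) (auto intro!: sets.finite_UN)
  moreover have "G \<in> sets P" unfolding G_def using B by (auto intro!: sets.finite_UN)
  moreover have "(norm (\<Sum>q\<in>UNIV. cnj (green c r (a q) i) * green c r (a q) j))\<^sup>2 \<le> 4 * L1 * n"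
    if "a \<in> G" "i \<noteq> j" for a i j
  proof -
    have "a \<notin> B (i, j)" "a \<in> space P" using that by (auto simp: G_def)
    then have "Z i j a \<le> sqrt (4 * L1 * n)" using that by (simp add: B_def)
    then have "(Z i j a)\<^sup>2 \<le> (sqrt (4 * L1 * n))\<^sup>2" by (rule power_mono) (simp add: Z_def)
    then show ?thesis using L1 n by (simp add: Z_def)
  qed
  ultimately show ?thesis unfolding P_def n_def by blast
qed

text \<open>The event depends on sensors and support only, and then all vectors with this support
  and these phases are recovered at once. This uniformity matters because the magnitudes may depend
  on the phases drawn.\<close>

lemma good_phases:
  fixes r :: "'m::finite \<Rightarrow> real \<times> real" and S :: "'m set" and a :: "'n::finite \<Rightarrow> real \<times> real"
  defines "n \<equiv> real CARD('n)"
  assumes frame: "\<And>x. n / 2 * (\<Sum>i\<in>S. (norm (x i))\<^sup>2) \<le>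
      (\<Sum>q\<in>UNIV. (norm (cdot S (\<lambda>k. cnj (green (\<omega> / (2 * z0)) r (a q) k)) x))\<^sup>2)"
    and coh: "\<And>i j. i \<noteq> j \<Longrightarrow>
      (norm (\<Sum>q\<in>UNIV. cnj (green (\<omega> / (2 * z0)) r (a q) i) * green (\<omega> / (2 * z0)) r (a q) j))\<^sup>2 \<le> 4 * L1 * n"
    and S: "card S \<le> s" and L: "0 < L1" "0 < L2" and n: "64 * real s * L1 * L2 \<le> n"
  shows "\<exists>E\<in>sets (PiM UNIV (\<lambda>_::'m. uniform_measure lborel {0..2 * pi})).
    1 - 2 * real CARD('m) * exp (- 2 * L2) \<le> measure (PiM UNIV (\<lambda>_::'m. uniform_measure lborel {0..2 * pi})) E \<and>
    (\<forall>\<Theta>\<in>E. \<forall>X. {j. X $ j \<noteq> 0} = S \<longrightarrow> (\<forall>j. X $ j \<noteq> 0 \<longrightarrow> X $ j = of_real (norm (X $ j)) * cis (\<Theta> j)) \<longrightarrow>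
      BP_recovers (sensing_matrix \<omega> z0 r a) X)"
proof -
  define g where "g q k = green (\<omega> / (2 * z0)) r (a q) k" for q k
  define M where "M = sensing_matrix \<omega> z0 r a"
  have M: "M $ q $ k = of_real (1 / sqrt n) * g q k" for q k
    by (simp add: M_def sensing_matrix_green g_def n_def)
  have n0: "0 < n" by (simp add: n_def)
  have sq: "complex_of_real (1 / sqrt n) * complex_of_real (1 / sqrt n) = of_real (1 / n)"
    using n0 by (simp flip: of_real_mult)
  have cdot_M: "cdot S (\<lambda>k. cnj (M $ q $ k)) x = of_real (1 / sqrt n) * cdot S (\<lambda>k. cnj (g q k)) x" for q x
    by (simp add: cdot_def M sum_distrib_left mult_ac)
  have frame': "1 / 2 * (\<Sum>i\<in>S. (norm (x i))\<^sup>2) \<le> (\<Sum>q\<in>UNIV. (norm (cdot S (\<lambda>k. cnj (M $ q $ k)) x))\<^sup>2)" for x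
  proof -
    have "(\<Sum>q\<in>UNIV. (norm (cdot S (\<lambda>k. cnj (M $ q $ k)) x))\<^sup>2) =
        (\<Sum>q\<in>UNIV. (norm (cdot S (\<lambda>k. cnj (g q k)) x))\<^sup>2) / n"
      unfolding cdot_M using n0 by (simp add: norm_mult norm_divide power_divide sum_divide_distrib)
    then have "n * (\<Sum>q\<in>UNIV. (norm (cdot S (\<lambda>k. cnj (M $ q $ k)) x))\<^sup>2) =
        (\<Sum>q\<in>UNIV. (norm (cdot S (\<lambda>k. cnj (g q k)) x))\<^sup>2)"
      using n0 by simp
    with frame[of x] have "n * (1 / 2 * (\<Sum>i\<in>S. (norm (x i))\<^sup>2)) \<le>
        n * (\<Sum>q\<in>UNIV. (norm (cdot S (\<lambda>k. cnj (M $ q $ k)) x))\<^sup>2)"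
      unfolding g_def by linarith
    then show ?thesis using n0 by (rule mult_left_le_imp_le)
  qed
  define b where "b j k = (\<Sum>q\<in>UNIV. cnj (M $ q $ k) * M $ q $ j)" for j k
  have b: "(norm (b j k))\<^sup>2 \<le> 4 * L1 / n" if "k \<noteq> j" for j k
  proof -
    have "b j k = of_real (1 / n) * (\<Sum>q\<in>UNIV. cnj (g q k) * g q j)"
      unfolding b_def M complex_cnj_mult complex_cnj_complex_of_real sq [symmetric] sum_distrib_left
      by (simp add: mult_ac)
    then have "(norm (b j k))\<^sup>2 = (norm (\<Sum>q\<in>UNIV. cnj (g q k) * g q j))\<^sup>2 / n\<^sup>2"
      using n0 by (simp add: norm_mult norm_divide power_divide)
    also have "\<dots> \<le> (4 * L1 * n) / n\<^sup>2"
      using coh [OF that] by (intro divide_right_mono) (simp_all add: g_def)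
    finally show ?thesis using n0 by (simp add: power2_eq_square)
  qed
  have "\<forall>j. \<exists>c. (\<forall>k\<in>S. (\<Sum>q\<in>UNIV. cnj (M $ q $ k) * cdot S (\<lambda>k. cnj (M $ q $ k)) c) = b j k) \<and>
    (1 / 2)\<^sup>2 * (\<Sum>k\<in>S. (norm (c k))\<^sup>2) \<le> (\<Sum>k\<in>S. (norm (b j k))\<^sup>2)"
    by (rule allI, rule frame_solve [where \<phi> = "\<lambda>q k. cnj (M $ q $ k)", OF frame']) simp
  from choice [OF this] obtain c where c_all:
    "\<forall>j. (\<forall>k\<in>S. (\<Sum>q\<in>UNIV. cnj (M $ q $ k) * cdot S (\<lambda>k. cnj (M $ q $ k)) (c j)) = b j k) \<and>
      (1 / 2)\<^sup>2 * (\<Sum>k\<in>S. (norm (c j k))\<^sup>2) \<le> (\<Sum>k\<in>S. (norm (b j k))\<^sup>2)"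
    by (elim exE)
  note c = c_all [rule_format, THEN conjunct1, rule_format]
    and c_le = c_all [rule_format, THEN conjunct2]
  \<comment> \<open>Extension by zero lets the sum run over the whole index set of the product of
    phases, as \<open>tail_bound\<close> expects.\<close>
  define c' where "c' j k = (if k \<in> S then c j k else 0)" for j k
  \<comment> \<open>The factor 4 is the inverse square of the frame bound 1/2; with at most
    \<open>s\<close> entries of size 4 L1 / n the total is 16 s L1 / n, which 64 s L1 L2 \<le> n
    turns into 1 / (4 L2).\<close>
  have V: "(\<Sum>k\<in>UNIV. (norm (c' j k))\<^sup>2) \<le> 1 / (4 * L2)" if "j \<notin> S" for j
  proof -
    have "(\<Sum>k\<in>UNIV. (norm (c' j k))\<^sup>2) = (\<Sum>k\<in>S. (norm (c j k))\<^sup>2)"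
      by (simp add: c'_def if_distrib [of "\<lambda>z. (norm z)\<^sup>2"] sum.If_cases cong: if_cong)
    also have "\<dots> \<le> 4 * (\<Sum>k\<in>S. (norm (b j k))\<^sup>2)" using c_le[of j] by (simp add: power2_eq_square)
    also have "\<dots> \<le> 4 * (\<Sum>k\<in>S. 4 * L1 / n)"
      using that by (intro mult_left_mono sum_mono b) auto
    also have "\<dots> \<le> 4 * (real s * (4 * L1 / n))"
      using S L n0 by (simp add: divide_right_mono mult_right_mono)
    also have "\<dots> \<le> 1 / (4 * L2)" using n n0 L by (simp add: field_simps)
    finally show ?thesis .
  qed
  define U where "U = PiM UNIV (\<lambda>_::'m. uniform_measure lborel {0..2 * pi})"
  interpret steinhaus "uniform_measure lborel {0..2 * pi}" "\<lambda>\<theta>. cnj (cis \<theta>)" by (rule steinhaus_phase)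
  interpret U: prob_space U unfolding U_def by (intro prob_space_PiM prob_space_axioms)
  define Z where "Z j \<Theta> = norm (\<Sum>k\<in>UNIV. c' j k * cnj (cis (\<Theta> k)))" for j and \<Theta> :: "'m \<Rightarrow> real"
  define B where "B j = {\<Theta> \<in> space U. 1 \<le> Z j \<Theta>}" for j
  have B: "B j \<in> sets U" for j
  proof -
    have "Z j \<in> borel_measurable U" unfolding Z_def U_def by (rule measurable_norm_sum)
    then show ?thesis by (simp add: B_def)
  qed
  have "measure U (B j) \<le> 2 * exp (- 2 * L2)" if "j \<notin> S" for j
  proof -
    have "measure U (B j) \<le> 2 * exp (- 1\<^sup>2 / (2 * (1 / (4 * L2))))"
      unfolding B_def Z_def U_def using L by (intro tail_bound V that) auto
    then show ?thesis using L by simp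
  qed
  then have "(\<Sum>j\<in>-S. measure U (B j)) \<le> (\<Sum>j\<in>-S. 2 * exp (- 2 * L2))"
    by (intro sum_mono) auto
  also have "\<dots> \<le> 2 * real CARD('m) * exp (- 2 * L2)"
    using card_mono [of UNIV "-S"] by simp
  finally have "(\<Sum>j\<in>-S. measure U (B j)) \<le> 2 * real CARD('m) * exp (- 2 * L2)" .
  moreover have "measure U (\<Union>j\<in>-S. B j) \<le> (\<Sum>j\<in>-S. measure U (B j))"
    using B by (intro U.finite_measure_subadditive_finite) auto
  ultimately have le: "measure U (\<Union>j\<in>-S. B j) \<le> 2 * real CARD('m) * exp (- 2 * L2)" by linarith
  define E where "E = space U - (\<Union>j\<in>-S. B j)"
  have UB: "(\<Union>j\<in>-S. B j) \<in> sets U" using B by (intro sets.finite_UN) auto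
  have "1 - 2 * real CARD('m) * exp (- 2 * L2) \<le> measure U E"
    unfolding E_def using le UB by (subst U.prob_compl) auto
  moreover have "E \<in> sets U" unfolding E_def using UB by auto
  moreover have "BP_recovers M X"
    if E: "\<Theta> \<in> E" and supp: "{j. X $ j \<noteq> 0} = S"
      and sgn: "\<And>j. X $ j \<noteq> 0 \<Longrightarrow> X $ j = of_real (norm (X $ j)) * cis (\<Theta> j)" for \<Theta> X
  proof (rule BP_recovers_dual [where \<sigma> = "\<lambda>j. cis (\<Theta> j)" and S = S and \<gamma> = "1 / 2" and c = c])
    show "norm (\<Sum>k\<in>S. c j k * cnj (cis (\<Theta> k))) < 1" if "j \<notin> S" for j
    proof -
      have "Z j \<Theta> < 1" using E that by (auto simp: E_def B_def not_le)
      moreover have "(\<Sum>k\<in>UNIV. c' j k * cnj (cis (\<Theta> k))) = (\<Sum>k\<in>S. c j k * cnj (cis (\<Theta> k)))"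
        by (simp add: c'_def if_distrib [of "\<lambda>z. z * _"] sum.If_cases cong: if_cong)
      ultimately show ?thesis by (simp add: Z_def)
    qed
    show "(\<Sum>q\<in>UNIV. cnj (M $ q $ k) * cdot S (\<lambda>k. cnj (M $ q $ k)) (c j)) = (\<Sum>q\<in>UNIV. cnj (M $ q $ k) * M $ q $ j)"
      if "k \<in> S" for j k using c [OF that] by (simp add: b_def)
    show "X $ j = of_real (norm (X $ j)) * cis (\<Theta> j)" if "j \<in> S" for j
      using that supp by (intro sgn) auto
  qed (use supp frame' in auto)
  ultimately show ?thesis unfolding U_def M_def by blast
qed

section \<open>Recovery probability\<close>

lemma measurable_sensing_matrix:
  "(\<lambda>a. sensing_matrix \<omega> z0 r a :: complex^'m::finite^'n::finite) \<in> borel_measurable (sensor_ensemble A)"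
proof (intro borel_measurable_vecI)
  fix q :: 'n and j :: 'm
  have "(\<lambda>a. a q) \<in> measurable (sensor_ensemble A) (uniform_measure lborel ({0..A} \<times> {0..A}))"
    unfolding sensor_ensemble_def by (rule measurable_component_singleton) simp
  then have "(\<lambda>a. a q) \<in> borel_measurable (sensor_ensemble A)"
    by (simp add: measurable_cong_sets [OF refl sets_uniform_measure])
  from measurable_compose [OF this measurable_green]
  show "(\<lambda>a. sensing_matrix \<omega> z0 r a $ q $ j) \<in> borel_measurable (sensor_ensemble A)"
    unfolding sensing_matrix_green by (intro borel_measurable_times borel_measurable_const)
qed

lemma sets_BP_recovers:
  fixes X :: "'t \<Rightarrow> complex^'m::finite"
  assumes X: "X \<in> borel_measurable T"
  shows "{(a, t) \<in> space ((sensor_ensemble A :: ('n::finite \<Rightarrow> real \<times> real) measure) \<Otimes>\<^sub>M T).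
    BP_recovers (sensing_matrix \<omega> z0 r a) (X t)} \<in> sets (sensor_ensemble A \<Otimes>\<^sub>M T)"
proof -
  define f where "f = (\<lambda>p :: ('n \<Rightarrow> real \<times> real) \<times> 't. (sensing_matrix \<omega> z0 r (fst p) :: complex^'m^'n, X (snd p)))"
  have "f \<in> borel_measurable (sensor_ensemble A \<Otimes>\<^sub>M T)"
    unfolding f_def borel_prod [symmetric]
    by (intro measurable_Pair measurable_compose [OF measurable_fst measurable_sensing_matrix]
        measurable_compose [OF measurable_snd X])
  from measurable_sets [OF this borel_BP_recovers]
  show ?thesis
    by (rule back_subst [where P = "\<lambda>B. B \<in> _"]) (auto simp: f_def)
qed

text \<open>The index tuples form a finite set, and for fixed sensors the events that tuple
  \<open>j\<close> is drawn together with good phases are disjoint, each of probability at least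
  \<open>\<beta> * w j\<close> by the product law. Integrating over the sensors afterwards weighs
  tuple \<open>j\<close> by the measure of its own \<open>G\<close>, so \<open>G\<close> may vary
  with the support. The phase events are chosen separately for each \<open>a\<close>; only
  indicators of \<open>G\<close> are integrated.\<close>

lemma prob_recovery:
  fixes r :: "'m::finite \<Rightarrow> real \<times> real" and X :: "'t \<Rightarrow> complex^'m" and A :: real
  defines "P \<equiv> (sensor_ensemble A :: ('n::finite \<Rightarrow> real \<times> real) measure)"
    and "U \<equiv> PiM UNIV (\<lambda>_::'m. uniform_measure lborel {0..2 * pi})"
  assumes A: "0 < A" and target: "target_ensemble s T X"
    and G: "\<And>S. card S \<le> s \<Longrightarrow> G S \<in> sets P" "\<And>S. card S \<le> s \<Longrightarrow> \<alpha> \<le> measure P (G S)"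
    and E: "\<And>S a. card S \<le> s \<Longrightarrow> a \<in> G S \<Longrightarrow> \<exists>E\<in>sets U. \<beta> \<le> measure U E \<and>
      (\<forall>\<Theta>\<in>E. \<forall>X. {j. X $ j \<noteq> 0} = S \<longrightarrow> (\<forall>j. X $ j \<noteq> 0 \<longrightarrow> X $ j = of_real (norm (X $ j)) * cis (\<Theta> j)) \<longrightarrow>
        BP_recovers (sensing_matrix \<omega> z0 r a) X)"
    and \<alpha>: "0 \<le> \<alpha>" and \<beta>: "0 \<le> \<beta>"
  shows "\<alpha> * \<beta> \<le> measure (P \<Otimes>\<^sub>M T) {(a, t) \<in> space (P \<Otimes>\<^sub>M T). BP_recovers (sensing_matrix \<omega> z0 r a) (X t)}"
proof -
  note target_props = target [unfolded target_ensemble_def]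
  note T = target_props [THEN conjunct1] and X = target_props [THEN conjunct2, THEN conjunct1]
    and ex = target_props [THEN conjunct2, THEN conjunct2]
  from ex obtain J \<Theta> where J\<Theta>: "(\<lambda>t. (J t, \<Theta> t)) \<in> measurable T (index_phase_law s)"
    and distr: "distr T (index_phase_law s) (\<lambda>t. (J t, \<Theta> t)) = index_phase_law s"
    and supp: "\<forall>t\<in>space T. {j. X t $ j \<noteq> 0} = J t ` {..<s}"
    and sgn: "\<forall>t\<in>space T. \<forall>j. X t $ j \<noteq> 0 \<longrightarrow> X t $ j = of_real (norm (X t $ j)) * cis (\<Theta> t j)"
    by (elim exE conjE)
  interpret T: prob_space T by (rule T)
  interpret P: prob_space P
    unfolding P_def sensor_ensemble_def by (intro prob_space_PiM prob_space_uniform_square A)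
  interpret PT: pair_prob_space P T ..
  have "prob_space (uniform_measure lborel {0..2 * pi})" using steinhaus_phase by (simp add: steinhaus_def)
  then interpret U: prob_space U unfolding U_def by (intro prob_space_PiM)
  define V where "V = PiM {..<s} (\<lambda>_. uniform_count_measure (UNIV :: 'm set))"
  interpret V: prob_space V
    unfolding V_def by (intro prob_space_PiM prob_space_uniform_count_measure) auto
  have law: "index_phase_law s = V \<Otimes>\<^sub>M U"
    by (simp add: index_phase_law_def V_def U_def)
  define \<J> where "\<J> = space V"
  have \<J>_eq: "\<J> = PiE {..<s} (\<lambda>_. UNIV)"
    by (simp add: \<J>_def V_def space_PiM space_uniform_count_measure)
  have fin: "finite \<J>" unfolding \<J>_eq by (intro finite_PiE) auto
  have sing: "{j} \<in> sets V" if "j \<in> \<J>" for j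
  proof -
    have "{j} = PiE {..<s} (\<lambda>i. {j i})"
      using that by (intro PiE_singleton [symmetric]) (simp add: \<J>_eq PiE_def)
    also have "\<dots> \<in> sets V"
      unfolding V_def by (intro sets_PiM_I_finite) (auto simp: sets_uniform_count_measure)
    finally show ?thesis .
  qed
  define w where "w j = measure V {j}" for j
  have w_sum: "(\<Sum>j\<in>\<J>. w j) = 1"
    using V.finite_measure_eq_sum_singleton [OF fin] sing V.prob_space by (simp add: w_def \<J>_def)
  have card_J: "card (j ` {..<s}) \<le> s" for j :: "nat \<Rightarrow> 'm"
    using card_image_le [of "{..<s}" j] by simp
  define B where "B = {(a, t) \<in> space (P \<Otimes>\<^sub>M T). BP_recovers (sensing_matrix \<omega> z0 r a) (X t)}"
  have B: "B \<in> sets (P \<Otimes>\<^sub>M T)" unfolding B_def P_def by (rule sets_BP_recovers [OF X])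
  have slice: "ennreal (\<Sum>j\<in>\<J>. \<beta> * w j * indicator (G (j ` {..<s})) a) \<le> emeasure T (Pair a -` B)"
    if a: "a \<in> space P" for a
  proof -
    define H where "H = {j \<in> \<J>. a \<in> G (j ` {..<s})}"
    have "\<forall>j\<in>H. \<exists>E. E \<in> sets U \<and> \<beta> \<le> measure U E \<and>
      (\<forall>\<Theta>\<in>E. \<forall>X. {i. X $ i \<noteq> 0} = j ` {..<s} \<longrightarrow> (\<forall>i. X $ i \<noteq> 0 \<longrightarrow> X $ i = of_real (norm (X $ i)) * cis (\<Theta> i)) \<longrightarrow>
        BP_recovers (sensing_matrix \<omega> z0 r a) X)"
      by (rule ballI, rule E [OF card_J, unfolded Bex_def]) (simp add: H_def)
    from bchoice [OF this] obtain F where F_all: "\<forall>j\<in>H. F j \<in> sets U \<and> \<beta> \<le> measure U (F j) \<and>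
      (\<forall>\<Theta>\<in>F j. \<forall>X. {i. X $ i \<noteq> 0} = j ` {..<s} \<longrightarrow> (\<forall>i. X $ i \<noteq> 0 \<longrightarrow> X $ i = of_real (norm (X $ i)) * cis (\<Theta> i)) \<longrightarrow>
        BP_recovers (sensing_matrix \<omega> z0 r a) X)"
      by (elim exE)
    note F = F_all [THEN bspec, THEN conjunct1] F_all [THEN bspec, THEN conjunct2, THEN conjunct1]
      and rec = F_all [THEN bspec, THEN conjunct2, THEN conjunct2, THEN bspec, THEN spec, THEN mp, THEN mp]
    define K where "K j = (\<lambda>t. (J t, \<Theta> t)) -` ({j} \<times> F j) \<inter> space T" for j
    have H: "finite H" "H \<subseteq> \<J>" using fin by (auto simp: H_def)
    have rect: "{j} \<times> F j \<in> sets (index_phase_law s)" if "j \<in> H" for j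
      unfolding law using that F(1) sing H(2) by (intro pair_measureI) auto
    have K: "K j \<in> sets T" if "j \<in> H" for j
      unfolding K_def by (rule measurable_sets [OF J\<Theta> rect [OF that]])
    have K_ge: "\<beta> * w j \<le> measure T (K j)" if "j \<in> H" for j
    proof -
      have "measure T (K j) = measure (V \<Otimes>\<^sub>M U) ({j} \<times> F j)"
        using measure_distr [OF J\<Theta> rect [OF that]] unfolding distr unfolding K_def law by simp
      also have "\<dots> = w j * measure U (F j)"
        unfolding w_def measure_def
        using U.emeasure_pair_measure_Times [OF sing F(1) [OF that]] that H(2)
        by (auto simp: enn2real_mult)
      finally show ?thesis using F(2) [OF that] by (simp add: mult.commute mult_right_mono w_def)
    qed
    have disj: "disjoint_family_on K H" by (auto simp: disjoint_family_on_def K_def)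
    have "(\<Sum>j\<in>\<J>. \<beta> * w j * indicator (G (j ` {..<s})) a) = (\<Sum>j\<in>H. \<beta> * w j)"
      unfolding H_def using fin by (simp add: Collect_conj_eq sum.inter_restrict indicator_def if_distrib [of "\<lambda>z. _ * z"] cong: if_cong)
    also have "\<dots> \<le> (\<Sum>j\<in>H. measure T (K j))" by (intro sum_mono K_ge)
    also have "\<dots> = measure T (\<Union>j\<in>H. K j)"
      using K H(1) disj by (intro T.finite_measure_finite_Union [symmetric]) auto
    also have "ennreal (measure T (\<Union>j\<in>H. K j)) = emeasure T (\<Union>j\<in>H. K j)"
      by (simp add: T.emeasure_eq_measure)
    also have "\<dots> \<le> emeasure T (Pair a -` B)"
    proof (rule emeasure_mono)
      show "Pair a -` B \<in> sets T" by (rule sets_Pair1 [OF B])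
      show "(\<Union>j\<in>H. K j) \<subseteq> Pair a -` B"
      proof
        fix t assume "t \<in> (\<Union>j\<in>H. K j)"
        then have t: "t \<in> space T" "J t \<in> H" "\<Theta> t \<in> F (J t)" by (auto simp: K_def)
        then have "BP_recovers (sensing_matrix \<omega> z0 r a) (X t)"
          by (intro rec [OF t(2,3)] bspec [OF supp] bspec [OF sgn])
        then show "t \<in> Pair a -` B" using a t by (simp add: B_def space_pair_measure)
      qed
    qed
    finally show ?thesis by (simp add: ennreal_leI)
  qed
  have "\<alpha> * \<beta> = (\<Sum>j\<in>\<J>. \<beta> * w j * \<alpha>)"
    using w_sum by (simp flip: sum_distrib_left sum_distrib_right)
  also have "\<dots> \<le> (\<Sum>j\<in>\<J>. \<beta> * w j * measure P (G (j ` {..<s})))"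
    using \<beta> by (intro sum_mono mult_left_mono G(2) card_J mult_nonneg_nonneg) (auto simp: w_def)
  also have "\<dots> = (\<integral>a. (\<Sum>j\<in>\<J>. \<beta> * w j * indicator (G (j ` {..<s})) a) \<partial>P)"
    using G(1) [OF card_J] by (simp add: Bochner_Integration.integral_sum P.emeasure_eq_measure)
  finally have "ennreal (\<alpha> * \<beta>) \<le> ennreal (\<integral>a. (\<Sum>j\<in>\<J>. \<beta> * w j * indicator (G (j ` {..<s})) a) \<partial>P)"
    by (rule ennreal_leI)
  also have "\<dots> = (\<integral>\<^sup>+a. ennreal (\<Sum>j\<in>\<J>. \<beta> * w j * indicator (G (j ` {..<s})) a) \<partial>P)"
    using G(1) [OF card_J] \<beta>
    by (intro nn_integral_eq_integral [symmetric])
       (auto simp: w_def P.emeasure_eq_measure intro!: sum_nonneg mult_nonneg_nonneg)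
  also have "\<dots> \<le> (\<integral>\<^sup>+a. emeasure T (Pair a -` B) \<partial>P)"
    by (intro nn_integral_mono slice)
  also have "\<dots> = emeasure (P \<Otimes>\<^sub>M T) B"
    by (rule T.emeasure_pair_measure_alt [OF B, symmetric])
  also have "\<dots> = ennreal (measure (P \<Otimes>\<^sub>M T) B)"
    by (rule PT.emeasure_eq_measure)
  finally show ?thesis unfolding B_def by simp
qed

text \<open>Covers the lattice with a single point, for which the lower bounds on the logarithms
  used otherwise may fail. The only column has no zero entry, so the kernel is trivial.\<close>

lemma BP_recovers_singleton:
  assumes "CARD('m) = 1"
  shows "BP_recovers (sensing_matrix \<omega> z0 r a :: complex^'m::finite^'n::finite) X"
  unfolding BP_recovers_iff
proof (intro allI impI, elim conjE)
  fix h :: "complex^'m"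
  assume h: "(sensing_matrix \<omega> z0 r a :: complex^'m^'n) *v h = 0" "h \<noteq> 0"
  obtain j where j: "(UNIV :: 'm set) = {j}" using assms by (rule card_1_singletonE)
  obtain q :: 'n where True by blast
  have "((sensing_matrix \<omega> z0 r a :: complex^'m^'n) *v h) $ q = sensing_matrix \<omega> z0 r a $ q $ j * h $ j"
    by (simp add: matrix_vector_mult_def j)
  moreover have "sensing_matrix \<omega> z0 r a $ q $ j \<noteq> 0"
    unfolding sensing_matrix_green by (simp add: green_def)
  ultimately have "h $ j = 0" using h by auto
  moreover have "i = j" for i using j by auto
  ultimately have "h = 0" by (metis vec_eq_iff zero_index)
  then show "l1_norm X < l1_norm (X + h)" using h by simp
qed

lemma (in prob_space) measure_Int_ge:
  assumes "A \<in> events" "B \<in> events"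
  shows "prob A + prob B - 1 \<le> prob (A \<inter> B)"
proof -
  have "prob A \<le> prob (A \<inter> B \<union> (space M - B))"
    using assms sets.sets_into_space by (intro finite_measure_mono) auto
  also have "\<dots> \<le> prob (A \<inter> B) + prob (space M - B)"
    using assms by (intro measure_Un_le) auto
  finally show ?thesis using assms by (simp add: prob_compl)
qed

text \<open>With exp (-L1) = \<delta> / (2m), conditioning fails with probability at most card S exp
  (-L1) \<le> \<delta>/2, and the coherence bound with probability at most 2 (m exp (-L1))^2 =
  \<delta>^2/2 \<le> \<delta>/2.\<close>

lemma good_sensors:
  fixes r :: "'m::finite \<Rightarrow> real \<times> real" and S :: "'m set"
  assumes A: "0 < A" and c: "2 * c * l = 2 * pi * real N / A" and N: "0 < N"
    and lat: "square_lattice L l r" and S: "card S \<le> s" and s: "1 \<le> s"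
    and \<delta>: "0 < \<delta>" "\<delta> \<le> 1" and L1: "2 \<le> ln (2 * real CARD('m) / \<delta>)"
    and n: "64 * real s * ln (2 * real CARD('m) / \<delta>) < real CARD('n::finite)"
  shows "\<exists>G\<in>sets (sensor_ensemble A :: ('n \<Rightarrow> real \<times> real) measure).
    1 - \<delta> \<le> measure (sensor_ensemble A) G \<and>
    (\<forall>a\<in>G. (\<forall>x. real CARD('n) / 2 * (\<Sum>i\<in>S. (norm (x i))\<^sup>2) \<le>
        (\<Sum>q\<in>UNIV. (norm (cdot S (\<lambda>k. cnj (green c r (a q) k)) x))\<^sup>2)) \<and>
      (\<forall>i j. i \<noteq> j \<longrightarrow> (norm (\<Sum>q\<in>UNIV. cnj (green c r (a q) i) * green c r (a q) j))\<^sup>2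
        \<le> 4 * ln (2 * real CARD('m) / \<delta>) * real CARD('n)))"
proof -
  define P where "P = (sensor_ensemble A :: ('n \<Rightarrow> real \<times> real) measure)"
  interpret P: prob_space P
    unfolding P_def sensor_ensemble_def by (intro prob_space_PiM prob_space_uniform_square A)
  define L1 where "L1 = ln (2 * real CARD('m) / \<delta>)"
  have L1_ge: "2 \<le> L1" using L1 by (simp add: L1_def)
  then have L1_pos: "0 < L1" by linarith
  have "exp L1 = 2 * real CARD('m) / \<delta>" using \<delta> by (simp add: L1_def)
  then have e: "exp (- L1) = \<delta> / (2 * real CARD('m))" by (simp add: exp_minus)
  obtain G1 where G1: "G1 \<in> sets P" "1 - real (card S) * exp (- L1) \<le> measure P G1"
    and frame: "\<forall>a\<in>G1. \<forall>x. real CARD('n) / 2 * (\<Sum>i\<in>S. (norm (x i))\<^sup>2) \<le>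
        (\<Sum>q\<in>UNIV. (norm (cdot S (\<lambda>k. cnj (green c r (a q) k)) x))\<^sup>2)"
    using frame_sensors [OF A c N lat S s L1_ge n [folded L1_def]] unfolding P_def by (elim bexE conjE)
  obtain G2 where G2: "G2 \<in> sets P" "1 - 2 * (real CARD('m) * exp (- L1))\<^sup>2 \<le> measure P G2"
    and coh: "\<forall>a\<in>G2. \<forall>i j. i \<noteq> j \<longrightarrow>
      (norm (\<Sum>q\<in>UNIV. cnj (green c r (a q) i) * green c r (a q) j))\<^sup>2 \<le> 4 * L1 * real CARD('n)"
    using coherent_sensors [OF A c N lat L1_pos, where 'n = 'n] unfolding P_def by (elim bexE conjE)
  have "real (card S) * exp (- L1) \<le> real CARD('m) * exp (- L1)"
    by (intro mult_right_mono) (simp_all add: card_mono)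
  also have "\<dots> = \<delta> / 2" by (simp add: e)
  finally have "1 - \<delta> / 2 \<le> measure P G1" using G1 by linarith
  moreover have "2 * (real CARD('m) * exp (- L1))\<^sup>2 = \<delta> * \<delta> / 2"
    by (simp add: e power2_eq_square)
  moreover have "\<delta> * \<delta> / 2 \<le> \<delta> / 2" using \<delta> by (simp add: mult_left_le)
  ultimately have "1 - \<delta> \<le> measure P (G1 \<inter> G2)"
    using P.measure_Int_ge [OF G1(1) G2(1)] G2(2) by linarith
  then show ?thesis
    using G1 G2 frame coh unfolding P_def L1_def by (intro bexI [of _ "G1 \<inter> G2"]) auto
qed

text \<open>The terms subtracted besides 2\<delta> and 2\<epsilon> are nonnegative, so it suffices
  to reach (1 - 2\<delta>)(1 - 2\<epsilon>) when both brackets are positive. Clamping the brackets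
  at 0 rules out a spurious positive product of two negative ones.\<close>

theorem theorem2:
  fixes z0 l A lam \<omega> \<rho> \<delta> K \<epsilon> p :: real
    and L m n s :: nat
    and r :: "'m::finite \<Rightarrow> real \<times> real"
    and T :: "'t measure"
    and X :: "'t \<Rightarrow> complex^'m"
  defines "\<omega> \<equiv> 2 * pi / lam"
    and "\<rho> \<equiv> lam * z0 / (l * A)"
    and "p \<equiv> (ln (real m) - ln \<epsilon>) / (288 * sqrt (exp 1) * ln (real s))"
  assumes "z0 > 0" and "l > 0" and "A > 0" and "lam > 0"
    and "CARD('m) = m" and "m = L\<^sup>2" and "CARD('n::finite) = n"
    and "square_lattice L l r"
    and "1 / \<rho> \<in> \<nat>"
    and "s \<ge> 2"
    and "target_ensemble s T X"
    and "0 < \<epsilon>" and "\<epsilon> < 1"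
    and "\<delta> > 0" and "K > 0"
    and "real m \<le> \<delta> / 2 * exp (K\<^sup>2 / 2)"
    and "real s < real n / (64 * ln (2 * real m / \<delta>) * ln (real m / \<epsilon>))"
  shows "measure (sensor_ensemble A \<Otimes>\<^sub>M T)
           {(a, t) \<in> space ((sensor_ensemble A :: ('n \<Rightarrow> real \<times> real) measure) \<Otimes>\<^sub>M T).
              BP_recovers (sensing_matrix \<omega> z0 r a) (X t)}
         \<ge> max 0 (1 - 2 * \<delta> - \<rho> * real n * (real n - 1) powr (3 / 2) / sqrt (real m)) *
           max 0 (1 - 2 * \<epsilon> - real s powr (- p))"
    (is "?P \<ge> max 0 ?f1 * max 0 ?f2")
proof -
  have \<rho>: "0 < \<rho>" using assms(4-7) by (simp add: \<rho>_def)
  have f1: "?f1 \<le> 1 - 2 * \<delta>" using \<rho> by simp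
  have f2: "?f2 \<le> 1 - 2 * \<epsilon>" by simp
  show ?thesis
  proof (cases "0 < ?f1 \<and> 0 < ?f2")
    case False
    then have "max 0 ?f1 = 0 \<or> max 0 ?f2 = 0" by auto
    then show ?thesis by auto
  next
    case True
    then have \<delta>: "\<delta> < 1 / 2" and \<epsilon>: "\<epsilon> < 1 / 2" using f1 f2 by linarith+
    have max_le: "max 0 ?f1 * max 0 ?f2 \<le> (1 - 2 * \<delta>) * (1 - 2 * \<epsilon>)"
      using True f1 f2 by (intro mult_mono) auto
    show ?thesis
    proof (cases "m = 1")
      case True
      define Q where "Q = (sensor_ensemble A :: ('n \<Rightarrow> real \<times> real) measure) \<Otimes>\<^sub>M T"
      interpret T: prob_space T using assms(14) by (simp add: target_ensemble_def)
      interpret P: prob_space "sensor_ensemble A :: ('n \<Rightarrow> real \<times> real) measure"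
        unfolding sensor_ensemble_def by (intro prob_space_PiM prob_space_uniform_square assms)
      interpret PT: pair_prob_space "sensor_ensemble A :: ('n \<Rightarrow> real \<times> real) measure" T ..
      have "?P = measure Q (space Q)"
        using BP_recovers_singleton [where 'm = 'm and 'n = 'n] True assms(8)
        by (intro arg_cong2 [where f = measure]) (auto simp: Q_def)
      then have "?P = 1" unfolding Q_def using PT.prob_space by simp
      moreover have "(1 - 2 * \<delta>) * (1 - 2 * \<epsilon>) \<le> 1 * 1"
        using \<delta> \<epsilon> assms(15,17) by (intro mult_mono) auto
      ultimately show ?thesis using max_le by linarith
    next
      case False
      have "1 \<le> m" using assms(8) by (metis One_nat_def Suc_leI zero_less_card_finite)
      \<comment> \<open>A square other than 0 and 1 is at least 4. With \<delta> < 1/2 and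
        \<epsilon> < 1 this gives 2 \<le> L1 and 1 \<le> L2.\<close>
      with False assms(9) have "2 \<le> L" by (cases L; cases "L - 1") auto
      then have "2\<^sup>2 \<le> L\<^sup>2" by (intro power_mono) auto
      then have "4 \<le> m" using assms(9) by simp
      then have m: "4 \<le> real m" by simp
      define L1 where "L1 = ln (2 * real m / \<delta>)"
      define L2 where "L2 = ln (real m / \<epsilon>)"
      have e1: "exp (1 :: real) \<le> 3" by (rule exp_le)
      have "exp (2 :: real) = exp 1 * exp 1" by (simp flip: exp_add)
      also have "\<dots> \<le> 3 * 3" using e1 by (intro mult_mono) auto
      also have "\<dots> \<le> 2 * real m / \<delta>"
        using m \<delta> assms(17) by (simp add: pos_le_divide_eq)
      finally have L1: "2 \<le> L1" using m assms(17) by (simp add: L1_def ln_ge_iff)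
      have "exp 1 * \<epsilon> \<le> 3 * 1" using e1 assms(15,16) by (intro mult_mono) auto
      then have "exp 1 * \<epsilon> \<le> real m" using m by linarith
      then have "exp 1 \<le> real m / \<epsilon>" using assms(15) by (simp only: pos_le_divide_eq)
      then have L2: "1 \<le> L2" using m assms(15) by (simp add: L2_def ln_ge_iff)
      have n: "64 * real s * L1 * L2 < real CARD('n)"
        using assms(20) L1 L2 assms(10) unfolding L1_def [symmetric] L2_def [symmetric]
        by (simp add: pos_less_divide_eq mult_ac)
      have "64 * real s * L1 * 1 \<le> 64 * real s * L1 * L2"
        using L1 L2 by (intro mult_left_mono mult_nonneg_nonneg) auto
      then have n1: "64 * real s * L1 < real CARD('n)" using n by linarith
      obtain N where N: "1 / \<rho> = real N" using assms(12) by (auto simp: Nats_def)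
      then have "0 < N" using \<rho> by (intro Nat.gr0I) auto
      \<comment> \<open>The integrality of 1/\<rho> enters here: \<omega> l / z0 equals 2 pi l /
        (lam z0), and l A / (lam z0) = N.\<close>
      have c: "2 * (\<omega> / (2 * z0)) * l = 2 * pi * real N / A"
        using assms(4-7) unfolding N [symmetric] \<rho>_def \<omega>_def by (simp add: field_simps)
      have "\<forall>S\<in>{S :: 'm set. card S \<le> s}. \<exists>G. G \<in> sets (sensor_ensemble A :: ('n \<Rightarrow> real \<times> real) measure) \<and>
        1 - \<delta> \<le> measure (sensor_ensemble A) G \<and>
        (\<forall>a\<in>G. (\<forall>x. real CARD('n) / 2 * (\<Sum>i\<in>S. (norm (x i))\<^sup>2) \<le>
            (\<Sum>q\<in>UNIV. (norm (cdot S (\<lambda>k. cnj (green (\<omega> / (2 * z0)) r (a q) k)) x))\<^sup>2)) \<and>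
          (\<forall>i j. i \<noteq> j \<longrightarrow> (norm (\<Sum>q\<in>UNIV. cnj (green (\<omega> / (2 * z0)) r (a q) i) * green (\<omega> / (2 * z0)) r (a q) j))\<^sup>2
            \<le> 4 * L1 * real CARD('n)))"
        using good_sensors [OF assms(6) c \<open>0 < N\<close> assms(11), of _ s \<delta>, where 'n = 'n, unfolded assms(8) Bex_def]
          assms(13,17) \<delta> L1 n1 unfolding L1_def by simp
      from bchoice [OF this] obtain G where G:
        "\<forall>S\<in>{S :: 'm set. card S \<le> s}. G S \<in> sets (sensor_ensemble A :: ('n \<Rightarrow> real \<times> real) measure) \<and>
        1 - \<delta> \<le> measure (sensor_ensemble A) (G S) \<and>
        (\<forall>a\<in>G S. (\<forall>x. real CARD('n) / 2 * (\<Sum>i\<in>S. (norm (x i))\<^sup>2) \<le>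
            (\<Sum>q\<in>UNIV. (norm (cdot S (\<lambda>k. cnj (green (\<omega> / (2 * z0)) r (a q) k)) x))\<^sup>2)) \<and>
          (\<forall>i j. i \<noteq> j \<longrightarrow> (norm (\<Sum>q\<in>UNIV. cnj (green (\<omega> / (2 * z0)) r (a q) i) * green (\<omega> / (2 * z0)) r (a q) j))\<^sup>2
            \<le> 4 * L1 * real CARD('n)))"
        by (elim exE)
      have "exp L2 = real m / \<epsilon>" using m assms(15) by (simp add: L2_def)
      then have exp_L2: "exp (- L2) = \<epsilon> / real m" by (simp add: exp_minus)
      have "exp (- 2 * L2) = exp (- L2) * exp (- L2)" by (simp flip: exp_add)
      then have "exp (- 2 * L2) = (\<epsilon> / real m) * (\<epsilon> / real m)" by (simp only: exp_L2)
      \<comment> \<open>The square of \<epsilon>/m in each tail more than pays for the union over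
        \<open>m\<close> columns.\<close>
      then have "2 * real m * exp (- 2 * L2) = 2 * \<epsilon> * (\<epsilon> / real m)" using m by simp
      also have "\<dots> \<le> 2 * \<epsilon> * 1"
        using m assms(15,16) by (intro mult_left_mono) auto
      finally have \<beta>: "1 - 2 * \<epsilon> \<le> 1 - 2 * real CARD('m) * exp (- 2 * L2)" using assms(8) by simp
      have "(1 - 2 * \<delta>) * (1 - 2 * \<epsilon>) \<le> ?P"
      proof (rule prob_recovery [OF assms(6,14), where G = G])
        fix S :: "'m set" assume S: "card S \<le> s"
        then have S': "S \<in> {S. card S \<le> s}" by simp
        note GS = G [THEN bspec, OF S']
        show "G S \<in> sets (sensor_ensemble A)" by (rule GS [THEN conjunct1])
        show "1 - 2 * \<delta> \<le> measure (sensor_ensemble A) (G S)"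
          using GS [THEN conjunct2, THEN conjunct1] assms(17) by linarith
        fix a assume "a \<in> G S"
        note Ga = GS [THEN conjunct2, THEN conjunct2, THEN bspec, OF this]
        have L0: "0 < L1" "0 < L2" using L1 L2 by linarith+
        show "\<exists>E\<in>sets (PiM UNIV (\<lambda>_::'m. uniform_measure lborel {0..2 * pi})).
          1 - 2 * \<epsilon> \<le> measure (PiM UNIV (\<lambda>_::'m. uniform_measure lborel {0..2 * pi})) E \<and>
          (\<forall>\<Theta>\<in>E. \<forall>X. {j. X $ j \<noteq> 0} = S \<longrightarrow> (\<forall>j. X $ j \<noteq> 0 \<longrightarrow> X $ j = of_real (norm (X $ j)) * cis (\<Theta> j)) \<longrightarrow>
            BP_recovers (sensing_matrix \<omega> z0 r a) X)"
          by (rule bexE [OF good_phases [OF Ga [THEN conjunct1, THEN spec]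
                Ga [THEN conjunct2, THEN spec, THEN spec, THEN mp] S L0 less_imp_le [OF n]]], assumption,
              elim conjE, rule bexI, rule conjI, rule order_trans [OF \<beta>], assumption+)
      qed (use \<delta> \<epsilon> in auto)
      then show ?thesis using max_le by linarith
    qed
  qed
qed

end
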